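(* $\sigma(\mathcal L)\cap\Sigma=\sigma(\mathcal S_1)\cap\Sigma$ and $\sigma_x(\mathcal L)\cap\Sigma=\sigma_x(\mathcal S_1)\cap\Sigma$ for $x\in\{p,c,r,e\}$, denoting point, continuous, residual and essential spectrum, respectively.
   Context: $\Omega\subseteq\mathbb R^3$ is a (bounded or unbounded) Lipschitz domain; $\gamma_e,\gamma_m>0$ are constants; $\theta_e,\theta_m\in L^\infty(\Omega)$ are real-valued and non-negative, identified with multiplication operators. $H(\operatorname{curl},\Omega)=\{u\in L^2(\Omega)^3:\operatorname{curl}u\in L^2(\Omega)^3\}$ with its graph norm; $H_0(\operatorname{curl},\Omega)$ is the closure of $C_c^\infty(\Omega)^3$ in it; $\operatorname{curl}$ has domain $H(\operatorname{curl},\Omega)$ and $\operatorname{curl}_0$ is its restriction to $H_0(\operatorname{curl},\Omega)$. $\Theta_e(\omega)=\omega^2+i\gamma_e\omega-\theta_e^2$, $\Theta_m(\omega)=\omega^2+i\gamma_m\omega-\theta_m^2$, $\Sigma=\{\omega\in\mathbb C:\operatorname{Re}(\omega)\operatorname{Im}(\omega+i\gamma_m/2)\ne0\}$. For $\omega\in\mathbb C\setminus\{-i\gamma_e,-i\gamma_m\}$, $$\mathcal L(\omega)=\begin{pmatrix}-\omega+\frac{\theta_e^2}{\omega+i\gamma_e}& i\operatorname{curl}\\ -i\operatorname{curl}_0&-\omega+\frac{\theta_m^2}{\omega+i\gamma_m}\end{pmatrix},\quad \operatorname{dom}\mathcal L(\omega)=H_0(\operatorname{curl},\Omega)\oplus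 H(\operatorname{curl},\Omega)\subset L^2(\Omega)^3\oplus L^2(\Omega)^3.$$ For $\omega\in\Sigma$, $\mathcal S_1(\omega)=\operatorname{curl}\Theta_m(\omega)^{-1}\operatorname{curl}_0-\frac{\Theta_e(\omega)}{(\omega+i\gamma_e)(\omega+i\gamma_m)}$ in $L^2(\Omega)^3$ with domain $\{u\in H_0(\operatorname{curl},\Omega):\Theta_m(\omega)^{-1}\operatorname{curl}_0u\in H(\operatorname{curl},\Omega)\}$. For a pencil $\mathcal T$ on $D\subset\mathbb C$, $\sigma_x(\mathcal T)=\{\omega\in D:0\in\sigma_x(\mathcal T(\omega))\}$, and likewise for $\sigma$. For an operator $T$, $\sigma_e(T)$ is the set of $\lambda\in\mathbb C$ for which there are $u_n\in\operatorname{dom}T$ with $\|u_n\|=1$, $u_n\rightharpoonup0$, $\|(T-\lambda)u_n\|\to0$. *)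

theory Defs
  imports "HOL-Analysis.Analysis" "HOL-Library.Function_Algebras"
begin

section \<open>Hilbert spaces, unbounded operators and their spectra\<close>

text \<open>
  A Hilbert space is given by a carrier inside a type with pointwise addition, a scalar
  multiplication and an inner product that is linear in the first argument. The inner product
  may be degenerate: \<open>L\<^sup>2\<close> is represented by square-integrable functions, and vectors at
  distance \<open>0\<close> (functions that agree almost everywhere) represent the same element. All notions
  below are therefore phrased through the norm: equality of \<open>u\<close> and \<open>v\<close> in the space
  is \<open>hnorm H (u - v) = 0\<close>.
\<close>

record 'v hspace =
  carr :: "'v set"
  scl :: "complex \<Rightarrow> 'v \<Rightarrow> 'v"
  ip :: "'v \<Rightarrow> 'v \<Rightarrow> complex"

definition hnorm :: "'v hspace \<Rightarrow> 'v \<Rightarrow> real" where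
  "hnorm H u = sqrt (Re (ip H u u))"

definition hsum :: "'u hspace \<Rightarrow> 'v hspace \<Rightarrow> ('u \<times> 'v) hspace" where
  "hsum H K = \<lparr> carr = carr H \<times> carr K,
                scl = (\<lambda>c (u, v). (scl H c u, scl K c v)),
                ip = (\<lambda>(u, v) (u', v'). ip H u u' + ip K v v') \<rparr>"

record 'v oper =
  odom :: "'v set"
  omap :: "'v \<Rightarrow> 'v"

definition shift :: "'v::minus hspace \<Rightarrow> 'v oper \<Rightarrow> complex \<Rightarrow> 'v oper" where
  "shift H T l = T \<lparr> omap := (\<lambda>u. omap T u - scl H l u) \<rparr>"

definition injective_op :: "'v::minus hspace \<Rightarrow> 'v oper \<Rightarrow> bool" where
  "injective_op H T \<longleftrightarrow>
     (\<forall>u\<in>odom T. \<forall>v\<in>odom T. hnorm H (omap T u - omap T v) = 0 \<longrightarrow> hnorm H (u - v) = 0)"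

definition surjective_op :: "'v::minus hspace \<Rightarrow> 'v oper \<Rightarrow> bool" where
  "surjective_op H T \<longleftrightarrow> (\<forall>f\<in>carr H. \<exists>u\<in>odom T. hnorm H (f - omap T u) = 0)"

definition dense_range_op :: "'v::minus hspace \<Rightarrow> 'v oper \<Rightarrow> bool" where
  "dense_range_op H T \<longleftrightarrow>
     (\<forall>f\<in>carr H. \<forall>e>0. \<exists>u\<in>odom T. hnorm H (f - omap T u) < e)"

definition bounded_inverse_op :: "'v hspace \<Rightarrow> 'v oper \<Rightarrow> bool" where
  "bounded_inverse_op H T \<longleftrightarrow> (\<exists>C. \<forall>u\<in>odom T. hnorm H u \<le> C * hnorm H (omap T u))"

definition spectrum :: "'v::minus hspace \<Rightarrow> 'v oper \<Rightarrow> complex set" where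
  "spectrum H T = {l. \<not> (injective_op H (shift H T l) \<and> surjective_op H (shift H T l)
                         \<and> bounded_inverse_op H (shift H T l))}"

definition point_spectrum :: "'v::minus hspace \<Rightarrow> 'v oper \<Rightarrow> complex set" where
  "point_spectrum H T = {l. \<not> injective_op H (shift H T l)}"

text \<open>For closed \<open>T\<close>, \<open>l \<in> spectrum H T\<close> below says that \<open>T - l\<close> is not onto.\<close>

definition continuous_spectrum :: "'v::minus hspace \<Rightarrow> 'v oper \<Rightarrow> complex set" where
  "continuous_spectrum H T =
     {l \<in> spectrum H T. injective_op H (shift H T l) \<and> dense_range_op H (shift H T l)}"

definition residual_spectrum :: "'v::minus hspace \<Rightarrow> 'v oper \<Rightarrow> complex set" where
  "residual_spectrum H T =
     {l. injective_op H (shift H T l) \<and> \<not> dense_range_op H (shift H T l)}"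

definition essential_spectrum :: "'v::minus hspace \<Rightarrow> 'v oper \<Rightarrow> complex set" where
  "essential_spectrum H T =
     {l. \<exists>u :: nat \<Rightarrow> 'v. (\<forall>n. u n \<in> odom T \<and> hnorm H (u n) = 1)
          \<and> (\<forall>v\<in>carr H. (\<lambda>n. ip H (u n) v) \<longlonglongrightarrow> 0)
          \<and> (\<lambda>n. hnorm H (omap (shift H T l) (u n))) \<longlonglongrightarrow> 0}"

definition pencil_set :: "('v oper \<Rightarrow> complex set) \<Rightarrow> complex set \<Rightarrow> (complex \<Rightarrow> 'v oper) \<Rightarrow> complex set"
  where "pencil_set \<sigma> D \<T> = {\<omega> \<in> D. 0 \<in> \<sigma> (\<T> \<omega>)}"


section \<open>Function spaces\<close>

type_synonym vfield = "real^3 \<Rightarrow> complex^3"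

definition lipschitz_domain :: "(real^3) set \<Rightarrow> bool" where
  "lipschitz_domain \<Omega> \<longleftrightarrow> open \<Omega> \<and> connected \<Omega> \<and> \<Omega> \<noteq> {} \<and>
     (\<forall>p\<in>frontier \<Omega>. \<exists>U (Q :: real^3 \<Rightarrow> real^3) (h :: real^2 \<Rightarrow> real) L.
        open U \<and> p \<in> U \<and> orthogonal_transformation Q \<and> L-lipschitz_on UNIV h \<and>
        \<Omega> \<inter> U = {p + Q y | y. h (vector [y$1, y$2]) < y$3} \<inter> U)"

definition Linfty :: "(real^3) set \<Rightarrow> (real^3 \<Rightarrow> real) set" where
  "Linfty \<Omega> = {f \<in> borel_measurable (lebesgue_on \<Omega>). \<exists>C. AE x in lebesgue_on \<Omega>. \<bar>f x\<bar> \<le> C}"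

definition L2 :: "(real^3) set \<Rightarrow> vfield hspace" where
  "L2 \<Omega> = \<lparr> carr = {u \<in> borel_measurable (lebesgue_on \<Omega>).
                      integrable (lebesgue_on \<Omega>) (\<lambda>x. (norm (u x))\<^sup>2)},
             scl = (\<lambda>c u x. c *s u x),
             ip = (\<lambda>u v. LINT x|lebesgue_on \<Omega>. (\<Sum>k\<in>UNIV. u x $ k * cnj (v x $ k))) \<rparr>"

definition partial :: "3 \<Rightarrow> vfield \<Rightarrow> vfield" where
  "partial j f = (\<lambda>x. frechet_derivative f (at x) (axis j 1))"

fun Ck :: "nat \<Rightarrow> vfield \<Rightarrow> bool" where
  "Ck 0 f \<longleftrightarrow> continuous_on UNIV f"
| "Ck (Suc k) f \<longleftrightarrow> f differentiable_on UNIV \<and> (\<forall>j. Ck k (partial j f))"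

definition test_fields :: "(real^3) set \<Rightarrow> vfield set" where
  "test_fields \<Omega> = {f. (\<forall>k. Ck k f) \<and> compact (closure {x. f x \<noteq> 0}) \<and> closure {x. f x \<noteq> 0} \<subseteq> \<Omega>}"

definition classical_curl :: "vfield \<Rightarrow> vfield" where
  "classical_curl f = (\<lambda>x. vector [partial 2 f x $ 3 - partial 3 f x $ 2,
                                   partial 3 f x $ 1 - partial 1 f x $ 3,
                                   partial 1 f x $ 2 - partial 2 f x $ 1])"

text \<open>
  The distributional curl of \<open>u\<close> is \<open>w\<close>. Pairing with the complex conjugates of the test fields
  makes no difference, as the test fields are closed under conjugation.
\<close>

definition is_weak_curl :: "(real^3) set \<Rightarrow> vfield \<Rightarrow> vfield \<Rightarrow> bool" where
  "is_weak_curl \<Omega> u w \<longleftrightarrow>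
     (\<forall>f\<in>test_fields \<Omega>. ip (L2 \<Omega>) w f = ip (L2 \<Omega>) u (classical_curl f))"

text \<open>The weak curl is unique up to null sets; some representative is chosen.\<close>

definition curl :: "(real^3) set \<Rightarrow> vfield oper" where
  "curl \<Omega> = \<lparr> odom = {u \<in> carr (L2 \<Omega>). \<exists>w\<in>carr (L2 \<Omega>). is_weak_curl \<Omega> u w},
               omap = (\<lambda>u. SOME w. w \<in> carr (L2 \<Omega>) \<and> is_weak_curl \<Omega> u w) \<rparr>"

definition Hcurl :: "(real^3) set \<Rightarrow> vfield set" where
  "Hcurl \<Omega> = odom (curl \<Omega>)"

definition curl_norm :: "(real^3) set \<Rightarrow> vfield \<Rightarrow> real" where
  "curl_norm \<Omega> u = sqrt ((hnorm (L2 \<Omega>) u)\<^sup>2 + (hnorm (L2 \<Omega>) (omap (curl \<Omega>) u))\<^sup>2)"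

definition Hcurl0 :: "(real^3) set \<Rightarrow> vfield set" where
  "Hcurl0 \<Omega> = {u \<in> Hcurl \<Omega>. \<forall>e>0. \<exists>f\<in>test_fields \<Omega>. curl_norm \<Omega> (u - f) < e}"

definition curl0 :: "(real^3) set \<Rightarrow> vfield oper" where
  "curl0 \<Omega> = curl \<Omega> \<lparr> odom := Hcurl0 \<Omega> \<rparr>"


section \<open>The Drude--Lorentz pencils\<close>

definition Theta :: "real \<Rightarrow> (real^3 \<Rightarrow> real) \<Rightarrow> complex \<Rightarrow> real^3 \<Rightarrow> complex" where
  "Theta \<gamma> \<theta> \<omega> x = \<omega>\<^sup>2 + \<i> * of_real \<gamma> * \<omega> - of_real ((\<theta> x)\<^sup>2)"

definition Sigma_set :: "real \<Rightarrow> complex set" where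
  "Sigma_set \<gamma>m = {\<omega>. Re \<omega> * Im (\<omega> + \<i> * of_real \<gamma>m / 2) \<noteq> 0}"

definition L_op :: "(real^3) set \<Rightarrow> real \<Rightarrow> real \<Rightarrow> (real^3 \<Rightarrow> real) \<Rightarrow> (real^3 \<Rightarrow> real)
    \<Rightarrow> complex \<Rightarrow> (vfield \<times> vfield) oper" where
  "L_op \<Omega> \<gamma>e \<gamma>m \<theta>e \<theta>m \<omega> =
     \<lparr> odom = Hcurl0 \<Omega> \<times> Hcurl \<Omega>,
       omap = (\<lambda>(u, v).
         (\<lambda>x. (- \<omega> + of_real ((\<theta>e x)\<^sup>2) / (\<omega> + \<i> * of_real \<gamma>e)) *s u x
               + \<i> *s omap (curl \<Omega>) v x,
          \<lambda>x. (- \<i>) *s omap (curl0 \<Omega>) u x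
               + (- \<omega> + of_real ((\<theta>m x)\<^sup>2) / (\<omega> + \<i> * of_real \<gamma>m)) *s v x)) \<rparr>"

definition S1_op :: "(real^3) set \<Rightarrow> real \<Rightarrow> real \<Rightarrow> (real^3 \<Rightarrow> real) \<Rightarrow> (real^3 \<Rightarrow> real)
    \<Rightarrow> complex \<Rightarrow> vfield oper" where
  "S1_op \<Omega> \<gamma>e \<gamma>m \<theta>e \<theta>m \<omega> =
     \<lparr> odom = {u \<in> Hcurl0 \<Omega>. (\<lambda>x. inverse (Theta \<gamma>m \<theta>m \<omega> x) *s omap (curl0 \<Omega>) u x) \<in> Hcurl \<Omega>},
       omap = (\<lambda>u x.
         omap (curl \<Omega>) (\<lambda>y. inverse (Theta \<gamma>m \<theta>m \<omega> y) *s omap (curl0 \<Omega>) u y) x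
         - (Theta \<gamma>e \<theta>e \<omega> x / ((\<omega> + \<i> * of_real \<gamma>e) * (\<omega> + \<i> * of_real \<gamma>m))) *s u x) \<rparr>"

end

theory Submission
  imports Defs
begin

text \<open>
  Solving the second row of \<open>\<L>(\<omega>) (u, v) = (f, 0)\<close> for \<open>v\<close> gives \<open>v = - \<i> (\<omega> + \<i> \<gamma>\<^sub>m) / \<Theta>\<^sub>m curl\<^sub>0 u\<close>, and the
  first row becomes \<open>(\<omega> + \<i> \<gamma>\<^sub>m) \<S>\<^sub>1(\<omega>) u = f\<close>. This settles right-hand sides \<open>(f, 0)\<close>. A general
  \<open>(f, g)\<close> cannot be treated in the same way, as \<open>g / \<Theta>\<^sub>m\<close> need not lie in \<open>H(curl)\<close>. Instead, on \<open>\<Sigma>\<close> the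
  imaginary part of \<open>\<Theta>\<^sub>m\<close> is a nonzero constant, so that for a suitable \<open>\<kappa> \<in> {\<i>, - \<i>}\<close> the form
  \<open>\<langle>u, \<phi>\<rangle> + \<kappa> \<langle>\<Theta>\<^sub>m\<^sup>-\<^sup>1 curl\<^sub>0 u, curl\<^sub>0 \<phi>\<rangle>\<close> is coercive on \<open>H\<^sub>0(curl)\<close>. By the Lax--Milgram lemma, \<open>\<L>(\<omega>)\<close> plus a
  bounded perturbation of the upper left entry has a bounded inverse. Subtracting the solution of
  the perturbed problem reduces every \<open>(f, g)\<close> to a right-hand side \<open>(m, 0)\<close>, with \<open>m\<close> bounded by \<open>(f, g)\<close>;
  surjectivity, density of the range, bounded inverses and singular sequences are transferred in
  this way.
\<close>

section \<open>Semi-inner product spaces and the Lax--Milgram lemma\<close>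

text \<open>The perturbed problem keeps the second row unchanged. Hence two pairs with the same
  second row differ by a pair with second row zero, and such a pair has its first component in the
  domain of the Schur complement automatically: there \<open>P (A u)\<close> is a multiple of the
  second component. The Schur complement does not see the second component. It is recovered by an
  energy estimate: Green's formula and coercivity bound \<open>A u\<close>, and with it
  \<open>lift u\<close>, by \<open>u\<close> and \<open>schur u\<close>. This carries injectivity
  and bounded inverses to the block operator, and it keeps the first components of a singular
  sequence from tending to zero. A further obstacle is that L2 consists of functions, not of
  classes, and that the curl is a chosen representative. It is linear only up to null fields, so
  identities between operator values are mostly checked by pairing with all vectors. Of the curl,
  the abstract part uses only that the operator on \<open>D\<close> is the adjoint of its
  restriction to the closed domain \<open>D0\<close>. For the weak curl this rests on integration by
  parts and on the separation of fields by test fields.\<close>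

locale semi_inner =
  fixes H :: "'v::ab_group_add hspace"
  assumes vs: "vector_space (scl H)"
    and zero_carr [simp]: "0 \<in> carr H"
    and add_carr [simp]: "\<lbrakk>x \<in> carr H; y \<in> carr H\<rbrakk> \<Longrightarrow> x + y \<in> carr H"
    and scl_carr [simp]: "x \<in> carr H \<Longrightarrow> scl H c x \<in> carr H"
    and ip_add: "\<lbrakk>x \<in> carr H; y \<in> carr H; z \<in> carr H\<rbrakk> \<Longrightarrow> ip H (x + y) z = ip H x z + ip H y z"
    and ip_scl: "\<lbrakk>x \<in> carr H; z \<in> carr H\<rbrakk> \<Longrightarrow> ip H (scl H c x) z = c * ip H x z"
    and ip_cnj: "\<lbrakk>x \<in> carr H; y \<in> carr H\<rbrakk> \<Longrightarrow> ip H y x = cnj (ip H x y)"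
    and ip_pos: "x \<in> carr H \<Longrightarrow> 0 \<le> Re (ip H x x)"
begin

sublocale vs: vector_space "scl H" by (rule vs)

lemma uminus_carr [simp]: "x \<in> carr H \<Longrightarrow> - x \<in> carr H"
  using scl_carr[of x "- 1"] by simp

lemma diff_carr [simp]: "\<lbrakk>x \<in> carr H; y \<in> carr H\<rbrakk> \<Longrightarrow> x - y \<in> carr H"
  using add_carr[of x "- y"] by simp

lemma ip_uminus: "\<lbrakk>x \<in> carr H; z \<in> carr H\<rbrakk> \<Longrightarrow> ip H (- x) z = - ip H x z"
  using ip_scl[of x z "- 1"] by simp

lemma ip_diff: "\<lbrakk>x \<in> carr H; y \<in> carr H; z \<in> carr H\<rbrakk> \<Longrightarrow> ip H (x - y) z = ip H x z - ip H y z"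
  using ip_add[of x "- y" z] by (simp add: ip_uminus)

lemma ip_add_right: "\<lbrakk>x \<in> carr H; y \<in> carr H; z \<in> carr H\<rbrakk> \<Longrightarrow> ip H z (x + y) = ip H z x + ip H z y"
  by (simp add: ip_cnj[of _ z] ip_add)

lemma ip_diff_right: "\<lbrakk>x \<in> carr H; y \<in> carr H; z \<in> carr H\<rbrakk> \<Longrightarrow> ip H z (x - y) = ip H z x - ip H z y"
  by (simp add: ip_cnj[of _ z] ip_diff)

lemma ip_uminus_right: "\<lbrakk>x \<in> carr H; z \<in> carr H\<rbrakk> \<Longrightarrow> ip H z (- x) = - ip H z x"
  by (simp add: ip_cnj[of _ z] ip_uminus)

lemma ip_scl_right: "\<lbrakk>x \<in> carr H; z \<in> carr H\<rbrakk> \<Longrightarrow> ip H z (scl H c x) = cnj c * ip H z x"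
  by (simp add: ip_cnj[of _ z] ip_scl)

lemmas ip_simps = ip_add ip_diff ip_uminus ip_scl ip_add_right ip_diff_right ip_uminus_right ip_scl_right

lemma ip_zero [simp]: "x \<in> carr H \<Longrightarrow> ip H 0 x = 0" "x \<in> carr H \<Longrightarrow> ip H x 0 = 0"
  using ip_scl[of 0 x 0] ip_scl_right[of 0 x 0] by auto

lemma hnorm_sq: "x \<in> carr H \<Longrightarrow> (hnorm H x)\<^sup>2 = Re (ip H x x)"
  by (simp add: hnorm_def ip_pos)

lemma hnorm_nonneg [simp]: "x \<in> carr H \<Longrightarrow> 0 \<le> hnorm H x"
  by (simp add: hnorm_def ip_pos)

lemma ip_self: "x \<in> carr H \<Longrightarrow> ip H x x = of_real ((hnorm H x)\<^sup>2)"
  using ip_cnj[of x x] by (auto simp: hnorm_sq complex_eq_iff)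

lemma hnorm_sq_add:
  "\<lbrakk>x \<in> carr H; y \<in> carr H\<rbrakk> \<Longrightarrow>
    (hnorm H (x + y))\<^sup>2 = (hnorm H x)\<^sup>2 + (hnorm H y)\<^sup>2 + 2 * Re (ip H x y)"
  by (simp add: hnorm_sq ip_simps ip_cnj[of x y])

lemma hnorm_sq_diff:
  "\<lbrakk>x \<in> carr H; y \<in> carr H\<rbrakk> \<Longrightarrow>
    (hnorm H (x - y))\<^sup>2 = (hnorm H x)\<^sup>2 + (hnorm H y)\<^sup>2 - 2 * Re (ip H x y)"
  by (simp add: hnorm_sq ip_simps ip_cnj[of x y])

lemma hnorm_scl: "x \<in> carr H \<Longrightarrow> hnorm H (scl H c x) = cmod c * hnorm H x"
proof -
  assume x: "x \<in> carr H"
  have "ip H (scl H c x) (scl H c x) = (c * cnj c) * ip H x x" using x by (simp add: ip_simps)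
  also have "\<dots> = of_real ((cmod c * hnorm H x)\<^sup>2)"
    unfolding complex_norm_square[symmetric] ip_self[OF x] by (simp add: power_mult_distrib)
  finally have "(hnorm H (scl H c x))\<^sup>2 = (cmod c * hnorm H x)\<^sup>2"
    using x by (simp only: hnorm_sq scl_carr Re_complex_of_real)
  then show ?thesis using x by (simp add: power2_eq_iff_nonneg)
qed

lemma hnorm_zero [simp]: "hnorm H 0 = 0"
  using hnorm_scl[of 0 0] by simp

lemma hnorm_uminus: "x \<in> carr H \<Longrightarrow> hnorm H (- x) = hnorm H x"
  using hnorm_scl[of x "- 1"] by simp

lemma hnorm_minus_commute: "\<lbrakk>x \<in> carr H; y \<in> carr H\<rbrakk> \<Longrightarrow> hnorm H (x - y) = hnorm H (y - x)"
  using hnorm_uminus[of "x - y"] by simp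

text \<open>A vector of norm zero need not be zero, so \<open>hnorm H y = 0\<close> is a case of its
  own: the quadratic in \<open>key\<close> is then affine in \<open>t\<close>, and being nonnegative
  for all \<open>t\<close> forces \<open>a = 0\<close>.\<close>

lemma Cauchy_Schwarz:
  assumes x: "x \<in> carr H" and y: "y \<in> carr H"
  shows "cmod (ip H x y) \<le> hnorm H x * hnorm H y"
proof -
  define a where "a = (cmod (ip H x y))\<^sup>2"
  have key: "0 \<le> (hnorm H x)\<^sup>2 - 2 * t * a + t\<^sup>2 * a * (hnorm H y)\<^sup>2" for t :: real
  proof -
    let ?c = "of_real t * ip H x y"
    have "0 \<le> (hnorm H (x - scl H ?c y))\<^sup>2" by simp
    also have "\<dots> = (hnorm H x)\<^sup>2 + (cmod ?c * hnorm H y)\<^sup>2 - 2 * Re (cnj ?c * ip H x y)"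
      using x y by (simp add: hnorm_sq_diff hnorm_scl ip_scl_right)
    also have "cnj ?c * ip H x y = of_real (t * a)"
      unfolding a_def of_real_mult complex_norm_square by (simp add: mult_ac)
    also have "(cmod ?c * hnorm H y)\<^sup>2 = t\<^sup>2 * a * (hnorm H y)\<^sup>2"
      by (simp add: a_def norm_mult power_mult_distrib)
    finally show ?thesis by simp
  qed
  have a0: "a \<ge> 0" by (simp add: a_def)
  have "a \<le> (hnorm H x)\<^sup>2 * (hnorm H y)\<^sup>2"
  proof (cases "hnorm H y = 0")
    case True
    show ?thesis
    proof (cases "a = 0")
      case False
      then have "a > 0" using a0 by simp
      then show ?thesis using key[of "((hnorm H x)\<^sup>2 + 1) / (2 * a)"] True by (simp add: field_simps)
    qed (use True in simp)
  next
    case False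
    define b where "b = (hnorm H y)\<^sup>2"
    have b: "b > 0" using False by (simp add: b_def)
    then have "(1 / b)\<^sup>2 * a * b = a / b" by (simp add: power2_eq_square)
    then have "a / b \<le> (hnorm H x)\<^sup>2" using key[of "1 / b"] by (simp flip: b_def)
    then show ?thesis using b by (simp add: pos_divide_le_eq flip: b_def)
  qed
  then have "(cmod (ip H x y))\<^sup>2 \<le> (hnorm H x * hnorm H y)\<^sup>2" by (simp add: a_def power_mult_distrib)
  then show ?thesis using x y by (simp add: power2_le_iff_abs_le)
qed

lemma hnorm_triangle:
  assumes x: "x \<in> carr H" and y: "y \<in> carr H"
  shows "hnorm H (x + y) \<le> hnorm H x + hnorm H y"
proof -
  have "Re (ip H x y) \<le> hnorm H x * hnorm H y"
    using Cauchy_Schwarz[OF x y] complex_Re_le_cmod order_trans by blast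
  then have "(hnorm H (x + y))\<^sup>2 \<le> (hnorm H x + hnorm H y)\<^sup>2"
    using x y by (simp add: hnorm_sq_add power2_sum)
  then show ?thesis using x y by (simp add: power2_le_iff_abs_le)
qed

lemma hnorm_triangle_diff:
  "\<lbrakk>x \<in> carr H; y \<in> carr H\<rbrakk> \<Longrightarrow> hnorm H (x - y) \<le> hnorm H x + hnorm H y"
  using hnorm_triangle[of x "- y"] by (simp add: hnorm_uminus)

lemma hnorm_triangle_via:
  "\<lbrakk>x \<in> carr H; y \<in> carr H; z \<in> carr H\<rbrakk> \<Longrightarrow> hnorm H (x - z) \<le> hnorm H (x - y) + hnorm H (y - z)"
  using hnorm_triangle[of "x - y" "y - z"] by simp

lemma hnorm_le_add_diff:
  "\<lbrakk>x \<in> carr H; y \<in> carr H\<rbrakk> \<Longrightarrow> hnorm H x \<le> hnorm H y + hnorm H (x - y)"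
  using hnorm_triangle[of "y" "x - y"] by simp

lemma geometric_steps_Cauchy:
  assumes X: "\<And>n. X n \<in> carr H" and r: "0 \<le> r" "r < 1" and K: "0 \<le> K"
    and step: "\<And>n. hnorm H (X (Suc n) - X n) \<le> K * r ^ n" and e: "e > 0"
  shows "\<exists>N. \<forall>m\<ge>N. \<forall>n\<ge>N. hnorm H (X m - X n) < e"
proof -
  \<comment> \<open>The factor \<open>1 - r ^ k\<close> keeps the exact partial sum of the geometric
    series; the bound without it would not survive the induction step.\<close>
  have gap: "hnorm H (X (n + k) - X n) \<le> K * r ^ n * (1 - r ^ k) / (1 - r)" for n k
  proof (induction k)
    case (Suc k)
    have "hnorm H (X (n + Suc k) - X n) \<le> hnorm H (X (Suc (n + k)) - X (n + k)) + hnorm H (X (n + k) - X n)"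
      using hnorm_triangle_via[OF X X X] by simp
    also have "\<dots> \<le> K * r ^ (n + k) + K * r ^ n * (1 - r ^ k) / (1 - r)"
      using Suc step add_mono by blast
    also have "\<dots> = K * r ^ n * (1 - r ^ Suc k) / (1 - r)"
      using r by (simp add: field_simps power_add)
    finally show ?case .
  qed (use r in simp)
  have gap': "hnorm H (X m - X n) \<le> K / (1 - r) * r ^ n" if "n \<le> m" for m n
  proof -
    have "K * r ^ n * (1 - r ^ (m - n)) \<le> K * r ^ n * 1"
      using r K by (intro mult_left_mono) auto
    then have "K * r ^ n * (1 - r ^ (m - n)) / (1 - r) \<le> K * r ^ n / (1 - r)"
      using r by (intro divide_right_mono) auto
    then show ?thesis using gap[of n "m - n"] that by simp
  qed
  have "(\<lambda>n. K / (1 - r) * r ^ n) \<longlonglongrightarrow> K / (1 - r) * 0"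
    by (intro tendsto_intros LIMSEQ_power_zero) (use r in auto)
  then have "eventually (\<lambda>n. K / (1 - r) * r ^ n < e / 2) sequentially"
    by (rule order_tendstoD(2)) (use e in simp)
  then obtain N where N: "K / (1 - r) * r ^ N < e / 2"
    by (auto simp: eventually_sequentially)
  have "hnorm H (X m - X n) < e" if "m \<ge> N" "n \<ge> N" for m n
    using hnorm_triangle_via[OF X[of m] X[of N] X[of n]] gap'[OF that(1)] gap'[OF that(2)] N
      hnorm_minus_commute[OF X[of N] X[of n]] by linarith
  then show ?thesis by blast
qed

end

section \<open>Completeness, Riesz representation and the Lax-Milgram lemma\<close>

locale semi_hilbert = semi_inner H for H :: "'v::ab_group_add hspace" +
  assumes complete: "\<lbrakk>\<And>n. X n \<in> carr H; \<And>e. e > 0 \<Longrightarrow> \<exists>N. \<forall>m\<ge>N. \<forall>n\<ge>N. hnorm H (X m - X n) < e\<rbrakk>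
      \<Longrightarrow> \<exists>x\<in>carr H. (\<lambda>n::nat. hnorm H (X n - x)) \<longlonglongrightarrow> 0"
begin

text \<open>The representing vector minimises \<open>J x\<close>, that is, the squared norm minus
  \<open>2 * Re (l x)\<close>. The first variation at the minimiser gives the real parts, and
  replacing \<open>x\<close> by \<open>\<i> x\<close> the imaginary parts. The functional is
  conjugate-linear because the inner product is linear in its first argument, where \<open>w\<close>
  stands.\<close>

lemma Riesz_representation:
  fixes l :: "'v \<Rightarrow> complex"
  assumes add: "\<And>x y. \<lbrakk>x \<in> carr H; y \<in> carr H\<rbrakk> \<Longrightarrow> l (x + y) = l x + l y"
    and scl: "\<And>c x. x \<in> carr H \<Longrightarrow> l (scl H c x) = cnj c * l x"
    and bdd: "\<And>x. x \<in> carr H \<Longrightarrow> cmod (l x) \<le> C * hnorm H x"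
  shows "\<exists>w\<in>carr H. \<forall>x\<in>carr H. l x = ip H w x"
proof -
  define J where "J x = (hnorm H x)\<^sup>2 - 2 * Re (l x)" for x
  have J_lb: "- C\<^sup>2 \<le> J x" if "x \<in> carr H" for x
  proof -
    have "Re (l x) \<le> C * hnorm H x" using bdd[OF that] complex_Re_le_cmod order_trans by blast
    moreover have "0 \<le> (hnorm H x - C)\<^sup>2" by simp
    ultimately show ?thesis by (simp add: J_def power2_diff algebra_simps)
  qed
  define m where "m = Inf (J ` carr H)"
  have bdd_J: "bdd_below (J ` carr H)" using J_lb by (intro bdd_belowI2)
  have m_le: "m \<le> J x" if "x \<in> carr H" for x
    unfolding m_def using that bdd_J by (intro cInf_lower) auto
  have near: "\<exists>x\<in>carr H. J x < m + e" if "e > 0" for e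
  proof -
    have "Inf (J ` carr H) < m + e" using that m_def by simp
    moreover have "J ` carr H \<noteq> {}" using zero_carr by blast
    ultimately obtain y where "y \<in> J ` carr H" "y < m + e" using cInf_lessD by metis
    then show ?thesis by auto
  qed
  have "\<forall>n::nat. \<exists>x\<in>carr H. J x < m + 1 / (n + 1)" by (intro allI near) simp
  then obtain X :: "nat \<Rightarrow> 'v" where X: "\<And>n. X n \<in> carr H" and JX: "\<And>n. J (X n) < m + 1 / (n + 1)"
    by metis
  \<comment> \<open>Parallelogram law with the midpoint \<open>?h\<close>: the squared distance
    equals \<open>2 * J (X i) + 2 * J (X j) - 4 * J ?h\<close>, and \<open>J ?h\<close> is at least
    \<open>m\<close>. So a minimising sequence is Cauchy.\<close>
  have gap: "(hnorm H (X i - X j))\<^sup>2 \<le> 2 / (real i + 1) + 2 / (real j + 1)" for i j :: nat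
  proof -
    let ?h = "scl H (1/2) (X i + X j)"
    have n1: "(hnorm H ?h)\<^sup>2 = (hnorm H (X i + X j))\<^sup>2 / 4"
      using X by (simp add: hnorm_scl power_divide)
    have n2: "(hnorm H (X i + X j))\<^sup>2 + (hnorm H (X i - X j))\<^sup>2
        = 2 * (hnorm H (X i))\<^sup>2 + 2 * (hnorm H (X j))\<^sup>2"
      using X by (simp add: hnorm_sq_add hnorm_sq_diff)
    have n3: "Re (l ?h) = (Re (l (X i)) + Re (l (X j))) / 2"
      using X by (simp add: scl add)
    have "(hnorm H (X i - X j))\<^sup>2 = 2 * J (X i) + 2 * J (X j) - 4 * J ?h"
      unfolding J_def n1 n3 using n2 by (simp add: field_simps)
    moreover have "m \<le> J ?h" using X m_le by simp
    moreover have "2 / (real i + 1) = 2 * (1 / (real i + 1))" "2 / (real j + 1) = 2 * (1 / (real j + 1))"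
      by simp_all
    ultimately show ?thesis using JX[of i] JX[of j] by linarith
  qed
  have "\<exists>N. \<forall>i\<ge>N. \<forall>j\<ge>N. hnorm H (X i - X j) < e" if "e > 0" for e
  proof -
    obtain N :: nat where N: "4 / e\<^sup>2 < N" using reals_Archimedean2 by blast
    have "hnorm H (X i - X j) < e" if ij: "i \<ge> N" "j \<ge> N" for i j
    proof -
      have "2 / (real i + 1) \<le> 2 / (real N + 1)" "2 / (real j + 1) \<le> 2 / (real N + 1)"
        using ij by (auto intro!: divide_left_mono)
      moreover have "4 / (real N + 1) = 2 / (real N + 1) + 2 / (real N + 1)" by simp
      moreover have "4 / (real N + 1) < e\<^sup>2"
      proof -
        have "4 < real N * e\<^sup>2" using N \<open>e > 0\<close> by (simp add: pos_divide_less_eq)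
        moreover have "0 < e\<^sup>2" using \<open>e > 0\<close> by simp
        moreover have "e\<^sup>2 * (real N + 1) = real N * e\<^sup>2 + e\<^sup>2" by (simp add: algebra_simps)
        ultimately have "4 < e\<^sup>2 * (real N + 1)" by linarith
        then show ?thesis by (simp add: pos_divide_less_eq)
      qed
      ultimately have "(hnorm H (X i - X j))\<^sup>2 < e\<^sup>2" using gap[of i j] by linarith
      then show ?thesis using \<open>e > 0\<close> by (simp add: power2_less_imp_less)
    qed
    then show ?thesis by blast
  qed
  from complete[OF X this] obtain w where w: "w \<in> carr H" and lim: "(\<lambda>n. hnorm H (X n - w)) \<longlonglongrightarrow> 0"
    by auto
  have Jw: "J w \<le> m"
  proof -
    have "J w \<le> J (X n) + (hnorm H (X n - w) * (2 * hnorm H w + 2 * C + hnorm H (X n - w)) )" for n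
    proof -
      let ?d = "hnorm H (X n - w)"
      have "X n = w + (X n - w)" by simp
      then have "J (X n) = (hnorm H w)\<^sup>2 + ?d\<^sup>2 + 2 * Re (ip H w (X n - w)) - 2 * Re (l w) - 2 * Re (l (X n - w))"
        unfolding J_def using hnorm_sq_add[OF w, of "X n - w"] add[OF w, of "X n - w"] X w by simp
      moreover have "\<bar>Re (ip H w (X n - w))\<bar> \<le> hnorm H w * ?d"
        using Cauchy_Schwarz[OF w, of "X n - w"] abs_Re_le_cmod order_trans X w by (metis diff_carr)
      moreover have "\<bar>Re (l (X n - w))\<bar> \<le> C * ?d"
        using bdd[of "X n - w"] abs_Re_le_cmod order_trans X w by (metis diff_carr)
      moreover have "?d * (2 * hnorm H w + 2 * C + ?d) = 2 * (hnorm H w * ?d) + 2 * (C * ?d) + ?d\<^sup>2"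
        by (simp add: algebra_simps power2_eq_square)
      moreover have "0 \<le> ?d\<^sup>2" by simp
      ultimately show ?thesis unfolding J_def by linarith
    qed
    then have le: "J w \<le> m + 1 / (real n + 1) + hnorm H (X n - w) * (2 * hnorm H w + 2 * C + hnorm H (X n - w))" for n
      using JX[of n] by (meson add_right_mono less_imp_le order_trans)
    have "(\<lambda>n. m + 1 / (real n + 1) + hnorm H (X n - w) * (2 * hnorm H w + 2 * C + hnorm H (X n - w)))
        \<longlonglongrightarrow> m + 0 + 0 * (2 * hnorm H w + 2 * C + 0)"
      using lim LIMSEQ_inverse_real_of_nat
      by (intro tendsto_intros) (auto simp: inverse_eq_divide add.commute)
    from LIMSEQ_le_const[OF this] le show ?thesis by simp
  qed
  have re: "Re (ip H w x) = Re (l x)" if x: "x \<in> carr H" for x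
  proof -
    define s where "s = Re (ip H w x) - Re (l x)"
    have key: "0 \<le> t\<^sup>2 * (hnorm H x)\<^sup>2 + 2 * t * s" for t :: real
    proof -
      have "J w \<le> J (w + scl H (of_real t) x)" using Jw m_le[of "w + scl H (of_real t) x"] w x by simp
      also have "\<dots> = J w + t\<^sup>2 * (hnorm H x)\<^sup>2 + 2 * t * s"
      proof -
        have "(hnorm H (w + scl H (of_real t) x))\<^sup>2 = (hnorm H w)\<^sup>2 + t\<^sup>2 * (hnorm H x)\<^sup>2 + 2 * t * Re (ip H w x)"
          using w x by (simp add: hnorm_sq_add hnorm_scl ip_scl_right power_mult_distrib)
        moreover have "Re (l (w + scl H (of_real t) x)) = Re (l w) + t * Re (l x)"
          using w x by (simp add: add scl)
        ultimately show ?thesis by (simp add: J_def s_def right_diff_distrib)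
      qed
      finally show ?thesis by simp
    qed
    show ?thesis
    proof (rule ccontr)
      assume "Re (ip H w x) \<noteq> Re (l x)"
      then have "s\<^sup>2 > 0" by (simp add: s_def)
      \<comment> \<open>The quadratic in \<open>key\<close> would be negative at
        \<open>t = - s / ?q\<close>; the summand \<open>1\<close> keeps the denominator positive
        when \<open>x\<close> is a null vector.\<close>
      let ?q = "(hnorm H x)\<^sup>2 + 1"
      have q: "?q > 0" by (simp add: add_nonneg_pos)
      define r where "r = s / ?q"
      have "0 \<le> r\<^sup>2 * (hnorm H x)\<^sup>2 - 2 * (r * s)" using key[of "- r"] by simp
      moreover have "r\<^sup>2 * (hnorm H x)\<^sup>2 \<le> r\<^sup>2 * ?q" by (intro mult_left_mono) auto
      moreover have "r\<^sup>2 * ?q = r * s" using q by (simp add: r_def power2_eq_square)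
      moreover have "r * s > 0" using q \<open>s\<^sup>2 > 0\<close> by (simp add: r_def power2_eq_square)
      ultimately show False by linarith
    qed
  qed
  have "l x = ip H w x" if x: "x \<in> carr H" for x
  proof (rule complex_eqI)
    show "Re (l x) = Re (ip H w x)" using re[OF x] by simp
    have "Re (ip H w (scl H \<i> x)) = Re (l (scl H \<i> x))" using re x by simp
    then show "Im (l x) = Im (ip H w x)" using x w by (simp add: ip_scl_right scl)
  qed
  then show ?thesis using w by blast
qed

text \<open>Riesz representation turns the form into a map \<open>B\<close> and the equation into
  \<open>B u = w\<close>. This is solved by the iteration \<open>x - \<rho> (B x - w)\<close>, whose
  increments contract by coercivity if \<open>\<rho>\<close> is small.\<close>

lemma Lax_Milgram:
  fixes a :: "'v \<Rightarrow> 'v \<Rightarrow> complex" and l :: "'v \<Rightarrow> complex"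
  assumes a_add: "\<And>x y z. \<lbrakk>x \<in> carr H; y \<in> carr H; z \<in> carr H\<rbrakk> \<Longrightarrow> a (x + y) z = a x z + a y z"
    and a_scl: "\<And>c x z. \<lbrakk>x \<in> carr H; z \<in> carr H\<rbrakk> \<Longrightarrow> a (scl H c x) z = c * a x z"
    and a_add': "\<And>x y z. \<lbrakk>x \<in> carr H; y \<in> carr H; z \<in> carr H\<rbrakk> \<Longrightarrow> a z (x + y) = a z x + a z y"
    and a_scl': "\<And>c x z. \<lbrakk>x \<in> carr H; z \<in> carr H\<rbrakk> \<Longrightarrow> a z (scl H c x) = cnj c * a z x"
    and a_bdd: "\<And>x y. \<lbrakk>x \<in> carr H; y \<in> carr H\<rbrakk> \<Longrightarrow> cmod (a x y) \<le> M * hnorm H x * hnorm H y"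
    and coercive: "\<And>x. x \<in> carr H \<Longrightarrow> d * (hnorm H x)\<^sup>2 \<le> Re (a x x)" and d: "0 < d"
    and l_add: "\<And>x y. \<lbrakk>x \<in> carr H; y \<in> carr H\<rbrakk> \<Longrightarrow> l (x + y) = l x + l y"
    and l_scl: "\<And>c x. x \<in> carr H \<Longrightarrow> l (scl H c x) = cnj c * l x"
    and l_bdd: "\<And>x. x \<in> carr H \<Longrightarrow> cmod (l x) \<le> C * hnorm H x"
  shows "\<exists>u\<in>carr H. \<forall>x\<in>carr H. a u x = l x"
proof -
  obtain w where w: "w \<in> carr H" and lw: "\<And>x. x \<in> carr H \<Longrightarrow> l x = ip H w x"
    using Riesz_representation[of l C] l_add l_scl l_bdd by blast
  have "\<forall>x\<in>carr H. \<exists>b\<in>carr H. \<forall>y\<in>carr H. a x y = ip H b y"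
    by (intro ballI Riesz_representation[of _ "M * hnorm H _"]) (auto simp: a_add' a_scl' intro: a_bdd)
  then obtain B where B: "\<And>x. x \<in> carr H \<Longrightarrow> B x \<in> carr H"
    and aB: "\<And>x y. \<lbrakk>x \<in> carr H; y \<in> carr H\<rbrakk> \<Longrightarrow> a x y = ip H (B x) y" by metis
  \<comment> \<open>Enlarging \<open>M\<close> to at least \<open>d\<close> makes it positive and
    ensures \<open>q \<ge> 0\<close> below.\<close>
  define M' where "M' = max M d"
  have M': "M' > 0" "M \<le> M'" "d \<le> M'" using d by (auto simp: M'_def)
  \<comment> \<open>This value minimises \<open>1 - 2 * \<rho> * d + \<rho>^2 * M'^2\<close>, the
    bound for the contraction factor of the squared norm; the minimum is \<open>q\<close>.\<close>
  define \<rho> where "\<rho> = d / M'\<^sup>2"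
  have \<rho>: "\<rho> > 0" using d M' by (simp add: \<rho>_def)
  define X where "X = rec_nat 0 (\<lambda>_ x. x - scl H (of_real \<rho>) (B x - w))"
  have X_Suc: "X (Suc n) = X n - scl H (of_real \<rho>) (B (X n) - w)" for n by (simp add: X_def)
  have X: "X n \<in> carr H" for n
  proof (induction n)
    case (Suc n) then show ?case using B w by (simp add: X_Suc)
  qed (simp add: X_def)
  define D where "D n = X (Suc n) - X n" for n
  have D: "D n \<in> carr H" for n using X by (simp add: D_def)
  have D_eq: "D n = - scl H (of_real \<rho>) (B (X n) - w)" for n by (simp add: D_def X_Suc)
  define q where "q = 1 - d\<^sup>2 / M'\<^sup>2"
  have q: "0 \<le> q" "q < 1"
    using d M' by (auto simp: q_def field_simps power_mono)
  have step: "(hnorm H (D (Suc n)))\<^sup>2 \<le> q * (hnorm H (D n))\<^sup>2" for n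
  proof -
    \<comment> \<open>\<open>B\<close> is chosen pointwise among vectors determined only up to null
      vectors, so it need not be additive. Its increments are therefore related to
      \<open>a (D n)\<close> only through inner products.\<close>
    define b where "b = B (X (Suc n)) - B (X n)"
    have b: "b \<in> carr H" using B X by (simp add: b_def)
    have ipb: "ip H b y = a (D n) y" if "y \<in> carr H" for y
    proof -
      have "a (X (Suc n)) y = a (D n) y + a (X n) y"
        using a_add[OF D X that, of n n] by (simp add: D_def)
      then show ?thesis using that X B by (simp add: b_def ip_diff flip: aB)
    qed
    have nb: "hnorm H b \<le> M' * hnorm H (D n)"
    proof (cases "hnorm H b = 0")
      case False
      have "(hnorm H b)\<^sup>2 = cmod (ip H b b)" using ip_self[OF b] by (simp add: norm_power)
      also have "\<dots> \<le> M * hnorm H (D n) * hnorm H b" using a_bdd[OF D b] ipb[OF b] by simp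
      also have "\<dots> \<le> M' * hnorm H (D n) * hnorm H b"
        using M' b D by (intro mult_right_mono) auto
      finally show ?thesis using False hnorm_nonneg[OF b] by (simp add: power2_eq_square)
    qed (use M' D in simp)
    have "D (Suc n) = D n - scl H (of_real \<rho>) b"
      by (simp add: D_eq b_def vs.scale_right_diff_distrib)
    then have "(hnorm H (D (Suc n)))\<^sup>2
        = (hnorm H (D n))\<^sup>2 + \<rho>\<^sup>2 * (hnorm H b)\<^sup>2 - 2 * \<rho> * Re (a (D n) (D n))"
      using b D \<rho> ip_cnj[OF b D, of n] ipb[OF D, of n]
      by (simp add: hnorm_sq_diff hnorm_scl ip_scl_right power_mult_distrib)
    also have "\<dots> \<le> (hnorm H (D n))\<^sup>2 + \<rho>\<^sup>2 * (M' * hnorm H (D n))\<^sup>2 - 2 * \<rho> * (d * (hnorm H (D n))\<^sup>2)"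
      using \<rho> nb b coercive[OF D, of n]
      by (intro add_mono diff_mono mult_left_mono power_mono mult_nonneg_nonneg) (auto simp: hnorm_nonneg[OF D])
    also have "\<dots> = q * (hnorm H (D n))\<^sup>2"
      using M' by (simp add: q_def \<rho>_def field_simps power2_eq_square)
    finally show ?thesis .
  qed
  have Dn: "hnorm H (D n) \<le> hnorm H (D 0) * sqrt q ^ n" for n
  proof (induction n)
    case (Suc n)
    have "sqrt ((hnorm H (D (Suc n)))\<^sup>2) \<le> sqrt (q * (hnorm H (D n))\<^sup>2)" using step real_sqrt_le_mono by blast
    then have "hnorm H (D (Suc n)) \<le> sqrt q * hnorm H (D n)" using D by (simp add: real_sqrt_mult)
    also have "\<dots> \<le> sqrt q * (hnorm H (D 0) * sqrt q ^ n)" using Suc q by (intro mult_left_mono) auto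
    finally show ?case by (simp add: mult_ac)
  qed simp
  have sq: "0 \<le> sqrt q" "sqrt q < 1" using q by auto
  have "\<exists>u\<in>carr H. (\<lambda>n. hnorm H (X n - u)) \<longlonglongrightarrow> 0"
    by (intro complete X geometric_steps_Cauchy[OF X sq, of "hnorm H (D 0)"])
      (use Dn D in \<open>auto simp: D_def\<close>)
  then obtain u where u: "u \<in> carr H" and lim: "(\<lambda>n. hnorm H (X n - u)) \<longlonglongrightarrow> 0" by auto
  have D0: "(\<lambda>n. hnorm H (D n)) \<longlonglongrightarrow> 0"
  proof (rule tendsto_sandwich[of "\<lambda>_. 0"])
    have "(\<lambda>n. hnorm H (D 0) * sqrt q ^ n) \<longlonglongrightarrow> hnorm H (D 0) * 0"
      using sq by (intro tendsto_intros LIMSEQ_power_zero) auto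
    then show "(\<lambda>n. hnorm H (D 0) * sqrt q ^ n) \<longlonglongrightarrow> 0" by simp
  qed (use Dn D in auto)
  have "a u x = l x" if x: "x \<in> carr H" for x
  proof -
    have le: "cmod (a u x - l x) \<le> M * hnorm H (X n - u) * hnorm H x + hnorm H (D n) / \<rho> * hnorm H x" for n
    proof -
      have "a (X n) x = a (X n - u) x + a u x" using a_add[of "X n - u" u x] X u x by simp
      moreover have "a (X n) x - l x = ip H (B (X n) - w) x" using X x w B by (simp add: aB lw ip_diff)
      ultimately have "a u x - l x = ip H (B (X n) - w) x - a (X n - u) x" by (simp add: algebra_simps)
      also have "cmod \<dots> \<le> cmod (ip H (B (X n) - w) x) + cmod (a (X n - u) x)" by (rule norm_triangle_ineq4)
      also have "\<dots> \<le> hnorm H (B (X n) - w) * hnorm H x + M * hnorm H (X n - u) * hnorm H x"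
        using X x w B u by (intro add_mono Cauchy_Schwarz a_bdd) auto
      also have "hnorm H (B (X n) - w) = hnorm H (D n) / \<rho>"
        using X w B \<rho> by (simp add: D_eq hnorm_uminus hnorm_scl)
      finally show ?thesis by simp
    qed
    have "(\<lambda>n. M * hnorm H (X n - u) * hnorm H x + hnorm H (D n) / \<rho> * hnorm H x)
        \<longlonglongrightarrow> M * 0 * hnorm H x + 0 / \<rho> * hnorm H x"
      using \<rho> by (intro tendsto_intros lim D0) auto
    from LIMSEQ_le_const[OF this] le have "cmod (a u x - l x) \<le> M * 0 * hnorm H x + 0 / \<rho> * hnorm H x"
      by blast
    then show ?thesis by simp
  qed
  then show ?thesis using u by blast
qed

end

section \<open>Pairs of adjoint operators\<close>

context semi_inner
begin

text \<open>Equality of the represented elements. Membership in the carrier is part of the relation,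
  so that transitivity and replacement inside inner products need no side conditions on
  \<open>x\<close> and \<open>y\<close>.\<close>

definition eqv :: "'v \<Rightarrow> 'v \<Rightarrow> bool" where
  "eqv x y \<longleftrightarrow> x \<in> carr H \<and> y \<in> carr H \<and> hnorm H (x - y) = 0"

lemma eqv_carr: "eqv x y \<Longrightarrow> x \<in> carr H" "eqv x y \<Longrightarrow> y \<in> carr H"
  by (auto simp: eqv_def)

lemma eqv_ip: "eqv x y \<Longrightarrow> z \<in> carr H \<Longrightarrow> ip H x z = ip H y z"
  using Cauchy_Schwarz[of "x - y" z] by (simp add: eqv_def ip_diff)

text \<open>Take \<open>z = x - y\<close>. Identities involving \<open>A\<close> are mostly proved
  in this form, since \<open>A\<close> is accessible only through its inner products.\<close>

lemma eqv_ipI: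
  assumes "x \<in> carr H" "y \<in> carr H" "\<And>z. z \<in> carr H \<Longrightarrow> ip H x z = ip H y z"
  shows "eqv x y"
proof -
  have "(hnorm H (x - y))\<^sup>2 = 0"
    using assms by (simp add: hnorm_sq ip_diff)
  then show ?thesis using assms by (simp add: eqv_def)
qed

lemma eqv_refl: "x \<in> carr H \<Longrightarrow> eqv x x" by (simp add: eqv_def)

lemma eqv_sym: "eqv x y \<Longrightarrow> eqv y x" by (simp add: eqv_def hnorm_minus_commute)

lemma eqv_trans: "eqv x y \<Longrightarrow> eqv y z \<Longrightarrow> eqv x z"
  by (intro eqv_ipI) (auto simp: eqv_carr eqv_ip)

lemma eqv_hnorm: "eqv x y \<Longrightarrow> hnorm H x = hnorm H y"
  using hnorm_le_add_diff[of x y] hnorm_le_add_diff[of y x] by (auto simp: eqv_def hnorm_minus_commute)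

lemma eqv_hnorm_zero: "eqv x 0 \<longleftrightarrow> x \<in> carr H \<and> hnorm H x = 0" by (auto simp: eqv_def)

lemma eqv_diff_hnorm: "eqv x y \<Longrightarrow> z \<in> carr H \<Longrightarrow> hnorm H (x - z) = hnorm H (y - z)"
  by (intro eqv_hnorm eqv_ipI) (auto simp: eqv_carr ip_diff eqv_ip)

text \<open>Linearity is an exact equality here, not one up to \<open>eqv\<close>. Multiplication
  operators have it, in contrast to an operator whose values are chosen representatives.\<close>

definition bdd_op :: "('v \<Rightarrow> 'v) \<Rightarrow> bool" where
  "bdd_op T \<longleftrightarrow> (\<forall>u\<in>carr H. T u \<in> carr H)
     \<and> (\<forall>u\<in>carr H. \<forall>v\<in>carr H. T (u + v) = T u + T v)
     \<and> (\<forall>c. \<forall>u\<in>carr H. T (scl H c u) = scl H c (T u))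
     \<and> (\<exists>C\<ge>0. \<forall>u\<in>carr H. hnorm H (T u) \<le> C * hnorm H u)"

lemma bdd_opD:
  assumes "bdd_op T"
  shows bdd_op_carr: "\<And>u. u \<in> carr H \<Longrightarrow> T u \<in> carr H"
    and bdd_op_add: "\<And>u v. \<lbrakk>u \<in> carr H; v \<in> carr H\<rbrakk> \<Longrightarrow> T (u + v) = T u + T v"
    and bdd_op_scl: "\<And>c u. u \<in> carr H \<Longrightarrow> T (scl H c u) = scl H c (T u)"
  using assms by (auto simp: bdd_op_def)

lemma bdd_op_diff: "bdd_op T \<Longrightarrow> u \<in> carr H \<Longrightarrow> v \<in> carr H \<Longrightarrow> T (u - v) = T u - T v"
  using bdd_op_add[of T "u - v" v] by (simp add: algebra_simps)

lemma bdd_op_bound: 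
  assumes "bdd_op T"
  obtains C where "C \<ge> 0" "\<And>u. u \<in> carr H \<Longrightarrow> hnorm H (T u) \<le> C * hnorm H u"
  using assms by (auto simp: bdd_op_def)

lemma bdd_op_eqv:
  assumes "bdd_op T" "eqv u v" shows "eqv (T u) (T v)"
proof -
  obtain C where "hnorm H (T (u - v)) \<le> C * hnorm H (u - v)"
    using bdd_op_bound[OF assms(1)] assms(2) by (metis diff_carr eqv_def)
  then show ?thesis
    using assms hnorm_nonneg[of "T u - T v"] by (auto simp: eqv_def bdd_opD bdd_op_diff intro: antisym)
qed

lemma bdd_op_scaled:
  assumes "bdd_op T" shows "bdd_op (\<lambda>u. scl H k (T u))"
proof -
  obtain C where C: "C \<ge> 0" "\<And>u. u \<in> carr H \<Longrightarrow> hnorm H (T u) \<le> C * hnorm H u"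
    using bdd_op_bound[OF assms] by blast
  have "hnorm H (scl H k (T u)) \<le> (cmod k * C) * hnorm H u" if "u \<in> carr H" for u
    using C(2)[OF that] that assms
    by (simp add: hnorm_scl bdd_opD mult.assoc mult_left_mono)
  then have "\<exists>C\<ge>0. \<forall>u\<in>carr H. hnorm H (scl H k (T u)) \<le> C * hnorm H u"
    using C(1) by (intro exI[of _ "cmod k * C"]) auto
  then show ?thesis
    using assms by (auto simp: bdd_op_def vs.scale_right_distrib mult.commute)
qed

end

text \<open>The operator \<open>(D, A)\<close> is the adjoint of \<open>(D0, A)\<close>. As \<open>A\<close> only picks a representative of
  its value, it need not be additive; that it is linear up to null vectors follows from \<open>green\<close>
  and \<open>adjoint\<close>.\<close>

locale adjoint_pair = semi_hilbert H for H :: "'v::ab_group_add hspace" +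
  fixes D0 D :: "'v set" and A :: "'v \<Rightarrow> 'v"
  assumes D_carr: "u \<in> D \<Longrightarrow> u \<in> carr H"
    and D0_D: "u \<in> D0 \<Longrightarrow> u \<in> D"
    and A_carr [simp]: "u \<in> D \<Longrightarrow> A u \<in> carr H"
    and D0_zero: "0 \<in> D0"
    and D0_add: "u \<in> D0 \<Longrightarrow> v \<in> D0 \<Longrightarrow> u + v \<in> D0"
    and D0_scl: "u \<in> D0 \<Longrightarrow> scl H c u \<in> D0"
    and green: "u \<in> D0 \<Longrightarrow> v \<in> D \<Longrightarrow> ip H (A v) u = ip H v (A u)"
    and adjoint: "\<lbrakk>q \<in> carr H; p \<in> carr H; \<And>u. u \<in> D0 \<Longrightarrow> ip H p u = ip H q (A u)\<rbrakk>
          \<Longrightarrow> q \<in> D \<and> hnorm H (A q - p) = 0"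
    and D0_closed: "\<lbrakk>u \<in> D; \<And>e. e > 0 \<Longrightarrow> \<exists>v\<in>D0. hnorm H (u - v) < e \<and> hnorm H (A u - A v) < e\<rbrakk> \<Longrightarrow> u \<in> D0"
begin

lemma D0_carr [simp]: "u \<in> D0 \<Longrightarrow> u \<in> carr H" by (simp add: D_carr D0_D)

declare D0_D [simp] D_carr [simp]

lemma adjointI:
  assumes "q \<in> carr H" "p \<in> carr H" "\<And>u. u \<in> D0 \<Longrightarrow> ip H p u = ip H q (A u)"
  shows "q \<in> D" "eqv (A q) p"
  using adjoint[OF assms] assms by (auto simp: eqv_def)

lemma D_add: "u \<in> D \<Longrightarrow> v \<in> D \<Longrightarrow> u + v \<in> D"
  and A_add: "u \<in> D \<Longrightarrow> v \<in> D \<Longrightarrow> eqv (A (u + v)) (A u + A v)"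
  using adjointI[of "u + v" "A u + A v"] by (auto simp: ip_add green)

lemma D_scl: "u \<in> D \<Longrightarrow> scl H c u \<in> D"
  and A_scl: "u \<in> D \<Longrightarrow> eqv (A (scl H c u)) (scl H c (A u))"
  using adjointI[of "scl H c u" "scl H c (A u)"] by (auto simp: ip_scl green)

lemma D_diff: "u \<in> D \<Longrightarrow> v \<in> D \<Longrightarrow> u - v \<in> D"
  and A_diff: "u \<in> D \<Longrightarrow> v \<in> D \<Longrightarrow> eqv (A (u - v)) (A u - A v)"
  using adjointI[of "u - v" "A u - A v"] by (auto simp: ip_diff green)

lemma D_eqv: "eqv u v \<Longrightarrow> u \<in> D \<Longrightarrow> v \<in> D"
  and A_eqv: "eqv u v \<Longrightarrow> u \<in> D \<Longrightarrow> eqv (A v) (A u)"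
  using adjointI[of v "A u"] by (auto simp: eqv_carr green eqv_ip)

lemma D0_diff: "u \<in> D0 \<Longrightarrow> v \<in> D0 \<Longrightarrow> u - v \<in> D0"
  using D0_add[of u "scl H (- 1) v"] D0_scl[of v "- 1"] by simp

lemma ip_A:
  "\<lbrakk>u \<in> D; v \<in> D; z \<in> carr H\<rbrakk> \<Longrightarrow> ip H (A (u + v)) z = ip H (A u) z + ip H (A v) z"
  "\<lbrakk>u \<in> D; v \<in> D; z \<in> carr H\<rbrakk> \<Longrightarrow> ip H (A (u - v)) z = ip H (A u) z - ip H (A v) z"
  "\<lbrakk>u \<in> D; z \<in> carr H\<rbrakk> \<Longrightarrow> ip H (A (scl H c u)) z = c * ip H (A u) z"
  using eqv_ip[OF A_add] eqv_ip[OF A_diff] eqv_ip[OF A_scl] by (auto simp: ip_simps)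

lemma ip_A_right:
  "\<lbrakk>u \<in> D; v \<in> D; z \<in> carr H\<rbrakk> \<Longrightarrow> ip H z (A (u + v)) = ip H z (A u) + ip H z (A v)"
  "\<lbrakk>u \<in> D; v \<in> D; z \<in> carr H\<rbrakk> \<Longrightarrow> ip H z (A (u - v)) = ip H z (A u) - ip H z (A v)"
  "\<lbrakk>u \<in> D; z \<in> carr H\<rbrakk> \<Longrightarrow> ip H z (A (scl H c u)) = cnj c * ip H z (A u)"
  by (simp_all add: ip_cnj[of _ z] ip_A D_add D_diff D_scl)

section \<open>The graph norm and the coercive variational problem\<close>

definition graph_space :: "'v hspace" where
  "graph_space = \<lparr> carr = D0, scl = scl H, ip = (\<lambda>u v. ip H u v + ip H (A u) (A v)) \<rparr>"

lemma graph_space_simps [simp]: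
  "carr graph_space = D0" "scl graph_space = scl H"
  "ip graph_space u v = ip H u v + ip H (A u) (A v)"
  by (simp_all add: graph_space_def)

lemma graph_norm: "u \<in> D0 \<Longrightarrow> (hnorm graph_space u)\<^sup>2 = (hnorm H u)\<^sup>2 + (hnorm H (A u))\<^sup>2"
  by (simp add: hnorm_def ip_pos)

lemma semi_inner_graph: "semi_inner graph_space"
proof
  show "ip graph_space y x = cnj (ip graph_space x y)" if "x \<in> carr graph_space" "y \<in> carr graph_space" for x y
    using that by (simp add: ip_cnj[of x y] ip_cnj[of "A x" "A y"])
qed (auto simp: D0_zero D0_add D0_scl ip_simps ip_A ip_pos algebra_simps)

lemma hnorm_le_graph:
  assumes "u \<in> D0"
  shows "hnorm H u \<le> hnorm graph_space u" "hnorm H (A u) \<le> hnorm graph_space u"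
    "hnorm graph_space u \<le> hnorm H u + hnorm H (A u)"
proof -
  interpret V: semi_inner graph_space by (rule semi_inner_graph)
  show "hnorm H u \<le> hnorm graph_space u" "hnorm H (A u) \<le> hnorm graph_space u"
    using graph_norm[OF assms] V.hnorm_nonneg[of u] assms by (auto intro: power2_le_imp_le)
  have "0 \<le> 2 * (hnorm H u * hnorm H (A u))" using assms by simp
  then have "(hnorm graph_space u)\<^sup>2 \<le> (hnorm H u + hnorm H (A u))\<^sup>2"
    using graph_norm[OF assms] by (simp add: power2_sum)
  then show "hnorm graph_space u \<le> hnorm H u + hnorm H (A u)"
    using assms by (auto intro: power2_le_imp_le)
qed

text \<open>Closedness of \<open>A\<close> comes from the adjoint property: if \<open>X n\<close>
  tends to \<open>u\<close> and \<open>A (X n)\<close> to \<open>w\<close>, then Green's formula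
  passes to the limit as \<open>ip H w f = ip H u (A f)\<close>, so \<open>u\<close> lies in
  \<open>D\<close> and \<open>A u\<close> is \<open>w\<close> up to a null vector.
  \<open>D0_closed\<close> then places \<open>u\<close> in \<open>D0\<close>.\<close>

lemma semi_hilbert_graph: "semi_hilbert graph_space"
proof -
  interpret V: semi_inner graph_space by (rule semi_inner_graph)
  show ?thesis
  proof
    fix X :: "nat \<Rightarrow> 'v"
    assume X: "\<And>n. X n \<in> carr graph_space"
      and C: "\<And>e. e > 0 \<Longrightarrow> \<exists>N. \<forall>m\<ge>N. \<forall>n\<ge>N. hnorm graph_space (X m - X n) < e"
    have X0: "X n \<in> D0" for n using X by simp
    have d1: "hnorm H (X m - X n) \<le> hnorm graph_space (X m - X n)"
      and d2: "hnorm H (A (X m) - A (X n)) \<le> hnorm graph_space (X m - X n)" for m n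
      using hnorm_le_graph[OF D0_diff[OF X0 X0]] eqv_hnorm[OF A_diff[OF D0_D[OF X0] D0_D[OF X0]]] by auto
    have "\<exists>u\<in>carr H. (\<lambda>n. hnorm H (X n - u)) \<longlonglongrightarrow> 0"
      by (rule complete) (use X0 in simp, meson C d1 le_less_trans)
    then obtain u where u: "u \<in> carr H" and ulim: "(\<lambda>n. hnorm H (X n - u)) \<longlonglongrightarrow> 0" by blast
    have "\<exists>w\<in>carr H. (\<lambda>n. hnorm H (A (X n) - w)) \<longlonglongrightarrow> 0"
      by (rule complete) (use X0 in simp, meson C d2 le_less_trans)
    then obtain w where w: "w \<in> carr H" and wlim: "(\<lambda>n. hnorm H (A (X n) - w)) \<longlonglongrightarrow> 0" by blast
    have "ip H w f = ip H u (A f)" if f: "f \<in> D0" for f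
    proof -
      have le: "cmod (ip H w f - ip H u (A f))
          \<le> hnorm H (A (X n) - w) * hnorm H f + hnorm H (X n - u) * hnorm H (A f)" for n
      proof -
        have "ip H w f - ip H u (A f) = ip H (X n - u) (A f) - ip H (A (X n) - w) f"
          using f w u X0 green[OF f, of "X n"] by (simp add: ip_diff)
        also have "cmod \<dots> \<le> cmod (ip H (X n - u) (A f)) + cmod (ip H (A (X n) - w) f)"
          by (rule norm_triangle_ineq4)
        also have "\<dots> \<le> hnorm H (X n - u) * hnorm H (A f) + hnorm H (A (X n) - w) * hnorm H f"
          using f w u X0 by (intro add_mono Cauchy_Schwarz) auto
        finally show ?thesis by simp
      qed
      have "(\<lambda>n. hnorm H (A (X n) - w) * hnorm H f + hnorm H (X n - u) * hnorm H (A f))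
          \<longlonglongrightarrow> 0 * hnorm H f + 0 * hnorm H (A f)"
        by (intro tendsto_intros ulim wlim)
      from LIMSEQ_le_const[OF this] le have "cmod (ip H w f - ip H u (A f)) \<le> 0 * hnorm H f + 0 * hnorm H (A f)"
        by blast
      then show ?thesis by simp
    qed
    from adjointI[OF u w this] have uD: "u \<in> D" and Au: "eqv (A u) w" by auto
    have Alim: "(\<lambda>n. hnorm H (A (X n) - A u)) \<longlonglongrightarrow> 0"
      using wlim X0 w uD eqv_diff_hnorm[OF eqv_sym[OF Au]]
      by (simp add: hnorm_minus_commute[of "A (X _)"])
    have u0: "u \<in> D0"
    proof (rule D0_closed[OF uD])
      fix e :: real assume "e > 0"
      then have "eventually (\<lambda>n. hnorm H (X n - u) < e \<and> hnorm H (A (X n) - A u) < e) sequentially"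
        using order_tendstoD(2)[OF ulim] order_tendstoD(2)[OF Alim] by (simp add: eventually_conj)
      then obtain n where "hnorm H (X n - u) < e \<and> hnorm H (A (X n) - A u) < e"
        by (auto simp: eventually_sequentially)
      then show "\<exists>v\<in>D0. hnorm H (u - v) < e \<and> hnorm H (A u - A v) < e"
        using X0 u uD by (intro bexI[of _ "X n"]) (auto simp: hnorm_minus_commute)
    qed
    have "(\<lambda>n. hnorm graph_space (X n - u)) \<longlonglongrightarrow> 0"
    proof (rule tendsto_sandwich[of "\<lambda>_. 0"])
      show "(\<lambda>n. hnorm H (X n - u) + hnorm H (A (X n) - A u)) \<longlonglongrightarrow> 0"
        using tendsto_add[OF ulim Alim] by simp
      show "eventually (\<lambda>n. hnorm graph_space (X n - u) \<le> hnorm H (X n - u) + hnorm H (A (X n) - A u)) sequentially"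
        using hnorm_le_graph(3)[OF D0_diff[OF X0 u0]] eqv_hnorm[OF A_diff[OF D0_D[OF X0] uD]] by simp
      show "eventually (\<lambda>n. 0 \<le> hnorm graph_space (X n - u)) sequentially"
        using X0 u0 V.hnorm_nonneg D0_diff by simp
    qed simp
    then show "\<exists>x\<in>carr graph_space. (\<lambda>n. hnorm graph_space (X n - x)) \<longlonglongrightarrow> 0"
      using u0 by auto
  qed
qed

text \<open>Solves \<open>u + A (T (A u) - G) = F\<close>. In the weak form the outer
  \<open>A\<close> acts on the test vector, so \<open>G\<close> may be any vector of the carrier:
  only the difference \<open>T (A u) - G\<close> has to lie in \<open>D\<close>, and the adjoint
  property puts it there. The bounds result from testing with \<open>u\<close> itself.\<close>

lemma graph_solve:
  assumes T: "bdd_op T" and \<delta>: "\<delta> > 0"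
    and co: "\<And>w. w \<in> carr H \<Longrightarrow> \<delta> * (hnorm H w)\<^sup>2 \<le> Re (ip H (T w) w)"
  obtains C where "C \<ge> 0" "\<And>F G. \<lbrakk>F \<in> carr H; G \<in> carr H\<rbrakk> \<Longrightarrow> \<exists>u\<in>D0. T (A u) - G \<in> D
      \<and> eqv (A (T (A u) - G)) (F - u)
      \<and> hnorm H u \<le> C * (hnorm H F + hnorm H G) \<and> hnorm H (A u) \<le> C * (hnorm H F + hnorm H G)"
proof -
  interpret V: semi_hilbert graph_space by (rule semi_hilbert_graph)
  obtain M where M: "M \<ge> 0" "\<And>u. u \<in> carr H \<Longrightarrow> hnorm H (T u) \<le> M * hnorm H u"
    using bdd_op_bound[OF T] by blast
  \<comment> \<open>The form controls the norm of \<open>u\<close> with constant \<open>1\<close>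
    and the norm of \<open>A u\<close> with constant \<open>\<delta>\<close>, hence the graph norm
    with the smaller of the two.\<close>
  define d where "d = min 1 \<delta>"
  have d: "d > 0" "d \<le> 1" "d \<le> \<delta>" using \<delta> by (auto simp: d_def)
  define a where "a u v = ip H u v + ip H (T (A u)) (A v)" for u v
  have a_coercive: "d * (hnorm graph_space u)\<^sup>2 \<le> Re (a u u)" if u: "u \<in> D0" for u
  proof -
    have "d * (hnorm graph_space u)\<^sup>2 = d * (hnorm H u)\<^sup>2 + d * (hnorm H (A u))\<^sup>2"
      using u by (simp add: graph_norm distrib_left)
    also have "\<dots> \<le> 1 * (hnorm H u)\<^sup>2 + \<delta> * (hnorm H (A u))\<^sup>2"
      using d by (intro add_mono mult_right_mono) auto
    also have "\<dots> \<le> Re (a u u)" using u co[of "A u"] by (simp add: a_def hnorm_sq)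
    finally show ?thesis .
  qed
  have T_A: "ip H (T (A (u + v))) z = ip H (T (A u)) z + ip H (T (A v)) z"
    "ip H (T (A (scl H c u))) z = c * ip H (T (A u)) z"
    if "u \<in> D0" "v \<in> D0" "z \<in> carr H" for u v z c
    using that T eqv_ip[OF bdd_op_eqv[OF T A_add], of u v z] eqv_ip[OF bdd_op_eqv[OF T A_scl], of u z c]
    by (auto simp: bdd_opD ip_simps)
  have a_bdd: "cmod (a x y) \<le> (1 + M) * hnorm graph_space x * hnorm graph_space y"
    if "x \<in> D0" "y \<in> D0" for x y
  proof -
    note nn = hnorm_le_graph[OF that(1)] hnorm_le_graph[OF that(2)]
    have "cmod (a x y) \<le> cmod (ip H x y) + cmod (ip H (T (A x)) (A y))"
      unfolding a_def by (rule norm_triangle_ineq)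
    also have "\<dots> \<le> hnorm H x * hnorm H y + hnorm H (T (A x)) * hnorm H (A y)"
      using that T by (intro add_mono Cauchy_Schwarz) (auto simp: bdd_opD)
    also have "\<dots> \<le> hnorm H x * hnorm H y + (M * hnorm H (A x)) * hnorm H (A y)"
      using that M(2)[of "A x"] by (intro add_mono mult_right_mono) auto
    also have "\<dots> \<le> hnorm graph_space x * hnorm graph_space y + (M * hnorm graph_space x) * hnorm graph_space y"
      using that M nn V.hnorm_nonneg by (intro add_mono mult_mono) auto
    finally show ?thesis by (simp add: algebra_simps)
  qed
  define C where "C = 1 / d"
  have "\<exists>u\<in>D0. T (A u) - G \<in> D \<and> eqv (A (T (A u) - G)) (F - u)
      \<and> hnorm H u \<le> C * (hnorm H F + hnorm H G) \<and> hnorm H (A u) \<le> C * (hnorm H F + hnorm H G)"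
    if F: "F \<in> carr H" and G: "G \<in> carr H" for F G
  proof -
    define l where "l v = ip H F v + ip H G (A v)" for v
    have l_bdd: "cmod (l v) \<le> (hnorm H F + hnorm H G) * hnorm graph_space v" if "v \<in> D0" for v
    proof -
      have "cmod (l v) \<le> cmod (ip H F v) + cmod (ip H G (A v))" unfolding l_def by (rule norm_triangle_ineq)
      also have "\<dots> \<le> hnorm H F * hnorm H v + hnorm H G * hnorm H (A v)"
        using that F G by (intro add_mono Cauchy_Schwarz) auto
      also have "\<dots> \<le> hnorm H F * hnorm graph_space v + hnorm H G * hnorm graph_space v"
        using hnorm_le_graph[OF that] F G by (intro add_mono mult_left_mono) auto
      finally show ?thesis by (simp add: algebra_simps)
    qed
    have "\<exists>u\<in>carr graph_space. \<forall>v\<in>carr graph_space. a u v = l v"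
    proof (rule V.Lax_Milgram[where d = d and M = "1 + M" and C = "hnorm H F + hnorm H G"])
      fix x y z c assume "x \<in> carr graph_space" "z \<in> carr graph_space"
      then show "a (scl graph_space c x) z = c * a x z" "a z (scl graph_space c x) = cnj c * a z x"
        using T by (auto simp: a_def T_A ip_simps ip_A_right bdd_opD algebra_simps)
      assume "y \<in> carr graph_space"
      then show "a (x + y) z = a x z + a y z" "a z (x + y) = a z x + a z y"
        using T \<open>x \<in> _\<close> \<open>z \<in> _\<close> by (auto simp: a_def T_A ip_simps ip_A_right bdd_opD)
    qed (use F G d(1) a_coercive a_bdd l_bdd in \<open>auto simp: l_def ip_simps ip_A_right distrib_left\<close>)
    then obtain u where u: "u \<in> D0" and au: "\<And>v. v \<in> D0 \<Longrightarrow> a u v = l v" by auto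
    have "ip H (F - u) v = ip H (T (A u) - G) (A v)" if "v \<in> D0" for v
      using au[OF that] u T F G that by (simp add: a_def l_def ip_simps bdd_opD algebra_simps)
    from adjointI[OF _ _ this] u T F G
    have sol: "T (A u) - G \<in> D" "eqv (A (T (A u) - G)) (F - u)" by (auto simp: bdd_opD)
    have nn: "0 \<le> hnorm graph_space u" using V.hnorm_nonneg u by simp
    have "d * (hnorm graph_space u)\<^sup>2 \<le> (hnorm H F + hnorm H G) * hnorm graph_space u"
      using a_coercive[OF u] l_bdd[OF u] complex_Re_le_cmod[of "l u"] unfolding au[OF u]
      by (meson order_trans)
    then have "d * hnorm graph_space u \<le> hnorm H F + hnorm H G"
      using nn F G by (cases "hnorm graph_space u = 0") (auto simp: power2_eq_square)
    then have "hnorm graph_space u \<le> C * (hnorm H F + hnorm H G)"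
      using d by (simp add: C_def field_simps)
    then show ?thesis using sol u hnorm_le_graph[OF u] by (intro bexI[of _ u]) auto
  qed
  moreover have "C \<ge> 0" using d by (simp add: C_def)
  ultimately show thesis using that by blast
qed

end

section \<open>The block operator and its Schur complement\<close>

lemma hsum_simps [simp]:
  "carr (hsum H K) = carr H \<times> carr K"
  "scl (hsum H K) c (u, v) = (scl H c u, scl K c v)"
  "ip (hsum H K) (u, v) (u', v') = ip H u u' + ip K v v'"
  by (simp_all add: hsum_def)

context semi_inner
begin

lemma shift_zero: "shift H T 0 = T"
  by (simp add: shift_def)

lemma shift_zero_hsum: "shift (hsum H H) T 0 = T"
proof -
  have "scl (hsum H H) 0 z = 0" for z by (cases z) (simp add: zero_prod_def)
  then show ?thesis by (simp add: shift_def)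
qed

lemma hnorm_hsum:
  "u \<in> carr H \<Longrightarrow> v \<in> carr H \<Longrightarrow> hnorm (hsum H H) (u, v) = sqrt ((hnorm H u)\<^sup>2 + (hnorm H v)\<^sup>2)"
  unfolding hnorm_def by (simp add: ip_pos)

lemma hnorm_hsum_zero:
  "u \<in> carr H \<Longrightarrow> v \<in> carr H \<Longrightarrow> hnorm (hsum H H) (u, v) = 0 \<longleftrightarrow> hnorm H u = 0 \<and> hnorm H v = 0"
  by (simp add: hnorm_hsum sum_power2_eq_zero_iff)

lemma hnorm_hsum_bounds:
  assumes "u \<in> carr H" "v \<in> carr H"
  shows "hnorm H u \<le> hnorm (hsum H H) (u, v)" "hnorm H v \<le> hnorm (hsum H H) (u, v)"
    "hnorm (hsum H H) (u, v) \<le> hnorm H u + hnorm H v"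
  using assms by (auto simp: hnorm_hsum sqrt_sum_squares_le_sum intro: real_le_rsqrt)

end

text \<open>The diagonal entries are \<open>a E\<close> and \<open>b Q\<close>, the off-diagonal
  ones \<open>\<i> A\<close> and \<open>- \<i> A\<close>; \<open>P\<close> inverts \<open>Q\<close>,
  and primes denote adjoints. For the Drude-Lorentz pencil \<open>E\<close> and \<open>Q\<close> are
  the multiplications by the two functions \<open>Theta\<close>, and \<open>a\<close>,
  \<open>b\<close> are \<open>- 1 / (\<omega> + \<i> \<gamma>e)\<close> and
  \<open>- 1 / (\<omega> + \<i> \<gamma>m)\<close>. The adjoints serve the weak limits of singular
  sequences.\<close>

locale schur_pencil = adjoint_pair H D0 D A for H :: "'v::ab_group_add hspace" and D0 D A +
  fixes E P Q E' P' :: "'v \<Rightarrow> 'v" and a b \<kappa> :: complex and \<delta> :: real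
  assumes E: "bdd_op E" and P: "bdd_op P" and Q: "bdd_op Q" and P': "bdd_op P'"
    and E'_carr: "u \<in> carr H \<Longrightarrow> E' u \<in> carr H"
    and PQ: "u \<in> carr H \<Longrightarrow> P (Q u) = u" and QP: "u \<in> carr H \<Longrightarrow> Q (P u) = u"
    and E_adj: "u \<in> carr H \<Longrightarrow> v \<in> carr H \<Longrightarrow> ip H (E u) v = ip H u (E' v)"
    and P_adj: "u \<in> carr H \<Longrightarrow> v \<in> carr H \<Longrightarrow> ip H (P u) v = ip H u (P' v)"
    and b: "b \<noteq> 0" and \<kappa>: "\<kappa> \<noteq> 0" and \<delta>: "\<delta> > 0"
    and coercive: "w \<in> carr H \<Longrightarrow> \<delta> * (hnorm H w)\<^sup>2 \<le> Re (\<kappa> * ip H (P w) w)"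
begin

definition row1 :: "'v \<Rightarrow> 'v \<Rightarrow> 'v" where "row1 u v = scl H a (E u) + scl H \<i> (A v)"

definition row2 :: "'v \<Rightarrow> 'v \<Rightarrow> 'v" where "row2 u v = scl H (- \<i>) (A u) + scl H b (Q v)"

definition schur :: "'v \<Rightarrow> 'v" where "schur u = A (P (A u)) - scl H (a * b) (E u)"

definition domS :: "'v set" where "domS = {u \<in> D0. P (A u) \<in> D}"

text \<open>The second component that a vanishing second row forces upon \<open>u\<close>.\<close>

definition lift :: "'v \<Rightarrow> 'v" where "lift u = scl H (\<i> / b) (P (A u))"

lemma op_carr [simp]:
  "u \<in> carr H \<Longrightarrow> E u \<in> carr H" "u \<in> carr H \<Longrightarrow> P u \<in> carr H"
  "u \<in> carr H \<Longrightarrow> Q u \<in> carr H" "u \<in> carr H \<Longrightarrow> P' u \<in> carr H" "u \<in> carr H \<Longrightarrow> E' u \<in> carr H"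
  using E P Q P' E'_carr by (auto simp: bdd_opD)

lemma row_carr [simp]:
  "u \<in> D0 \<Longrightarrow> v \<in> D \<Longrightarrow> row1 u v \<in> carr H" "u \<in> D0 \<Longrightarrow> v \<in> D \<Longrightarrow> row2 u v \<in> carr H"
  by (auto simp: row1_def row2_def)

lemma domS_D0: "u \<in> domS \<Longrightarrow> u \<in> D0" and domS_D: "u \<in> domS \<Longrightarrow> P (A u) \<in> D"
  by (auto simp: domS_def)

lemma domS_intro: "u \<in> D0 \<Longrightarrow> P (A u) \<in> D \<Longrightarrow> u \<in> domS"
  by (simp add: domS_def)

lemma domS_carr [simp]:
  assumes "u \<in> domS"
  shows "u \<in> D0" "P (A u) \<in> D" "schur u \<in> carr H" "lift u \<in> D"
  using assms by (auto simp: domS_def schur_def lift_def intro: D_scl)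

lemma row_diff:
  assumes "u \<in> D0" "u' \<in> D0" "v \<in> D" "v' \<in> D"
  shows "eqv (row1 (u - u') (v - v')) (row1 u v - row1 u' v')"
    "eqv (row2 (u - u') (v - v')) (row2 u v - row2 u' v')"
  using assms
  by (auto intro!: eqv_ipI simp: D0_diff D_diff)
    (auto simp: row1_def row2_def ip_simps ip_A bdd_op_diff[OF Q] bdd_op_diff[OF E] D0_diff D_diff algebra_simps)

lemma row_scl:
  assumes "u \<in> D0" "v \<in> D"
  shows "eqv (row1 (scl H c u) (scl H c v)) (scl H c (row1 u v))"
    "eqv (row2 (scl H c u) (scl H c v)) (scl H c (row2 u v))"
  using assms
  by (auto intro!: eqv_ipI simp: D0_scl D_scl)
    (auto simp: row1_def row2_def ip_simps ip_A bdd_opD[OF Q] bdd_opD[OF E] D0_scl D_scl algebra_simps)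

lemma PA_diff:
  assumes "u \<in> domS" "u' \<in> domS"
  shows "eqv (P (A (u - u'))) (P (A u) - P (A u'))"
  using bdd_op_eqv[OF P A_diff[of u u']] assms by (simp add: bdd_op_diff[OF P])

lemma PA_scl:
  assumes "u \<in> domS"
  shows "eqv (P (A (scl H c u))) (scl H c (P (A u)))"
  using bdd_op_eqv[OF P A_scl[of u c]] assms by (simp add: bdd_opD[OF P])

lemma domS_diff:
  assumes "u \<in> domS" "u' \<in> domS"
  shows "u - u' \<in> domS"
proof -
  have "P (A (u - u')) \<in> D"
    by (rule D_eqv[OF eqv_sym[OF PA_diff[OF assms]] D_diff[OF domS_D[OF assms(1)] domS_D[OF assms(2)]]])
  then show ?thesis using assms by (intro domS_intro) (simp_all add: D0_diff)
qed

lemma domS_scl: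
  assumes "u \<in> domS"
  shows "scl H c u \<in> domS"
proof -
  have "P (A (scl H c u)) \<in> D"
    by (rule D_eqv[OF eqv_sym[OF PA_scl[OF assms]] D_scl[OF domS_D[OF assms]]])
  then show ?thesis using assms by (intro domS_intro) (simp_all add: D0_scl)
qed

lemma schur_diff:
  assumes u: "u \<in> domS" and u': "u' \<in> domS"
  shows "eqv (schur (u - u')) (schur u - schur u')"
proof -
  note d = domS_diff[OF u u']
  have "eqv (A (P (A (u - u')))) (A (P (A u) - P (A u')))"
    by (rule A_eqv[OF eqv_sym[OF PA_diff[OF u u']] D_diff[OF domS_D[OF u] domS_D[OF u']]])
  from eqv_ip[OF eqv_trans[OF this A_diff[OF domS_D[OF u] domS_D[OF u']]]] u u' d show ?thesis
    by (auto intro!: eqv_ipI) (simp add: schur_def ip_simps bdd_op_diff[OF E] algebra_simps)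
qed

lemma schur_scl:
  assumes u: "u \<in> domS"
  shows "eqv (schur (scl H c u)) (scl H c (schur u))"
proof -
  note d = domS_scl[OF u, of c]
  have "eqv (A (P (A (scl H c u)))) (A (scl H c (P (A u))))"
    by (rule A_eqv[OF eqv_sym[OF PA_scl[OF u]] D_scl[OF domS_D[OF u]]])
  from eqv_ip[OF eqv_trans[OF this A_scl[OF domS_D[OF u]]]] u d show ?thesis
    by (auto intro!: eqv_ipI) (simp add: schur_def ip_simps bdd_opD[OF E] algebra_simps)
qed

lemma row1_solved:
  assumes u: "u \<in> domS" and v: "v \<in> D" "eqv v (lift u)"
  shows "eqv (row1 u v) (scl H (- 1 / b) (schur u))"
proof -
  have "eqv (A v) (A (lift u))" by (rule A_eqv[OF eqv_sym[OF v(2)]]) (use u in simp)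
  moreover have "eqv (A (lift u)) (scl H (\<i> / b) (A (P (A u))))"
    unfolding lift_def by (rule A_scl[OF domS_D[OF u]])
  ultimately have "eqv (A v) (scl H (\<i> / b) (A (P (A u))))" by (rule eqv_trans)
  from eqv_ip[OF this] u v b show ?thesis
    by (auto intro!: eqv_ipI) (simp add: row1_def schur_def ip_simps field_simps)
qed

lemma row2_lift:
  assumes "u \<in> domS" shows "row2 u (lift u) = 0"
  using assms b by (simp add: row2_def lift_def bdd_opD[OF Q] QP)

text \<open>Applying \<open>P\<close> to the second row gives \<open>b v = \<i> P (A u)\<close> up
  to a null vector. So \<open>P (A u)\<close> is a multiple of \<open>v\<close> and inherits
  membership in \<open>D\<close>, which is the condition defining \<open>domS\<close>.\<close>

lemma row2_zero:
  assumes u: "u \<in> D0" and v: "v \<in> D" and z: "hnorm H (row2 u v) = 0"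
  shows "u \<in> domS" "eqv v (lift u)"
proof -
  have "eqv (row2 u v) 0" using u v z by (simp add: eqv_def)
  from bdd_op_eqv[OF P this] have "eqv (P (row2 u v)) 0"
    using bdd_op_scl[OF P, of 0 0] by simp
  moreover have "P (row2 u v) = scl H b v - scl H \<i> (P (A u))"
  proof -
    have "P (row2 u v) = scl H (- \<i>) (P (A u)) + scl H b (P (Q v))"
      unfolding row2_def using u v by (simp only: bdd_opD[OF P] op_carr A_carr D0_D D_carr scl_carr)
    then show ?thesis using v by (simp add: PQ)
  qed
  ultimately have "eqv (scl H b v - scl H \<i> (P (A u))) 0" by simp
  from eqv_ip[OF this] have ip_eq: "b * ip H v z = \<i> * ip H (P (A u)) z" if "z \<in> carr H" for z
    using that u v by (simp add: ip_simps)
  show ev: "eqv v (lift u)"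
    using u v b ip_eq by (auto intro!: eqv_ipI simp: lift_def ip_scl field_simps)
  have "eqv (scl H (- \<i> * b) v) (P (A u))"
  proof (rule eqv_ipI)
    fix z assume z: "z \<in> carr H"
    have "ip H (scl H (- \<i> * b) v) z = - \<i> * (b * ip H v z)"
      unfolding ip_scl[OF D_carr[OF v] z] by simp
    then show "ip H (scl H (- \<i> * b) v) z = ip H (P (A u)) z"
      by (simp add: ip_eq[OF z])
  qed (use u v in auto)
  from D_eqv[OF this D_scl[OF v]] show "u \<in> domS" by (rule domS_intro[OF u])
qed

section \<open>The perturbed block problem\<close>

lemma kappa_solve:
  obtains C where "C \<ge> 0" "\<And>F G. \<lbrakk>F \<in> carr H; G \<in> carr H\<rbrakk> \<Longrightarrow> \<exists>u\<in>D0. scl H \<kappa> (P (A u)) - G \<in> D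
      \<and> eqv (A (scl H \<kappa> (P (A u)) - G)) (F - u)
      \<and> hnorm H u \<le> C * (hnorm H F + hnorm H G) \<and> hnorm H (A u) \<le> C * (hnorm H F + hnorm H G)"
proof (rule graph_solve[OF bdd_op_scaled[OF P] \<delta>])
  show "\<delta> * (hnorm H w)\<^sup>2 \<le> Re (ip H (scl H \<kappa> (P w)) w)" if "w \<in> carr H" for w
    using coercive[OF that] that by (simp add: ip_scl)
qed (use that in blast)

text \<open>Passing to the adjoint coefficient conjugates the quadratic form and leaves its real
  part unchanged, so the same \<open>\<delta>\<close> works.\<close>

lemma kappa_solve_adjoint:
  assumes F: "F \<in> carr H" and G: "G \<in> carr H"
  shows "\<exists>u\<in>D0. scl H (cnj \<kappa>) (P' (A u)) - G \<in> D \<and> eqv (A (scl H (cnj \<kappa>) (P' (A u)) - G)) (F - u)"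
proof (rule graph_solve[OF bdd_op_scaled[OF P'] \<delta>])
  show "\<delta> * (hnorm H w)\<^sup>2 \<le> Re (ip H (scl H (cnj \<kappa>) (P' w)) w)" if "w \<in> carr H" for w
  proof -
    have "ip H (scl H (cnj \<kappa>) (P' w)) w = cnj (\<kappa> * ip H (P w) w)"
      using that by (simp add: ip_scl P_adj ip_cnj[of w "P' w"])
    then show ?thesis using coercive[OF that] by simp
  qed
qed (use F G in blast)

text \<open>The block operator becomes boundedly invertible after a bounded perturbation of its
  first row; the perturbation is the vector \<open>m\<close>.\<close>

definition perturbed_solution :: "real \<Rightarrow> 'v \<Rightarrow> 'v \<Rightarrow> bool" where
  "perturbed_solution C f g \<longleftrightarrow> (\<exists>u\<in>D0. \<exists>v\<in>D. \<exists>m\<in>carr H.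
      eqv (row1 u v) (f + m) \<and> eqv (row2 u v) g
      \<and> hnorm H u \<le> C * (hnorm H f + hnorm H g) \<and> hnorm H v \<le> C * (hnorm H f + hnorm H g)
      \<and> hnorm H m \<le> C * (hnorm H f + hnorm H g))"

text \<open>With the entry \<open>a E\<close> replaced by the scalar
  \<open>- 1 / (b * \<kappa>)\<close>, the second row gives
  \<open>v = (\<i> / b) P (A u - \<i> g)\<close>, and the first row becomes
  \<open>u + A (\<kappa> P (A u) - G) = F\<close> with the \<open>F\<close> and \<open>G\<close>
  defined in the proof. This is the problem of \<open>kappa_solve\<close>.\<close>

lemma perturbed_solve:
  obtains C where "C \<ge> 0" "\<And>f g. \<lbrakk>f \<in> carr H; g \<in> carr H\<rbrakk> \<Longrightarrow> perturbed_solution C f g"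
proof -
  obtain C1 where C1: "C1 \<ge> 0" and sol: "\<And>F G. \<lbrakk>F \<in> carr H; G \<in> carr H\<rbrakk> \<Longrightarrow> \<exists>u\<in>D0. scl H \<kappa> (P (A u)) - G \<in> D
      \<and> eqv (A (scl H \<kappa> (P (A u)) - G)) (F - u)
      \<and> hnorm H u \<le> C1 * (hnorm H F + hnorm H G) \<and> hnorm H (A u) \<le> C1 * (hnorm H F + hnorm H G)"
    by (rule kappa_solve) blast
  obtain CP where CP: "CP \<ge> 0" "\<And>u. u \<in> carr H \<Longrightarrow> hnorm H (P u) \<le> CP * hnorm H u"
    using bdd_op_bound[OF P] by blast
  obtain CE where CE: "CE \<ge> 0" "\<And>u. u \<in> carr H \<Longrightarrow> hnorm H (E u) \<le> CE * hnorm H u"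
    using bdd_op_bound[OF E] by blast
  define k where "k = cmod \<kappa>"
  define C2 where "C2 = C1 * (cmod (b * \<kappa>) + k * CP)"
  define C3 where "C3 = cmod (\<i> / b) * CP * (C2 + 1)"
  define C4 where "C4 = (cmod a * CE + cmod (1 / (b * \<kappa>))) * C2"
  have nn: "C2 \<ge> 0" "C3 \<ge> 0" "C4 \<ge> 0" using C1 CP CE by (simp_all add: C2_def C3_def C4_def k_def)
  define C where "C = C2 + C3 + C4"
  have "perturbed_solution C f g"
    if f: "f \<in> carr H" and g: "g \<in> carr H" for f g
  proof -
    define F where "F = scl H (- b * \<kappa>) f"
    define G where "G = scl H (\<i> * \<kappa>) (P g)"
    have FG: "F \<in> carr H" "G \<in> carr H" using f g by (auto simp: F_def G_def)
    define r where "r = hnorm H f + hnorm H g"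
    have r: "0 \<le> hnorm H f" "0 \<le> hnorm H g" "r \<ge> 0" using f g by (simp_all add: r_def)
    have "hnorm H F \<le> cmod (b * \<kappa>) * r"
      using f r by (simp add: F_def hnorm_uminus hnorm_scl norm_mult r_def mult_left_mono)
    moreover have "hnorm H G \<le> k * CP * r"
    proof -
      have "hnorm H G = k * hnorm H (P g)" using g by (simp add: G_def hnorm_scl norm_mult k_def)
      also have "\<dots> \<le> k * (CP * r)"
        using CP(1) CP(2)[OF g] r g by (intro mult_left_mono order_trans[OF CP(2)[OF g]]) (auto simp: k_def r_def)
      finally show ?thesis by simp
    qed
    ultimately have FGr: "hnorm H F + hnorm H G \<le> (cmod (b * \<kappa>) + k * CP) * r"
      by (simp add: algebra_simps)
    obtain u where u: "u \<in> D0" and q: "scl H \<kappa> (P (A u)) - G \<in> D"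
      and Aq: "eqv (A (scl H \<kappa> (P (A u)) - G)) (F - u)"
      and nu: "hnorm H u \<le> C1 * (hnorm H F + hnorm H G)" and nA: "hnorm H (A u) \<le> C1 * (hnorm H F + hnorm H G)"
      using sol[OF FG] by blast
    have "C1 * (hnorm H F + hnorm H G) \<le> C2 * r"
      using FGr C1 mult_left_mono[OF FGr C1] by (simp add: C2_def mult.assoc)
    then have nu: "hnorm H u \<le> C2 * r" and nA: "hnorm H (A u) \<le> C2 * r" using nu nA by auto
    \<comment> \<open>As a multiple of the vector in \<open>q\<close>, \<open>v\<close> visibly lies
      in \<open>D\<close>; \<open>v_eq\<close> rewrites it as the solution of the second
      row.\<close>
    define v where "v = scl H (\<i> / (b * \<kappa>)) (scl H \<kappa> (P (A u)) - G)"
    have v: "v \<in> D" unfolding v_def by (rule D_scl[OF q])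
    have v_eq: "v = scl H (\<i> / b) (P (A u - scl H \<i> g))"
      using u g \<kappa> by (simp add: v_def G_def vs.scale_right_diff_distrib bdd_op_diff[OF P] bdd_opD[OF P] mult.commute)
    have "hnorm H v \<le> cmod (\<i> / b) * (CP * (hnorm H (A u) + hnorm H g))"
    proof -
      have "hnorm H (A u - scl H \<i> g) \<le> hnorm H (A u) + hnorm H g"
        using hnorm_triangle_diff[of "A u" "scl H \<i> g"] u g by (simp add: hnorm_scl)
      then have "hnorm H (P (A u - scl H \<i> g)) \<le> CP * (hnorm H (A u) + hnorm H g)"
        using CP(2)[of "A u - scl H \<i> g"] CP(1) u g by (simp add: order_trans[OF _ mult_left_mono])
      then have "cmod (\<i> / b) * hnorm H (P (A u - scl H \<i> g)) \<le> cmod (\<i> / b) * (CP * (hnorm H (A u) + hnorm H g))"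
        by (rule mult_left_mono) simp
      then show ?thesis using u g by (simp add: v_eq hnorm_scl)
    qed
    also have "\<dots> \<le> cmod (\<i> / b) * (CP * ((C2 + 1) * r))"
      using nA r CP(1) by (intro mult_left_mono) (auto simp: r_def algebra_simps)
    finally have nv: "hnorm H v \<le> C3 * r" by (simp add: C3_def)
    \<comment> \<open>The true entry \<open>a E\<close> minus its replacement
      \<open>- 1 / (b * \<kappa>)\<close>, applied to \<open>u\<close>.\<close>
    define m where "m = scl H a (E u) + scl H (1 / (b * \<kappa>)) u"
    have m: "m \<in> carr H" using u by (simp add: m_def)
    have "hnorm H m \<le> cmod a * (CE * hnorm H u) + cmod (1 / (b * \<kappa>)) * hnorm H u"
      using hnorm_triangle[of "scl H a (E u)" "scl H (1 / (b * \<kappa>)) u"] u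
        mult_left_mono[OF CE(2)[of u], of "cmod a"] unfolding m_def by (simp add: hnorm_scl del: mult_le_cancel_left)
    also have "\<dots> = (cmod a * CE + cmod (1 / (b * \<kappa>))) * hnorm H u" by (simp add: algebra_simps)
    also have "\<dots> \<le> (cmod a * CE + cmod (1 / (b * \<kappa>))) * (C2 * r)"
      using nu CE by (intro mult_left_mono) auto
    finally have nm: "hnorm H m \<le> C4 * r" by (simp add: C4_def mult.assoc)
    have e1: "eqv (row1 u v) (f + m)"
    proof (rule eqv_ipI)
      fix z assume z: "z \<in> carr H"
      have "ip H (A v) z = \<i> / (b * \<kappa>) * ip H (A (scl H \<kappa> (P (A u)) - G)) z"
        unfolding v_def using q z by (simp add: ip_A)
      also have "\<dots> = \<i> / (b * \<kappa>) * (- b * \<kappa> * ip H f z - ip H u z)"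
        using eqv_ip[OF Aq z] u f z by (simp add: F_def ip_simps)
      finally have "ip H (A v) z = - \<i> * ip H f z - \<i> / (b * \<kappa>) * ip H u z"
        using b \<kappa> by (simp add: field_simps)
      then have "\<i> * ip H (A v) z = \<i> * (- \<i> * ip H f z - \<i> / (b * \<kappa>) * ip H u z)" by simp
      also have "\<dots> = ip H f z + 1 / (b * \<kappa>) * ip H u z" by (simp add: right_diff_distrib)
      finally show "ip H (row1 u v) z = ip H (f + m) z"
        using u v f z by (simp add: row1_def m_def ip_simps algebra_simps)
    qed (use u v f m in auto)
    have "Q v = scl H (\<i> / b) (A u - scl H \<i> g)"
      using u g by (simp add: v_eq bdd_opD[OF Q] QP)
    then have "row2 u v = g"
      using b by (simp add: row2_def vs.scale_right_diff_distrib vs.scale_right_distrib)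
    then have e2: "eqv (row2 u v) g" using g by (simp add: eqv_refl)
    have "C2 * r \<le> C * r" "C3 * r \<le> C * r" "C4 * r \<le> C * r"
      using nn r by (auto simp: C_def intro: mult_right_mono)
    then show ?thesis using u v m e1 e2 nu nv nm unfolding r_def perturbed_solution_def
      by (intro bexI[of _ u] bexI[of _ v] bexI[of _ m]) auto
  qed
  moreover have "C \<ge> 0" using nn by (simp add: C_def)
  ultimately show thesis using that by blast
qed

section \<open>The energy estimate and the reduction to pairs \<open>(w, lift w)\<close>\<close>

text \<open>As \<open>P (A u)\<close> lies in \<open>D\<close>, Green's formula turns
  \<open>ip H (P (A u)) (A u)\<close> into \<open>ip H (A (P (A u))) u\<close>, where
  \<open>A (P (A u))\<close> is \<open>schur u\<close> plus a bounded term in \<open>u\<close>.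
  Coercivity bounds the square of the norm of \<open>A u\<close> by this, whence the root of
  \<open>K\<close> in the constant.\<close>

lemma energy:
  obtains C where "C \<ge> 0" "\<And>u. u \<in> domS \<Longrightarrow> hnorm H (lift u) \<le> C * (hnorm H u + hnorm H (schur u))"
proof -
  obtain CP where CP: "CP \<ge> 0" "\<And>u. u \<in> carr H \<Longrightarrow> hnorm H (P u) \<le> CP * hnorm H u"
    using bdd_op_bound[OF P] by blast
  obtain CE where CE: "CE \<ge> 0" "\<And>u. u \<in> carr H \<Longrightarrow> hnorm H (E u) \<le> CE * hnorm H u"
    using bdd_op_bound[OF E] by blast
  define K where "K = cmod \<kappa> * (1 + cmod (a * b) * CE) / \<delta>"
  have K: "K \<ge> 0" using CE \<delta> by (simp add: K_def)
  define C where "C = cmod (\<i> / b) * CP * sqrt K"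
  have "hnorm H (lift u) \<le> C * (hnorm H u + hnorm H (schur u))" if u: "u \<in> domS" for u
  proof -
    define r where "r = hnorm H u + hnorm H (schur u)"
    have nn: "0 \<le> hnorm H u" "0 \<le> hnorm H (schur u)" using u by simp_all
    then have r: "hnorm H u \<le> r" "0 \<le> r" by (simp_all add: r_def)
    have "A (P (A u)) = schur u + scl H (a * b) (E u)" by (simp add: schur_def)
    then have "hnorm H (A (P (A u))) \<le> hnorm H (schur u) + cmod (a * b) * hnorm H (E u)"
      using hnorm_triangle[of "schur u" "scl H (a * b) (E u)"] u by (simp add: hnorm_scl)
    also have "\<dots> \<le> r + cmod (a * b) * (CE * r)"
      using CE(2)[of u] CE(1) u nn r
      by (intro add_mono mult_left_mono order_trans[OF CE(2)[of u]]) (auto simp: r_def)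
    also have "\<dots> = (1 + cmod (a * b) * CE) * r" by (simp add: algebra_simps)
    finally have APA: "hnorm H (A (P (A u))) \<le> (1 + cmod (a * b) * CE) * r" .
    have "\<delta> * (hnorm H (A u))\<^sup>2 \<le> Re (\<kappa> * ip H (P (A u)) (A u))" using coercive[of "A u"] u by simp
    also have "\<dots> \<le> cmod (\<kappa> * ip H (A (P (A u))) u)"
      unfolding green[OF domS_D0[OF u] domS_D[OF u]] by (rule complex_Re_le_cmod)
    also have "\<dots> \<le> cmod \<kappa> * (hnorm H (A (P (A u))) * hnorm H u)"
      unfolding norm_mult using u by (intro mult_left_mono Cauchy_Schwarz) auto
    also have "\<dots> \<le> cmod \<kappa> * (((1 + cmod (a * b) * CE) * r) * r)"
      using APA r(1) r(2) CE(1) u by (intro mult_left_mono mult_mono mult_nonneg_nonneg) auto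
    finally have "(hnorm H (A u))\<^sup>2 \<le> K * r\<^sup>2"
      using \<delta> by (simp add: K_def field_simps power2_eq_square)
    then have "hnorm H (A u) \<le> sqrt (K * r\<^sup>2)" by (rule real_le_rsqrt)
    then have Au: "hnorm H (A u) \<le> sqrt K * r" using r by (simp add: real_sqrt_mult)
    have "hnorm H (lift u) = cmod (\<i> / b) * hnorm H (P (A u))"
      using u by (simp add: lift_def hnorm_scl)
    also have "\<dots> \<le> cmod (\<i> / b) * (CP * (sqrt K * r))"
      using CP(1) CP(2)[of "A u"] Au u by (intro mult_left_mono order_trans[OF CP(2)[of "A u"]]) auto
    finally show ?thesis by (simp add: C_def r_def mult.assoc)
  qed
  moreover have "C \<ge> 0" using CP K by (simp add: C_def)
  ultimately show thesis using that by blast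
qed

definition reduction_bounds :: "real \<Rightarrow> 'v \<Rightarrow> 'v \<Rightarrow> bool" where
  "reduction_bounds C u v \<longleftrightarrow> (\<exists>w\<in>domS.
      hnorm H (u - w) \<le> C * (hnorm H (row1 u v) + hnorm H (row2 u v))
      \<and> hnorm H (v - lift w) \<le> C * (hnorm H (row1 u v) + hnorm H (row2 u v))
      \<and> hnorm H (schur w) \<le> C * (hnorm H (row1 u v) + hnorm H (row2 u v)))"

text \<open>Let \<open>(u1, v1)\<close> solve the perturbed problem with the rows of
  \<open>(u, v)\<close> as data. Then \<open>w = u - u1\<close> and \<open>v - v1\<close> have
  second row zero and first row \<open>- m\<close>, up to null vectors. So \<open>v - v1\<close>
  represents \<open>lift w\<close>, \<open>schur w\<close> represents \<open>b m\<close>, and the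
  three quantities are the norms of \<open>u1\<close>, \<open>v1\<close> and \<open>b m\<close>, all
  bounded by the data.\<close>

lemma reduction:
  obtains C where "C \<ge> 0" "\<And>u v. \<lbrakk>u \<in> D0; v \<in> D\<rbrakk> \<Longrightarrow> reduction_bounds C u v"
proof -
  obtain C1 where C1: "C1 \<ge> 0" and sol: "\<And>f g. \<lbrakk>f \<in> carr H; g \<in> carr H\<rbrakk> \<Longrightarrow> perturbed_solution C1 f g"
    by (rule perturbed_solve) blast
  define C where "C = C1 + cmod b * C1"
  have "reduction_bounds C u v"
    if u: "u \<in> D0" and v: "v \<in> D" for u v
  proof -
    define r where "r = hnorm H (row1 u v) + hnorm H (row2 u v)"
    obtain u1 v1 m where u1: "u1 \<in> D0" and v1: "v1 \<in> D" and m: "m \<in> carr H"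
      and e1: "eqv (row1 u1 v1) (row1 u v + m)" and e2: "eqv (row2 u1 v1) (row2 u v)"
      and n: "hnorm H u1 \<le> C1 * r" "hnorm H v1 \<le> C1 * r" "hnorm H m \<le> C1 * r"
      unfolding r_def using sol[of "row1 u v" "row2 u v"] u v unfolding perturbed_solution_def by auto
    define w where "w = u - u1"
    have w0: "w \<in> D0" and v2: "v - v1 \<in> D" using u u1 v v1 by (auto simp: w_def D0_diff D_diff)
    have "eqv (row2 w (v - v1)) 0"
      unfolding w_def using eqv_ip[OF row_diff(2)[OF u u1 v v1]] eqv_ip[OF e2] u v u1 v1 w0 v2
      by (auto intro!: eqv_ipI simp: w_def ip_simps)
    then have "hnorm H (row2 w (v - v1)) = 0" by (simp add: eqv_hnorm_zero)
    from row2_zero[OF w0 v2 this] have w: "w \<in> domS" and vl: "eqv (v - v1) (lift w)" by auto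
    have "eqv (schur w) (scl H b m)"
    proof (rule eqv_ipI)
      fix z assume z: "z \<in> carr H"
      have "- 1 / b * ip H (schur w) z = ip H (row1 w (v - v1)) z"
        using eqv_ip[OF row1_solved[OF w v2 vl] z] w z by (simp add: ip_simps)
      also have "\<dots> = - ip H m z"
        unfolding w_def using eqv_ip[OF row_diff(1)[OF u u1 v v1] z] eqv_ip[OF e1 z] u v u1 v1 m z
        by (simp add: ip_simps)
      finally show "ip H (schur w) z = ip H (scl H b m) z" using b z m by (simp add: ip_scl field_simps)
    qed (use w m in auto)
    then have sw: "hnorm H (schur w) = cmod b * hnorm H m" using m by (simp add: eqv_hnorm hnorm_scl)
    have r0: "r \<ge> 0" using u v by (simp add: r_def)
    have le: "C1 * r \<le> C * r" "cmod b * (C1 * r) \<le> C * r"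
      using r0 C1 by (auto simp: C_def distrib_right)
    have "u - w = u1" by (simp add: w_def)
    then have "hnorm H (u - w) \<le> C * r" using n le by simp
    moreover have "eqv (v - lift w) v1"
      using eqv_ip[OF vl] w v v1 by (auto intro!: eqv_ipI simp: ip_simps algebra_simps)
    then have "hnorm H (v - lift w) \<le> C * r" using n le by (simp add: eqv_hnorm)
    moreover have "hnorm H (schur w) \<le> C * r"
      unfolding sw using n(3) le(2) by (meson mult_left_mono norm_ge_zero order_trans)
    ultimately show ?thesis using w unfolding r_def reduction_bounds_def by blast
  qed
  moreover have "C \<ge> 0" using C1 by (simp add: C_def)
  ultimately show thesis using that by blast
qed

end

section \<open>Equality of the spectra\<close>

context schur_pencil
begin

definition block_op :: "('v \<times> 'v) oper" where
  "block_op = \<lparr> odom = D0 \<times> D, omap = (\<lambda>(u, v). (row1 u v, row2 u v)) \<rparr>"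

definition schur_op :: "'v oper" where
  "schur_op = \<lparr> odom = domS, omap = schur \<rparr>"

lemma op_simps [simp]:
  "odom block_op = D0 \<times> D" "omap block_op (u, v) = (row1 u v, row2 u v)"
  "odom schur_op = domS" "omap schur_op = schur"
  by (simp_all add: block_op_def schur_op_def)

section \<open>Injectivity and bounded inverses\<close>

lemma block_lift:
  assumes "u \<in> domS"
  shows "hnorm H (row1 u (lift u)) = cmod (1 / b) * hnorm H (schur u)" "row2 u (lift u) = 0"
  using eqv_hnorm[OF row1_solved[OF assms _ eqv_refl]] assms
  by (auto simp: row2_lift hnorm_scl hnorm_uminus)

text \<open>The kernel form of injectivity compares \<open>u\<close> with \<open>0\<close>, but the
  representative \<open>A 0\<close> is only known to be null, not zero. Hence
  \<open>0 \<in> domS\<close> and the nullity of \<open>schur 0\<close> have to be derived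
  first.\<close>

lemma injective_schur_iff:
  "injective_op H schur_op \<longleftrightarrow> (\<forall>u\<in>domS. hnorm H (schur u) = 0 \<longrightarrow> hnorm H u = 0)"
proof
  assume inj: "injective_op H schur_op"
  have z: "0 \<in> domS" and "hnorm H (schur 0) = 0"
  proof -
    have A0: "eqv (A 0) 0" using A_scl[of 0 0] D0_D[OF D0_zero] by simp
    then have "eqv (P (A 0)) 0" using bdd_op_eqv[OF P A0] bdd_op_scl[OF P, of 0 0] by simp
    then have "P (A 0) \<in> D" using D_eqv[OF eqv_sym] D0_D[OF D0_zero] by blast
    then show z: "0 \<in> domS" using D0_zero by (intro domS_intro)
    have "eqv (schur (scl H 0 0)) (scl H 0 (schur 0))" by (rule schur_scl[OF z])
    then show "hnorm H (schur 0) = 0" by (simp add: eqv_hnorm)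
  qed
  then have s0: "eqv (schur 0) 0" by (simp add: eqv_def)
  show "\<forall>u\<in>domS. hnorm H (schur u) = 0 \<longrightarrow> hnorm H u = 0"
  proof (intro ballI impI)
    fix u assume u: "u \<in> domS" "hnorm H (schur u) = 0"
    then have "hnorm H (schur u - schur 0) = 0"
      using eqv_trans[OF _ eqv_sym[OF s0], of "schur u"] by (simp add: eqv_def)
    then have "hnorm H (u - 0) = 0"
      using inj[unfolded injective_op_def op_simps, rule_format, OF u(1) z] by simp
    then show "hnorm H u = 0" by simp
  qed
next
  assume k: "\<forall>u\<in>domS. hnorm H (schur u) = 0 \<longrightarrow> hnorm H u = 0"
  show "injective_op H schur_op"
    unfolding injective_op_def op_simps
    using k eqv_hnorm[OF schur_diff] domS_diff by metis
qed

lemma injective_block_iff: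
  "injective_op (hsum H H) block_op \<longleftrightarrow> (\<forall>u\<in>D0. \<forall>v\<in>D. hnorm H (row1 u v) = 0 \<longrightarrow>
     hnorm H (row2 u v) = 0 \<longrightarrow> hnorm H u = 0 \<and> hnorm H v = 0)"
proof
  assume inj: "injective_op (hsum H H) block_op"
  note D0_D[OF D0_zero, simp]
  have z: "eqv (row1 0 0) 0" "eqv (row2 0 0) 0"
    using row_scl[OF D0_zero D0_D[OF D0_zero], of 0] by simp_all
  show "\<forall>u\<in>D0. \<forall>v\<in>D. hnorm H (row1 u v) = 0 \<longrightarrow>
     hnorm H (row2 u v) = 0 \<longrightarrow> hnorm H u = 0 \<and> hnorm H v = 0"
  proof (intro ballI impI)
    fix u v assume u: "u \<in> D0" "v \<in> D" "hnorm H (row1 u v) = 0" "hnorm H (row2 u v) = 0"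
    then have "eqv (row1 u v) 0" "eqv (row2 u v) 0" by (auto simp: eqv_def)
    then have "eqv (row1 u v) (row1 0 0)" "eqv (row2 u v) (row2 0 0)"
      using z eqv_sym eqv_trans by blast+
    then have "hnorm (hsum H H) (row1 u v - row1 0 0, row2 u v - row2 0 0) = 0"
      by (subst hnorm_hsum_zero) (auto simp: eqv_def)
    then have "hnorm (hsum H H) (u - 0, v - 0) = 0"
      using inj u(1,2) D0_zero unfolding injective_op_def
      by (metis D0_D SigmaI diff_Pair op_simps(1,2))
    then show "hnorm H u = 0 \<and> hnorm H v = 0" using u by (simp add: hnorm_hsum_zero)
  qed
next
  assume k: "\<forall>u\<in>D0. \<forall>v\<in>D. hnorm H (row1 u v) = 0 \<longrightarrow>
     hnorm H (row2 u v) = 0 \<longrightarrow> hnorm H u = 0 \<and> hnorm H v = 0"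
  have "hnorm (hsum H H) ((u, v) - (u', v')) = 0"
    if "u \<in> D0" "v \<in> D" "u' \<in> D0" "v' \<in> D"
      "hnorm (hsum H H) ((row1 u v, row2 u v) - (row1 u' v', row2 u' v')) = 0" for u v u' v'
    using that k[rule_format, of "u - u'" "v - v'"]
      eqv_hnorm[OF row_diff(1)[of u u' v v']] eqv_hnorm[OF row_diff(2)[of u u' v v']]
    by (simp add: hnorm_hsum_zero D0_diff D_diff)
  then show "injective_op (hsum H H) block_op"
    unfolding injective_op_def by auto
qed

text \<open>A kernel vector of \<open>schur\<close> lifts to one of the block operator. Conversely a
  kernel pair is \<open>(u, lift u)\<close> up to null vectors, and \<open>energy\<close> makes
  \<open>lift u\<close> null once \<open>u\<close> and \<open>schur u\<close> are.\<close>

lemma injective_iff: "injective_op (hsum H H) block_op \<longleftrightarrow> injective_op H schur_op"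
proof
  assume inj: "injective_op (hsum H H) block_op"
  show "injective_op H schur_op"
    unfolding injective_schur_iff
  proof (intro ballI impI)
    fix u assume u: "u \<in> domS" "hnorm H (schur u) = 0"
    then show "hnorm H u = 0"
      using inj[unfolded injective_block_iff, rule_format, of u "lift u"] block_lift[OF u(1)] by simp
  qed
next
  assume inj: "injective_op H schur_op"
  show "injective_op (hsum H H) block_op"
    unfolding injective_block_iff
  proof (intro ballI impI)
    fix u v assume u: "u \<in> D0" and v: "v \<in> D" and "hnorm H (row1 u v) = 0" and r2: "hnorm H (row2 u v) = 0"
    note uv = row2_zero[OF u v r2]
    have "hnorm H (schur u) = 0"
      using eqv_hnorm[OF row1_solved[OF uv(1) v uv(2)]] \<open>hnorm H (row1 u v) = 0\<close> uv b
      by (simp add: hnorm_scl hnorm_uminus)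
    then have "hnorm H u = 0" using inj uv by (simp add: injective_schur_iff)
    moreover obtain C where "hnorm H (lift u) \<le> C * (hnorm H u + hnorm H (schur u))"
      using energy uv by blast
    then have "hnorm H (lift u) = 0"
      using \<open>hnorm H u = 0\<close> \<open>hnorm H (schur u) = 0\<close> hnorm_nonneg[of "lift u"] uv by (simp add: antisym)
    ultimately show "hnorm H u = 0 \<and> hnorm H v = 0" using eqv_hnorm[OF uv(2)] by simp
  qed
qed

lemma bounded_inverse_iff:
  "bounded_inverse_op (hsum H H) block_op \<longleftrightarrow> bounded_inverse_op H schur_op"
proof
  assume "bounded_inverse_op (hsum H H) block_op"
  then obtain C where C: "\<And>u v. \<lbrakk>u \<in> D0; v \<in> D\<rbrakk> \<Longrightarrow> hnorm (hsum H H) (u, v) \<le> C * hnorm (hsum H H) (row1 u v, row2 u v)"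
    unfolding bounded_inverse_op_def by fastforce
  have "hnorm H u \<le> (C * cmod (1 / b)) * hnorm H (schur u)" if u: "u \<in> domS" for u
  proof -
    have "hnorm (hsum H H) (row1 u (lift u), row2 u (lift u)) = cmod (1 / b) * hnorm H (schur u)"
      using block_lift[OF u] u by (simp add: hnorm_hsum)
    then show ?thesis using C[of u "lift u"] hnorm_hsum_bounds(1)[of u "lift u"] u
      by (simp add: mult.assoc del: mult_le_cancel_left)
  qed
  then show "bounded_inverse_op H schur_op" by (auto simp: bounded_inverse_op_def)
next
  assume "bounded_inverse_op H schur_op"
  then obtain B0 where B0: "\<And>u. u \<in> domS \<Longrightarrow> hnorm H u \<le> B0 * hnorm H (schur u)"
    unfolding bounded_inverse_op_def by auto
  \<comment> \<open>The definition of a bounded inverse leaves the sign of the constant open; the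
    monotonicity arguments below require a nonnegative one.\<close>
  define B where "B = max B0 0"
  have B: "B \<ge> 0" "\<And>u. u \<in> domS \<Longrightarrow> hnorm H u \<le> B * hnorm H (schur u)"
    unfolding B_def by (simp, rule order_trans[OF B0 mult_right_mono]) auto
  obtain C where C: "C \<ge> 0" and red: "\<And>u v. \<lbrakk>u \<in> D0; v \<in> D\<rbrakk> \<Longrightarrow> reduction_bounds C u v"
    by (rule reduction) blast
  obtain N where N: "N \<ge> 0" "\<And>u. u \<in> domS \<Longrightarrow> hnorm H (lift u) \<le> N * (hnorm H u + hnorm H (schur u))"
    by (rule energy) blast
  define K where "K = B + N * (B + 1)"
  have K: "K \<ge> 0" using B N by (simp add: K_def)
  \<comment> \<open>The two distances to \<open>(w, lift w)\<close> contribute \<open>2 * C\<close>,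
    the pair itself \<open>K * C\<close>, and the last factor \<open>2\<close> passes from the sum
    of the norms of the rows to the norm of the pair.\<close>
  have "hnorm (hsum H H) (u, v) \<le> (2 * C + K * C) * 2 * hnorm (hsum H H) (row1 u v, row2 u v)"
    if u: "u \<in> D0" and v: "v \<in> D" for u v
  proof -
    define r where "r = hnorm H (row1 u v) + hnorm H (row2 u v)"
    obtain w where w: "w \<in> domS" and uw: "hnorm H (u - w) \<le> C * r" and vw: "hnorm H (v - lift w) \<le> C * r"
      and sw: "hnorm H (schur w) \<le> C * r"
      using red[OF u v] unfolding r_def reduction_bounds_def by blast
    let ?s = "hnorm H (schur w)"
    have "hnorm H (lift w) \<le> N * (B * ?s + ?s)"
      using N(2)[OF w] B(2)[OF w] N(1) by (meson add_right_mono mult_left_mono order_trans)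
    then have "hnorm H w + hnorm H (lift w) \<le> K * ?s"
      using B(2)[OF w] by (simp add: K_def algebra_simps)
    also have "\<dots> \<le> K * (C * r)" using sw K by (rule mult_left_mono)
    finally have wl: "hnorm H w + hnorm H (lift w) \<le> K * (C * r)" .
    have "hnorm (hsum H H) (u, v) \<le> hnorm H u + hnorm H v" using hnorm_hsum_bounds u v by simp
    also have "\<dots> \<le> (2 * C + K * C) * r"
      using wl uw vw hnorm_le_add_diff[of u w] hnorm_le_add_diff[of v "lift w"] u v w
      by (simp add: algebra_simps)
    also have "\<dots> \<le> (2 * C + K * C) * (2 * hnorm (hsum H H) (row1 u v, row2 u v))"
      unfolding r_def using hnorm_hsum_bounds(1,2)[of "row1 u v" "row2 u v"] u v C K
      by (intro mult_left_mono) auto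
    finally show ?thesis by (simp only: mult.assoc)
  qed
  then show "bounded_inverse_op (hsum H H) block_op"
    unfolding bounded_inverse_op_def by auto
qed

section \<open>Ranges\<close>

lemma surjective_block_iff:
  "surjective_op (hsum H H) block_op \<longleftrightarrow> (\<forall>f\<in>carr H. \<forall>g\<in>carr H.
     \<exists>u\<in>D0. \<exists>v\<in>D. hnorm (hsum H H) (f - row1 u v, g - row2 u v) = 0)"
  by (simp add: surjective_op_def)

lemma dense_range_block_iff:
  "dense_range_op (hsum H H) block_op \<longleftrightarrow> (\<forall>f\<in>carr H. \<forall>g\<in>carr H. \<forall>e>0.
     \<exists>u\<in>D0. \<exists>v\<in>D. hnorm (hsum H H) (f - row1 u v, g - row2 u v) < e)"
  by (simp add: dense_range_op_def)

text \<open>Let \<open>(u, v)\<close> solve approximately for the data \<open>(- f / b, 0)\<close>.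
  Subtracting the perturbed solution for the data \<open>(0, row2 u v)\<close> makes the second row
  vanish, at the price of a vector \<open>m\<close> no larger than a multiple of the residual.
  Residual zero gives surjectivity, small residuals give density of the range.\<close>

lemma schur_range_from_block:
  obtains C where "C \<ge> 0" "\<And>f u v. \<lbrakk>f \<in> carr H; u \<in> D0; v \<in> D\<rbrakk> \<Longrightarrow> \<exists>w\<in>domS.
      hnorm H (f - schur w) \<le> C * hnorm (hsum H H) (scl H (- 1 / b) f - row1 u v, 0 - row2 u v)"
proof -
  obtain C where C: "C \<ge> 0" and sol: "\<And>f g. \<lbrakk>f \<in> carr H; g \<in> carr H\<rbrakk> \<Longrightarrow> perturbed_solution C f g"
    by (rule perturbed_solve) blast
  have "\<exists>w\<in>domS. hnorm H (f - schur w)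
      \<le> (cmod b * (1 + C)) * hnorm (hsum H H) (scl H (- 1 / b) f - row1 u v, 0 - row2 u v)"
    if f: "f \<in> carr H" and u: "u \<in> D0" and v: "v \<in> D" for f u v
  proof -
    let ?f = "scl H (- 1 / b) f"
    define e where "e = hnorm (hsum H H) (?f - row1 u v, 0 - row2 u v)"
    have l1: "hnorm H (?f - row1 u v) \<le> e" and l2: "hnorm H (row2 u v) \<le> e"
      using hnorm_hsum_bounds(1,2)[of "?f - row1 u v" "0 - row2 u v"] u v f
      by (auto simp: hnorm_uminus e_def)
    obtain u1 v1 m where u1: "u1 \<in> D0" and v1: "v1 \<in> D" and m: "m \<in> carr H"
      and e1: "eqv (row1 u1 v1) (0 + m)" and e2: "eqv (row2 u1 v1) (row2 u v)"
      and nm: "hnorm H m \<le> C * (hnorm H 0 + hnorm H (row2 u v))"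
      using sol[of 0 "row2 u v"] u v unfolding perturbed_solution_def by auto
    define w where "w = u - u1"
    have w0: "w \<in> D0" and v2: "v - v1 \<in> D" using u u1 v v1 by (auto simp: w_def D0_diff D_diff)
    have "eqv (row2 w (v - v1)) 0"
      unfolding w_def using eqv_ip[OF row_diff(2)[OF u u1 v v1]] eqv_ip[OF e2] u v u1 v1 w0 v2
      by (auto intro!: eqv_ipI simp: w_def ip_simps)
    then have "hnorm H (row2 w (v - v1)) = 0" by (simp add: eqv_hnorm_zero)
    from row2_zero[OF w0 v2 this] have w: "w \<in> domS" and vl: "eqv (v - v1) (lift w)" by auto
    have "eqv (f - schur w) (scl H (- b) (?f - row1 u v + m))"
    proof (rule eqv_ipI)
      fix z assume z: "z \<in> carr H"
      have "- 1 / b * ip H (schur w) z = ip H (row1 w (v - v1)) z"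
        using eqv_ip[OF row1_solved[OF w v2 vl] z] w z by (simp add: ip_simps)
      also have "\<dots> = ip H (row1 u v) z - ip H m z"
        unfolding w_def using eqv_ip[OF row_diff(1)[OF u u1 v v1] z] eqv_ip[OF e1 z] u v u1 v1 m z
        by (simp add: ip_simps)
      finally have "ip H (schur w) z = - b * (ip H (row1 u v) z - ip H m z)" using b by (simp add: field_simps)
      then show "ip H (f - schur w) z = ip H (scl H (- b) (?f - row1 u v + m)) z"
        using f u v m w z b by (simp add: ip_simps field_simps)
    qed (use f u v m w in auto)
    then have "hnorm H (f - schur w) = cmod b * hnorm H (?f - row1 u v + m)"
      using f u v m by (subst eqv_hnorm) (auto simp: hnorm_scl hnorm_uminus)
    also have "\<dots> \<le> cmod b * (hnorm H (?f - row1 u v) + hnorm H m)"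
      using f u v m by (intro mult_left_mono hnorm_triangle) auto
    also have "\<dots> \<le> cmod b * (e + C * e)"
    proof (intro mult_left_mono add_mono l1)
      show "hnorm H m \<le> C * e" using nm l2 C by (simp add: order_trans[OF _ mult_left_mono])
    qed simp
    finally show ?thesis using w by (intro bexI[of _ w]) (simp_all add: e_def algebra_simps)
  qed
  moreover have "cmod b * (1 + C) \<ge> 0" using C by simp
  ultimately show thesis using that by blast
qed

text \<open>The perturbed solution for \<open>(f, g)\<close> misses \<open>f\<close> by a vector
  that does not depend on \<open>w\<close>. Subtracting \<open>(w, lift w)\<close> leaves the second
  row alone up to null vectors and changes the first row by \<open>schur w / b\<close>, so it
  remains to approximate one fixed vector in the range of \<open>schur\<close>. The residuals agree
  up to a factor, which again covers surjectivity and density.\<close>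

lemma block_range_from_schur:
  assumes f: "f \<in> carr H" and g: "g \<in> carr H"
  obtains m where "m \<in> carr H" "\<And>w. w \<in> domS \<Longrightarrow> \<exists>u\<in>D0. \<exists>v\<in>D.
    hnorm (hsum H H) (f - row1 u v, g - row2 u v) = cmod (1 / b) * hnorm H (m - schur w)"
proof -
  obtain u1 v1 m where u1: "u1 \<in> D0" and v1: "v1 \<in> D" and m: "m \<in> carr H"
    and e1: "eqv (row1 u1 v1) (f + m)" and e2: "eqv (row2 u1 v1) g"
    using perturbed_solve f g unfolding perturbed_solution_def by metis
  have "\<exists>u\<in>D0. \<exists>v\<in>D. hnorm (hsum H H) (f - row1 u v, g - row2 u v)
      = cmod (1 / b) * hnorm H (scl H (- b) m - schur w)" if w: "w \<in> domS" for w
  proof -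
    let ?d = "scl H (- b) m - schur w"
    let ?u = "u1 - w" and ?v = "v1 - lift w"
    have uv: "?u \<in> D0" "?v \<in> D" using u1 v1 w by (auto simp: D0_diff D_diff)
    have 1: "eqv (f - row1 ?u ?v) (scl H (1 / b) ?d)"
    proof (rule eqv_ipI)
      fix z assume z: "z \<in> carr H"
      have "ip H (row1 w (lift w)) z = - 1 / b * ip H (schur w) z"
        using eqv_ip[OF row1_solved[OF w _ eqv_refl] z] w z by (simp add: ip_simps)
      then have "ip H (row1 ?u ?v) z = ip H f z + ip H m z + ip H (schur w) z / b"
        using eqv_ip[OF row_diff(1)[of u1 w v1 "lift w"] z] eqv_ip[OF e1 z] u1 v1 w m f z
        by (simp add: ip_simps)
      moreover have "ip H (scl H (1 / b) ?d) z = - ip H m z - ip H (schur w) z / b"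
        using m w z b by (simp add: ip_scl ip_simps diff_divide_distrib)
      ultimately show "ip H (f - row1 ?u ?v) z = ip H (scl H (1 / b) ?d) z"
        using uv f z by (simp add: ip_diff)
    qed (use uv w f m in auto)
    have n1: "hnorm H (f - row1 ?u ?v) = cmod (1 / b) * hnorm H ?d"
      using eqv_hnorm[OF 1] m w hnorm_scl[of ?d "1 / b"] by simp
    have "eqv (row2 ?u ?v) g"
      using eqv_trans[OF row_diff(2)[of u1 w v1 "lift w"], of g] e2 u1 v1 w by (simp add: row2_lift)
    then have n2: "hnorm H (g - row2 ?u ?v) = 0" using eqv_sym by (auto simp: eqv_def)
    have "hnorm (hsum H H) (f - row1 ?u ?v, g - row2 ?u ?v) = hnorm H (f - row1 ?u ?v)"
      using n2 uv f g by (subst hnorm_hsum) auto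
    then show ?thesis using n1 uv by metis
  qed
  then show thesis using that[of "scl H (- b) m"] m by simp
qed

lemma surjective_iff: "surjective_op (hsum H H) block_op \<longleftrightarrow> surjective_op H schur_op"
proof
  assume sur: "surjective_op (hsum H H) block_op"
  obtain C where C: "\<And>f u v. \<lbrakk>f \<in> carr H; u \<in> D0; v \<in> D\<rbrakk> \<Longrightarrow> \<exists>w\<in>domS.
      hnorm H (f - schur w) \<le> C * hnorm (hsum H H) (scl H (- 1 / b) f - row1 u v, 0 - row2 u v)"
    by (rule schur_range_from_block) blast
  show "surjective_op H schur_op"
    unfolding surjective_op_def
  proof
    fix f assume f: "f \<in> carr H"
    obtain u v where uv: "u \<in> D0" "v \<in> D"
      and z: "hnorm (hsum H H) (scl H (- 1 / b) f - row1 u v, 0 - row2 u v) = 0"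
      using sur[unfolded surjective_block_iff, rule_format, of "scl H (- 1 / b) f" 0] f by auto
    obtain w where "w \<in> domS" "hnorm H (f - schur w) \<le> 0" using C[OF f uv] unfolding z by auto
    then show "\<exists>u\<in>odom schur_op. hnorm H (f - omap schur_op u) = 0"
      using f by (intro bexI[of _ w]) (auto intro: antisym)
  qed
next
  assume sur: "surjective_op H schur_op"
  have "\<exists>u\<in>D0. \<exists>v\<in>D. hnorm (hsum H H) (f - row1 u v, g - row2 u v) = 0"
    if fg: "f \<in> carr H" "g \<in> carr H" for f g
  proof -
    obtain m where m: "m \<in> carr H" and red: "\<And>w. w \<in> domS \<Longrightarrow> \<exists>u\<in>D0. \<exists>v\<in>D.
        hnorm (hsum H H) (f - row1 u v, g - row2 u v) = cmod (1 / b) * hnorm H (m - schur w)"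
      using block_range_from_schur[OF fg] by blast
    obtain w where "w \<in> domS" "hnorm H (m - schur w) = 0"
      using sur m unfolding surjective_op_def op_simps by blast
    then show ?thesis using red[of w] by simp
  qed
  then show "surjective_op (hsum H H) block_op"
    unfolding surjective_block_iff by blast
qed

lemma dense_range_iff: "dense_range_op (hsum H H) block_op \<longleftrightarrow> dense_range_op H schur_op"
proof
  assume den: "dense_range_op (hsum H H) block_op"
  obtain C where C0: "C \<ge> 0" and C: "\<And>f u v. \<lbrakk>f \<in> carr H; u \<in> D0; v \<in> D\<rbrakk> \<Longrightarrow> \<exists>w\<in>domS.
      hnorm H (f - schur w) \<le> C * hnorm (hsum H H) (scl H (- 1 / b) f - row1 u v, 0 - row2 u v)"
    by (rule schur_range_from_block) blast
  show "dense_range_op H schur_op"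
    unfolding dense_range_op_def
  proof (intro ballI allI impI)
    fix f and e :: real assume f: "f \<in> carr H" and e: "e > 0"
    have "e / (C + 1) > 0" using e C0 by simp
    then obtain u v where uv: "u \<in> D0" "v \<in> D"
      and lt: "hnorm (hsum H H) (scl H (- 1 / b) f - row1 u v, 0 - row2 u v) < e / (C + 1)"
      using den[unfolded dense_range_block_iff, rule_format, of "scl H (- 1 / b) f" 0 "e / (C + 1)"] f by auto
    obtain w where w: "w \<in> domS" and le: "hnorm H (f - schur w)
        \<le> C * hnorm (hsum H H) (scl H (- 1 / b) f - row1 u v, 0 - row2 u v)"
      using C[OF f uv] by blast
    note le
    also have "\<dots> \<le> C * (e / (C + 1))" using lt C0 by (intro mult_left_mono) auto
    also have "\<dots> < e" using e C0 by (simp add: field_simps)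
    finally show "\<exists>u\<in>odom schur_op. hnorm H (f - omap schur_op u) < e" using w by auto
  qed
next
  assume den: "dense_range_op H schur_op"
  have "\<exists>u\<in>D0. \<exists>v\<in>D. hnorm (hsum H H) (f - row1 u v, g - row2 u v) < e"
    if fg: "f \<in> carr H" "g \<in> carr H" and e: "e > 0" for f g and e :: real
  proof -
    obtain m where m: "m \<in> carr H" and red: "\<And>w. w \<in> domS \<Longrightarrow> \<exists>u\<in>D0. \<exists>v\<in>D.
        hnorm (hsum H H) (f - row1 u v, g - row2 u v) = cmod (1 / b) * hnorm H (m - schur w)"
      using block_range_from_schur[OF fg] by blast
    have "e * cmod b > 0" using e b by simp
    then obtain w where w: "w \<in> domS" "hnorm H (m - schur w) < e * cmod b"
      using den m unfolding dense_range_op_def op_simps by blast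
    then have "cmod (1 / b) * hnorm H (m - schur w) < e" using b by (simp add: field_simps norm_divide)
    then show ?thesis using red[OF w(1)] by metis
  qed
  then show "dense_range_op (hsum H H) block_op"
    unfolding dense_range_block_iff by blast
qed

section \<open>Singular sequences\<close>

text \<open>Testing with \<open>z\<close> is transferred to \<open>w n\<close> and \<open>schur (w n)\<close> by solving the problem for the adjoint
  coefficient with right-hand side \<open>z\<close>; this makes density of \<open>D0\<close> or \<open>D\<close> unnecessary.\<close>

lemma weak_limit_lift:
  assumes w: "\<And>n. w n \<in> domS" and wbdd: "\<And>n. hnorm H (w n) \<le> 1"
    and weak: "\<And>z. z \<in> carr H \<Longrightarrow> (\<lambda>n. ip H (w n) z) \<longlonglongrightarrow> 0"
    and lim: "(\<lambda>n. hnorm H (schur (w n))) \<longlonglongrightarrow> 0"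
    and z: "z \<in> carr H"
  shows "(\<lambda>n. ip H (lift (w n)) z) \<longlonglongrightarrow> 0"
proof -
  obtain y where y: "y \<in> D0" and q: "scl H (cnj \<kappa>) (P' (A y)) - scl H (cnj \<kappa>) (P' z) \<in> D"
    and Aq: "eqv (A (scl H (cnj \<kappa>) (P' (A y)) - scl H (cnj \<kappa>) (P' z))) (0 - y)"
    using kappa_solve_adjoint[of 0 "scl H (cnj \<kappa>) (P' z)"] z by auto
  \<comment> \<open>Pair \<open>A (w n)\<close> with \<open>?q\<close>. Moving \<open>A\<close> onto
    \<open>?q\<close> gives \<open>- ip H (w n) y\<close> by the adjoint equation; moving the
    coefficient back gives \<open>\<kappa>\<close> times the pairing of \<open>P (A (w n))\<close>
    with \<open>A y - z\<close>, whose part with \<open>A y\<close> is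
    \<open>ip H (A (P (A (w n)))) y\<close> by Green's formula. All that remains beside
    \<open>z\<close> are pairings of \<open>w n\<close> and \<open>schur (w n)\<close> with fixed
    vectors.\<close>
  have eq: "\<kappa> * ip H (P (A (w n))) z
      = \<kappa> * (ip H (schur (w n)) y + a * b * ip H (w n) (E' y)) + ip H (w n) y" for n
  proof -
    let ?w = "w n" and ?q = "scl H (cnj \<kappa>) (P' (A y)) - scl H (cnj \<kappa>) (P' z)"
    have "ip H (A ?w) ?q = cnj (ip H (A ?q) ?w)"
      using green[of ?w ?q] q w[of n] ip_cnj[of ?q "A ?w"] ip_cnj[of "A ?q" ?w] by simp
    also have "\<dots> = - ip H ?w y"
      using eqv_ip[OF Aq, of ?w] w[of n] y ip_cnj[of y ?w] by (simp add: ip_simps)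
    finally have "\<kappa> * (ip H (P (A ?w)) (A y) - ip H (P (A ?w)) z) = - ip H ?w y"
      using w[of n] y z by (simp add: ip_simps P_adj right_diff_distrib)
    moreover have "ip H (P (A ?w)) (A y) = ip H (schur ?w) y + a * b * ip H ?w (E' y)"
      using green[OF y, of "P (A ?w)"] w[of n] y by (simp add: schur_def ip_simps E_adj)
    ultimately show ?thesis by (simp add: algebra_simps)
  qed
  have "(\<lambda>n. ip H (schur (w n)) y) \<longlonglongrightarrow> 0"
  proof (rule Lim_null_comparison)
    show "eventually (\<lambda>n. cmod (ip H (schur (w n)) y) \<le> hnorm H (schur (w n)) * hnorm H y) sequentially"
      using w y by (intro always_eventually allI Cauchy_Schwarz) auto
    show "(\<lambda>n. hnorm H (schur (w n)) * hnorm H y) \<longlonglongrightarrow> 0"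
      using tendsto_mult_right[OF lim, of "hnorm H y"] by simp
  qed
  then have "(\<lambda>n. \<kappa> * (ip H (schur (w n)) y + a * b * ip H (w n) (E' y)) + ip H (w n) y)
      \<longlonglongrightarrow> \<kappa> * (0 + a * b * 0) + 0"
    using y by (intro tendsto_intros weak) auto
  then have "(\<lambda>n. \<kappa> * ip H (P (A (w n))) z) \<longlonglongrightarrow> 0" by (simp add: eq)
  from tendsto_mult_left[OF this, of "\<i> / (b * \<kappa>)"]
  have "(\<lambda>n. \<i> / (b * \<kappa>) * (\<kappa> * ip H (P (A (w n))) z)) \<longlonglongrightarrow> 0" by simp
  moreover have "\<i> / (b * \<kappa>) * (\<kappa> * ip H (P (A (w n))) z) = ip H (lift (w n)) z" for n
    using \<kappa> w z by (simp add: lift_def ip_scl)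
  ultimately show ?thesis by simp
qed

text \<open>The pairs \<open>(w n, lift (w n))\<close> have norm at least \<open>1\<close>, so the
  normalising factor \<open>t n\<close> is at most \<open>1\<close> and preserves both the weak
  limit and the vanishing residual.\<close>

lemma essential_schur_imp_block:
  assumes "0 \<in> essential_spectrum H schur_op"
  shows "0 \<in> essential_spectrum (hsum H H) block_op"
proof -
  obtain w where w: "\<And>n. w n \<in> domS" and w1: "\<And>n. hnorm H (w n) = 1"
    and weak: "\<And>z. z \<in> carr H \<Longrightarrow> (\<lambda>n. ip H (w n) z) \<longlonglongrightarrow> 0"
    and lim: "(\<lambda>n::nat. hnorm H (schur (w n))) \<longlonglongrightarrow> 0"
    using assms by (auto simp: essential_spectrum_def shift_zero)
  have weak': "(\<lambda>n. ip H (lift (w n)) z) \<longlonglongrightarrow> 0" if "z \<in> carr H" for z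
    using weak_limit_lift[OF w _ weak lim that] w1 by simp
  define t where "t n = 1 / hnorm (hsum H H) (w n, lift (w n))" for n
  have ge1: "1 \<le> hnorm (hsum H H) (w n, lift (w n))" for n
    using hnorm_hsum_bounds(1)[of "w n" "lift (w n)"] w[of n] w1[of n] by simp
  have t: "0 < t n" "t n \<le> 1" for n using ge1[of n] by (auto simp: t_def)
  define U where "U n = (scl H (of_real (t n)) (w n), scl H (of_real (t n)) (lift (w n)))" for n
  have U: "U n \<in> odom block_op" for n
    using w by (simp add: U_def D0_scl D_scl)
  have U1: "hnorm (hsum H H) (U n) = 1" for n
  proof -
    have "hnorm (hsum H H) (U n) = sqrt ((t n)\<^sup>2 * ((hnorm H (w n))\<^sup>2 + (hnorm H (lift (w n)))\<^sup>2))"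
      using w[of n] t[of n] by (simp add: U_def hnorm_hsum hnorm_scl power_mult_distrib distrib_left)
    also have "\<dots> = t n * hnorm (hsum H H) (w n, lift (w n))"
      using w[of n] t[of n] by (simp add: hnorm_hsum real_sqrt_mult)
    finally show ?thesis using ge1[of n] by (simp add: t_def)
  qed
  have Uweak: "(\<lambda>n. ip (hsum H H) (U n) z) \<longlonglongrightarrow> 0" if "z \<in> carr (hsum H H)" for z
  proof -
    obtain x y where z: "z = (x, y)" and x: "x \<in> carr H" and y: "y \<in> carr H" using \<open>z \<in> _\<close> by auto
    have "(\<lambda>n. ip H (w n) x + ip H (lift (w n)) y) \<longlonglongrightarrow> 0"
      using tendsto_add[OF weak[OF x] weak'[OF y]] by simp
    then show ?thesis
    proof (rule Lim_null_comparison[OF _ tendsto_norm_zero, rotated])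
      have "cmod (ip (hsum H H) (U n) z) \<le> cmod (ip H (w n) x + ip H (lift (w n)) y)" for n
      proof -
        have "ip (hsum H H) (U n) z = of_real (t n) * (ip H (w n) x + ip H (lift (w n)) y)"
          using w[of n] x y by (simp add: U_def z ip_scl distrib_left)
        then show ?thesis using t[of n] by (simp add: norm_mult mult_left_le_one_le)
      qed
      then show "eventually (\<lambda>n. cmod (ip (hsum H H) (U n) z) \<le> cmod (ip H (w n) x + ip H (lift (w n)) y)) sequentially"
        by simp
    qed
  qed
  have Ulim: "(\<lambda>n. hnorm (hsum H H) (omap block_op (U n))) \<longlonglongrightarrow> 0"
  proof (rule Lim_null_comparison)
    have "norm (hnorm (hsum H H) (omap block_op (U n))) \<le> cmod (1 / b) * hnorm H (schur (w n))" for n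
    proof -
      have "hnorm H (row1 (fst (U n)) (snd (U n))) = t n * (cmod (1 / b) * hnorm H (schur (w n)))"
        using eqv_hnorm[OF row_scl(1)[of "w n" "lift (w n)" "of_real (t n)"]] w[of n] t[of n]
        by (simp add: U_def hnorm_scl block_lift)
      moreover have "hnorm H (row2 (fst (U n)) (snd (U n))) = 0"
        using eqv_hnorm[OF row_scl(2)[of "w n" "lift (w n)" "of_real (t n)"]] w[of n]
        by (simp add: U_def block_lift)
      ultimately have "hnorm (hsum H H) (omap block_op (U n)) = t n * (cmod (1 / b) * hnorm H (schur (w n)))"
        using U[of n] t[of n] w[of n] by (cases "U n") (simp add: hnorm_hsum)
      then show ?thesis using t[of n] w[of n] by (simp add: mult_left_le_one_le)
    qed
    then show "eventually (\<lambda>n. norm (hnorm (hsum H H) (omap block_op (U n))) \<le> cmod (1 / b) * hnorm H (schur (w n))) sequentially"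
      by simp
    show "(\<lambda>n. cmod (1 / b) * hnorm H (schur (w n))) \<longlonglongrightarrow> 0"
      using tendsto_mult_left[OF lim, of "cmod (1 / b)"] by simp
  qed
  show ?thesis
    unfolding essential_spectrum_def shift_zero_hsum mem_Collect_eq
    by (intro exI[of _ U] conjI allI ballI U U1 Uweak Ulim)
qed

text \<open>\<open>reduction\<close> replaces the pairs by \<open>(w n, lift (w n))\<close> with
  errors tending to zero. Normalising \<open>w n\<close> requires a lower bound for its norm, that
  is, the mass must not escape into the second component.\<close>

lemma essential_block_imp_schur:
  assumes "0 \<in> essential_spectrum (hsum H H) block_op"
  shows "0 \<in> essential_spectrum H schur_op"
proof -
  obtain U where U: "\<And>n. U n \<in> D0 \<times> D" and U1: "\<And>n. hnorm (hsum H H) (U n) = 1"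
    and weak: "\<And>z. z \<in> carr H \<times> carr H \<Longrightarrow> (\<lambda>n. ip (hsum H H) (U n) z) \<longlonglongrightarrow> 0"
    and lim: "(\<lambda>n::nat. hnorm (hsum H H) (omap block_op (U n))) \<longlonglongrightarrow> 0"
    using assms by (auto simp: essential_spectrum_def shift_zero_hsum)
  define u v where "u n = fst (U n)" and "v n = snd (U n)" for n
  have uv: "U n = (u n, v n)" "u n \<in> D0" "v n \<in> D" for n using U[of n] by (auto simp: u_def v_def)
  define r where "r n = hnorm H (row1 (u n) (v n)) + hnorm H (row2 (u n) (v n))" for n
  have r0: "r n \<ge> 0" for n using uv by (simp add: r_def)
  have rlim: "r \<longlonglongrightarrow> 0"
  proof (rule Lim_null_comparison)
    have "norm (r n) \<le> 2 * hnorm (hsum H H) (omap block_op (U n))" for n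
      using hnorm_hsum_bounds(1,2)[of "row1 (u n) (v n)" "row2 (u n) (v n)"] uv[of n] r0[of n]
      by (simp add: r_def)
    then show "eventually (\<lambda>n. norm (r n) \<le> 2 * hnorm (hsum H H) (omap block_op (U n))) sequentially"
      by simp
    show "(\<lambda>n. 2 * hnorm (hsum H H) (omap block_op (U n))) \<longlonglongrightarrow> 0"
      using tendsto_mult_left[OF lim, of 2] by simp
  qed
  obtain C where C: "C \<ge> 0" and red: "\<And>u v. \<lbrakk>u \<in> D0; v \<in> D\<rbrakk> \<Longrightarrow> reduction_bounds C u v"
    by (rule reduction) blast
  obtain N where N: "N \<ge> 0" "\<And>u. u \<in> domS \<Longrightarrow> hnorm H (lift u) \<le> N * (hnorm H u + hnorm H (schur u))"
    by (rule energy) blast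
  have "\<forall>n. \<exists>w\<in>domS. hnorm H (u n - w) \<le> C * r n \<and> hnorm H (v n - lift w) \<le> C * r n
      \<and> hnorm H (schur w) \<le> C * r n"
    unfolding r_def using red uv unfolding reduction_bounds_def by blast
  then obtain w where w: "\<And>n. w n \<in> domS" and uw: "\<And>n. hnorm H (u n - w n) \<le> C * r n"
    and vw: "\<And>n. hnorm H (v n - lift (w n)) \<le> C * r n" and sw: "\<And>n. hnorm H (schur (w n)) \<le> C * r n"
    by metis
  have Cr: "(\<lambda>n. K * r n) \<longlonglongrightarrow> 0" for K using tendsto_mult_left[OF rlim, of K] by simp
  \<comment> \<open>Here \<open>energy\<close> bounds the second component by the first: the total
    mass \<open>1\<close> is at most a multiple of the norm of \<open>w n\<close> plus a term
    tending to zero.\<close>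
  have low: "1 \<le> (1 + N) * hnorm H (w n) + (2 * C + N * C) * r n" for n
  proof -
    have "1 \<le> hnorm H (u n) + hnorm H (v n)"
      using U1[of n] hnorm_hsum_bounds(3)[of "u n" "v n"] uv[of n] by simp
    also have "\<dots> \<le> hnorm H (w n) + C * r n + (hnorm H (lift (w n)) + C * r n)"
      using hnorm_le_add_diff[of "u n" "w n"] hnorm_le_add_diff[of "v n" "lift (w n)"] uv[of n] w[of n]
        uw[of n] vw[of n] by simp
    also have "hnorm H (lift (w n)) \<le> N * (hnorm H (w n) + C * r n)"
      using N(1) sw[of n] by (intro order_trans[OF N(2)[OF w]] mult_left_mono) auto
    finally show ?thesis by (simp add: algebra_simps)
  qed
  \<comment> \<open>Once the vanishing term in \<open>low\<close> is below \<open>1 / 2\<close>, the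
    norm of \<open>w n\<close> is at least this.\<close>
  define c where "c = 1 / (2 * (1 + N))"
  have c: "c > 0" using N by (simp add: c_def)
  have "eventually (\<lambda>n. (2 * C + N * C) * r n < 1 / 2) sequentially"
    by (rule order_tendstoD(2)[OF Cr]) simp
  then obtain n0 where n0: "\<And>n. n \<ge> n0 \<Longrightarrow> (2 * C + N * C) * r n < 1 / 2"
    by (auto simp: eventually_sequentially)
  \<comment> \<open>The lower bound has to hold for every index, so the first \<open>n0\<close>
    members are dropped.\<close>
  define k where "k n = w (n + n0)" for n
  have k: "k n \<in> domS" for n using w by (simp add: k_def)
  have kc: "c \<le> hnorm H (k n)" for n
  proof -
    have "1 / 2 \<le> (1 + N) * hnorm H (k n)" using low[of "n + n0"] n0[of "n + n0"] by (simp add: k_def)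
    then show ?thesis using N by (simp add: c_def field_simps)
  qed
  define s where "s n = 1 / hnorm H (k n)" for n
  have s: "0 < s n" "s n \<le> 1 / c" for n
    using kc[of n] c by (auto simp: s_def intro: frac_le)
  define x where "x n = scl H (of_real (s n)) (k n)" for n
  have x: "x n \<in> odom schur_op" for n using domS_scl[OF k] by (simp add: x_def)
  have x1: "hnorm H (x n) = 1" for n
  proof -
    have "hnorm H (x n) = s n * hnorm H (k n)" using s[of n] k[of n] by (simp add: x_def hnorm_scl)
    also have "\<dots> = 1" using kc[of n] c by (simp add: s_def)
    finally show ?thesis .
  qed
  have wweak: "(\<lambda>n. ip H (w n) z) \<longlonglongrightarrow> 0" if z: "z \<in> carr H" for z
  proof -
    have "(\<lambda>n. ip H (u n) z) \<longlonglongrightarrow> 0"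
      using weak[of "(z, 0)"] z uv by simp
    moreover have "(\<lambda>n. ip H (u n - w n) z) \<longlonglongrightarrow> 0"
    proof (rule Lim_null_comparison)
      have "cmod (ip H (u n - w n) z) \<le> (C * hnorm H z) * r n" for n
        using mult_right_mono[OF uw[of n] hnorm_nonneg[OF z]] Cauchy_Schwarz[of "u n - w n" z] uv[of n] w[of n] z
        by (simp add: mult_ac)
      then show "eventually (\<lambda>n. cmod (ip H (u n - w n) z) \<le> (C * hnorm H z) * r n) sequentially" by simp
    qed (rule Cr)
    ultimately have "(\<lambda>n. ip H (u n) z - ip H (u n - w n) z) \<longlonglongrightarrow> 0 - 0" by (rule tendsto_diff)
    then show ?thesis using uv w z by (simp add: ip_diff)
  qed
  have xweak: "(\<lambda>n. ip H (x n) z) \<longlonglongrightarrow> 0" if z: "z \<in> carr H" for z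
  proof (rule Lim_null_comparison)
    have "cmod (ip H (x n) z) \<le> 1 / c * cmod (ip H (k n) z)" for n
      using s[of n] k[of n] z by (simp add: x_def ip_scl norm_mult mult_right_mono del: times_divide_eq_left)
    then show "eventually (\<lambda>n. cmod (ip H (x n) z) \<le> 1 / c * cmod (ip H (k n) z)) sequentially" by simp
    have "(\<lambda>n. cmod (ip H (k n) z)) \<longlonglongrightarrow> 0"
      unfolding k_def using LIMSEQ_ignore_initial_segment[OF wweak[OF z], of n0] by (rule tendsto_norm_zero)
    from tendsto_mult_left[OF this, of "1 / c"] show "(\<lambda>n. 1 / c * cmod (ip H (k n) z)) \<longlonglongrightarrow> 0" by simp
  qed
  have "(\<lambda>n. hnorm H (schur (x n))) \<longlonglongrightarrow> 0"
  proof (rule Lim_null_comparison)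
    have "norm (hnorm H (schur (x n))) \<le> 1 / c * (C * r (n + n0))" for n
    proof -
      have "hnorm H (schur (x n)) = s n * hnorm H (schur (k n))"
        unfolding x_def using eqv_hnorm[OF schur_scl[OF k]] k[of n] s[of n] by (simp add: hnorm_scl)
      also have "\<dots> \<le> 1 / c * (C * r (n + n0))"
        unfolding k_def using s[of n] sw[of "n + n0"] w[of "n + n0"] c by (intro mult_mono) auto
      finally show ?thesis using x[of n] by simp
    qed
    then show "eventually (\<lambda>n. norm (hnorm H (schur (x n))) \<le> 1 / c * (C * r (n + n0))) sequentially" by simp
    have "(\<lambda>n. C * r (n + n0)) \<longlonglongrightarrow> 0" using LIMSEQ_ignore_initial_segment[OF Cr[of C], of n0] .
    from tendsto_mult_left[OF this, of "1 / c"] show "(\<lambda>n. 1 / c * (C * r (n + n0))) \<longlonglongrightarrow> 0" by simp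
  qed
  then have xlim: "(\<lambda>n. hnorm H (omap schur_op (x n))) \<longlonglongrightarrow> 0" by simp
  show ?thesis
    unfolding essential_spectrum_def shift_zero mem_Collect_eq
    by (intro exI[of _ x] conjI allI ballI x x1 xweak xlim)
qed

lemma spectra_agree:
  "0 \<in> spectrum (hsum H H) block_op \<longleftrightarrow> 0 \<in> spectrum H schur_op"
  "0 \<in> point_spectrum (hsum H H) block_op \<longleftrightarrow> 0 \<in> point_spectrum H schur_op"
  "0 \<in> continuous_spectrum (hsum H H) block_op \<longleftrightarrow> 0 \<in> continuous_spectrum H schur_op"
  "0 \<in> residual_spectrum (hsum H H) block_op \<longleftrightarrow> 0 \<in> residual_spectrum H schur_op"
  "0 \<in> essential_spectrum (hsum H H) block_op \<longleftrightarrow> 0 \<in> essential_spectrum H schur_op"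
  using essential_schur_imp_block essential_block_imp_schur
  by (auto simp: spectrum_def point_spectrum_def continuous_spectrum_def residual_spectrum_def
      shift_zero shift_zero_hsum injective_iff surjective_iff bounded_inverse_iff dense_range_iff)

end

section \<open>The space of square-integrable fields\<close>

lemma measurable_vec_nth [measurable (raw)]:
  fixes u :: "'a \<Rightarrow> complex^3"
  assumes "u \<in> borel_measurable M" shows "(\<lambda>x. u x $ k) \<in> borel_measurable M"
  using assms by (rule borel_measurable_continuous_on[where f = "\<lambda>x. x $ k", rotated]) (intro continuous_intros)

lemma measurable_vec_scale [measurable (raw)]:
  fixes u :: "'a \<Rightarrow> complex^3"
  assumes m: "m \<in> borel_measurable M" and u: "u \<in> borel_measurable M"
  shows "(\<lambda>x. m x *s u x) \<in> borel_measurable M"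
proof -
  have "continuous_on UNIV (\<lambda>p::complex \<times> (complex^3). fst p *s snd p)"
    unfolding vector_scalar_mult_def by (intro continuous_intros)
  from borel_measurable_continuous_on[OF this borel_measurable_Pair[OF m u]] show ?thesis by simp
qed

lemma measurable_cnj [measurable (raw)]:
  "f \<in> borel_measurable M \<Longrightarrow> (\<lambda>x. cnj (f x)) \<in> borel_measurable M"
  by (rule borel_measurable_continuous_on[where f = cnj, OF linear_continuous_on[OF bounded_linear_cnj]])

lemma norm_vec_scale: "norm (c *s (v :: complex^3)) = cmod c * norm v"
  by (simp add: norm_vec_def norm_mult L2_set_right_distrib)

lemma norm_vec_sq: "(\<Sum>k\<in>UNIV. v $ k * cnj (v $ k)) = of_real ((norm (v :: complex^3))\<^sup>2)"
  by (simp add: norm_vec_def L2_set_def sum_nonneg complex_norm_square del: of_real_power)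

lemma L2_carr_iff:
  "u \<in> carr (L2 \<Omega>) \<longleftrightarrow> u \<in> borel_measurable (lebesgue_on \<Omega>) \<and> integrable (lebesgue_on \<Omega>) (\<lambda>x. (norm (u x))\<^sup>2)"
  by (simp add: L2_def)

lemma L2_scl [simp]: "scl (L2 \<Omega>) c u = (\<lambda>x. c *s u x)"
  by (simp add: L2_def)

lemma L2_ip: "ip (L2 \<Omega>) u v = (LINT x|lebesgue_on \<Omega>. (\<Sum>k\<in>UNIV. u x $ k * cnj (v x $ k)))"
  by (simp add: L2_def)

lemma L2_measurable: "u \<in> carr (L2 \<Omega>) \<Longrightarrow> u \<in> borel_measurable (lebesgue_on \<Omega>)"
  by (simp add: L2_carr_iff)

lemma L2_integrable_component:
  assumes u: "u \<in> carr (L2 \<Omega>)" and v: "v \<in> carr (L2 \<Omega>)"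
  shows "integrable (lebesgue_on \<Omega>) (\<lambda>x. u x $ i * cnj (v x $ j))"
proof (rule Bochner_Integration.integrable_bound)
  show "integrable (lebesgue_on \<Omega>) (\<lambda>x. (norm (u x))\<^sup>2 + (norm (v x))\<^sup>2)"
    using assms by (simp add: L2_carr_iff)
  note [measurable] = L2_measurable[OF u] L2_measurable[OF v]
  show "(\<lambda>x. u x $ i * cnj (v x $ j)) \<in> borel_measurable (lebesgue_on \<Omega>)" by measurable
  show "AE x in lebesgue_on \<Omega>. norm (u x $ i * cnj (v x $ j)) \<le> norm ((norm (u x))\<^sup>2 + (norm (v x))\<^sup>2)"
  proof (rule AE_I2)
    fix x
    have "cmod (u x $ i) * cmod (v x $ j) \<le> norm (u x) * norm (v x)"
      by (intro mult_mono Finite_Cartesian_Product.norm_nth_le) auto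
    also have "\<dots> \<le> (norm (u x))\<^sup>2 + (norm (v x))\<^sup>2"
      using sum_squares_bound[of "norm (u x)" "norm (v x)"] mult_nonneg_nonneg[OF norm_ge_zero[of "u x"] norm_ge_zero[of "v x"]] by linarith
    finally show "norm (u x $ i * cnj (v x $ j)) \<le> norm ((norm (u x))\<^sup>2 + (norm (v x))\<^sup>2)"
      by (simp add: norm_mult)
  qed
qed

lemma L2_integrable:
  assumes "u \<in> carr (L2 \<Omega>)" "v \<in> carr (L2 \<Omega>)"
  shows "integrable (lebesgue_on \<Omega>) (\<lambda>x. \<Sum>k\<in>UNIV. u x $ k * cnj (v x $ k))"
  using L2_integrable_component[OF assms] by auto

lemma L2_norm_sq:
  "(hnorm (L2 \<Omega>) u)\<^sup>2 = (LINT x|lebesgue_on \<Omega>. (norm (u x))\<^sup>2)"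
proof -
  have "ip (L2 \<Omega>) u u = of_real (LINT x|lebesgue_on \<Omega>. (norm (u x))\<^sup>2)"
    unfolding L2_ip norm_vec_sq by (rule integral_complex_of_real)
  then show ?thesis by (simp add: hnorm_def)
qed

lemma vector_space_fun: "vector_space (\<lambda>c (u :: 'a \<Rightarrow> complex^3) x. c *s u x)"
  by unfold_locales (auto simp: fun_eq_iff vector_add_ldistrib vector_sadd_rdistrib vector_smult_assoc)

lemma L2_add_carr:
  assumes u: "u \<in> carr (L2 \<Omega>)" and v: "v \<in> carr (L2 \<Omega>)"
  shows "u + v \<in> carr (L2 \<Omega>)"
proof -
  note [measurable] = L2_measurable[OF u] L2_measurable[OF v]
  have "integrable (lebesgue_on \<Omega>) (\<lambda>x. (norm (u x + v x))\<^sup>2)"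
  proof (rule Bochner_Integration.integrable_bound)
    show "integrable (lebesgue_on \<Omega>) (\<lambda>x. 2 * (norm (u x))\<^sup>2 + 2 * (norm (v x))\<^sup>2)"
      using assms by (simp add: L2_carr_iff)
    show "AE x in lebesgue_on \<Omega>. norm ((norm (u x + v x))\<^sup>2) \<le> norm (2 * (norm (u x))\<^sup>2 + 2 * (norm (v x))\<^sup>2)"
    proof (rule AE_I2)
      fix x
      have "(norm (u x + v x))\<^sup>2 \<le> (norm (u x) + norm (v x))\<^sup>2"
        by (intro power_mono norm_triangle_ineq) auto
      also have "\<dots> \<le> 2 * (norm (u x))\<^sup>2 + 2 * (norm (v x))\<^sup>2"
        using sum_squares_bound[of "norm (u x)" "norm (v x)"] by (simp add: power2_sum)
      finally show "norm ((norm (u x + v x))\<^sup>2) \<le> norm (2 * (norm (u x))\<^sup>2 + 2 * (norm (v x))\<^sup>2)" by simp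
    qed
  qed measurable
  then show ?thesis by (simp add: L2_carr_iff plus_fun_def)
qed

lemma L2_mult_carr:
  assumes u: "u \<in> carr (L2 \<Omega>)" and m: "m \<in> borel_measurable (lebesgue_on \<Omega>)"
    and C: "AE x in lebesgue_on \<Omega>. cmod (m x) \<le> C"
  shows "(\<lambda>x. m x *s u x) \<in> carr (L2 \<Omega>)"
    and "(hnorm (L2 \<Omega>) (\<lambda>x. m x *s u x))\<^sup>2 \<le> C\<^sup>2 * (hnorm (L2 \<Omega>) u)\<^sup>2"
proof -
  note [measurable] = L2_measurable[OF u] m
  have le: "AE x in lebesgue_on \<Omega>. (norm (m x *s u x))\<^sup>2 \<le> C\<^sup>2 * (norm (u x))\<^sup>2"
    using C by eventually_elim (auto simp: norm_vec_scale power_mult_distrib intro!: mult_right_mono power_mono)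
  have i: "integrable (lebesgue_on \<Omega>) (\<lambda>x. C\<^sup>2 * (norm (u x))\<^sup>2)" using u by (simp add: L2_carr_iff)
  have i': "integrable (lebesgue_on \<Omega>) (\<lambda>x. (norm (m x *s u x))\<^sup>2)"
    by (rule Bochner_Integration.integrable_bound[OF i]) (use le in auto)
  then show "(\<lambda>x. m x *s u x) \<in> carr (L2 \<Omega>)" by (simp add: L2_carr_iff)
  show "(hnorm (L2 \<Omega>) (\<lambda>x. m x *s u x))\<^sup>2 \<le> C\<^sup>2 * (hnorm (L2 \<Omega>) u)\<^sup>2"
    unfolding L2_norm_sq using integral_mono_AE[OF i' i le] by simp
qed

lemma semi_inner_L2: "semi_inner (L2 \<Omega>)"
proof (rule semi_inner.intro)
  show "vector_space (scl (L2 \<Omega>))"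
    using vector_space_fun by (simp add: L2_def)
  show "0 \<in> carr (L2 \<Omega>)" by (simp add: L2_carr_iff zero_fun_def)
  show "x + y \<in> carr (L2 \<Omega>)" if "x \<in> carr (L2 \<Omega>)" "y \<in> carr (L2 \<Omega>)" for x y
    using that by (rule L2_add_carr)
  show "scl (L2 \<Omega>) c x \<in> carr (L2 \<Omega>)" if "x \<in> carr (L2 \<Omega>)" for x c
    using L2_mult_carr(1)[OF that, of "\<lambda>_. c" "cmod c"] by simp
  show "ip (L2 \<Omega>) (x + y) z = ip (L2 \<Omega>) x z + ip (L2 \<Omega>) y z"
    if "x \<in> carr (L2 \<Omega>)" "y \<in> carr (L2 \<Omega>)" "z \<in> carr (L2 \<Omega>)" for x y z
    using L2_integrable[OF that(1,3)] L2_integrable[OF that(2,3)]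
    by (simp add: L2_ip distrib_right sum.distrib Bochner_Integration.integral_add)
  show "ip (L2 \<Omega>) (scl (L2 \<Omega>) c x) z = c * ip (L2 \<Omega>) x z"
    if "x \<in> carr (L2 \<Omega>)" "z \<in> carr (L2 \<Omega>)" for x z c
    by (simp add: L2_ip mult.assoc flip: sum_distrib_left)
  show "ip (L2 \<Omega>) y x = cnj (ip (L2 \<Omega>) x y)" if "x \<in> carr (L2 \<Omega>)" "y \<in> carr (L2 \<Omega>)" for x y
    unfolding L2_ip Bochner_Integration.integral_cnj[symmetric] by (simp add: mult.commute)
  show "0 \<le> Re (ip (L2 \<Omega>) x x)" if "x \<in> carr (L2 \<Omega>)" for x
    unfolding L2_ip norm_vec_sq integral_complex_of_real by simp
qed

text \<open>Riesz--Fischer. Along a subsequence the weighted squares of the increments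
  \<open>2 ^ k * |X (s (k + 1)) - X (s k)| ^ 2\<close> have a finite sum of integrals, which makes the
  increments geometrically small almost everywhere; Fatou's lemma then identifies the pointwise
  limit as the limit in the norm.\<close>

lemma L2_complete:
  assumes X: "\<And>n. X n \<in> carr (L2 \<Omega>)"
    and Cau: "\<And>e. e > 0 \<Longrightarrow> \<exists>N. \<forall>m\<ge>N. \<forall>n\<ge>N. hnorm (L2 \<Omega>) (X m - X n) < e"
  shows "\<exists>x\<in>carr (L2 \<Omega>). (\<lambda>n::nat. hnorm (L2 \<Omega>) (X n - x)) \<longlonglongrightarrow> 0"
proof -
  interpret H: semi_inner "L2 \<Omega>" by (rule semi_inner_L2)
  let ?M = "lebesgue_on \<Omega>"
  note [measurable] = L2_measurable[OF X]
  have nn_norm: "(\<integral>\<^sup>+x. ennreal ((norm (u x))\<^sup>2) \<partial>?M) = ennreal ((hnorm (L2 \<Omega>) u)\<^sup>2)"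
    if "u \<in> carr (L2 \<Omega>)" for u
    unfolding L2_norm_sq using that by (intro nn_integral_eq_integral) (auto simp: L2_carr_iff)
  have "\<forall>k. \<exists>N. \<forall>m\<ge>N. \<forall>n\<ge>N. hnorm (L2 \<Omega>) (X m - X n) < (1/2) ^ k" using Cau by simp
  then obtain N where N: "\<And>k m n. \<lbrakk>m \<ge> N k; n \<ge> N k\<rbrakk> \<Longrightarrow> hnorm (L2 \<Omega>) (X m - X n) < (1/2) ^ k"
    by metis
  define s where "s = rec_nat (N 0) (\<lambda>k r. max (Suc r) (N (Suc k)))"
  have s_Suc: "s (Suc k) = max (Suc (s k)) (N (Suc k))" for k by (simp add: s_def)
  have sN: "N k \<le> s k" for k by (cases k) (simp_all add: s_def)
  have s_mono: "strict_mono s" by (rule strict_monoI_Suc) (simp add: s_Suc less_max_iff_disj)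
  define g where "g k x = norm (X (s (Suc k)) x - X (s k) x)" for k x
  have [measurable]: "g k \<in> borel_measurable ?M" for k unfolding g_def by measurable
  have gint: "(\<integral>\<^sup>+x. ennreal (2 ^ k * (g k x)\<^sup>2) \<partial>?M) \<le> ennreal ((1/2) ^ k)" for k
  proof -
    have "(\<integral>\<^sup>+x. ennreal (2 ^ k * (g k x)\<^sup>2) \<partial>?M) = ennreal (2 ^ k) * (\<integral>\<^sup>+x. ennreal ((g k x)\<^sup>2) \<partial>?M)"
      by (simp add: ennreal_mult nn_integral_cmult)
    also have "(\<integral>\<^sup>+x. ennreal ((g k x)\<^sup>2) \<partial>?M) = ennreal ((hnorm (L2 \<Omega>) (X (s (Suc k)) - X (s k)))\<^sup>2)"
      using nn_norm[OF H.diff_carr[OF X X]] by (simp add: g_def)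
    also have "ennreal (2 ^ k) * \<dots> = ennreal (2 ^ k * (hnorm (L2 \<Omega>) (X (s (Suc k)) - X (s k)))\<^sup>2)"
      by (simp add: ennreal_mult)
    also have "\<dots> \<le> ennreal ((1/2) ^ k)"
    proof (rule ennreal_leI)
      have "s (Suc k) \<ge> N k" using sN[of k] by (simp add: s_Suc le_max_iff_disj)
      then have "hnorm (L2 \<Omega>) (X (s (Suc k)) - X (s k)) \<le> (1/2) ^ k" using N sN[of k] less_imp_le by blast
      then have "2 ^ k * (hnorm (L2 \<Omega>) (X (s (Suc k)) - X (s k)))\<^sup>2 \<le> 2 ^ k * ((1/2) ^ k)\<^sup>2"
        using X by (intro mult_left_mono power_mono) auto
      also have "\<dots> = (1/2) ^ k" by (simp add: power2_eq_square power_one_over)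
      finally show "2 ^ k * (hnorm (L2 \<Omega>) (X (s (Suc k)) - X (s k)))\<^sup>2 \<le> (1/2) ^ k" .
    qed
    finally show ?thesis .
  qed
  have "(\<integral>\<^sup>+x. (\<Sum>k. ennreal (2 ^ k * (g k x)\<^sup>2)) \<partial>?M) = (\<Sum>k. \<integral>\<^sup>+x. ennreal (2 ^ k * (g k x)\<^sup>2) \<partial>?M)"
    by (intro nn_integral_suminf) measurable
  also have "\<dots> \<le> (\<Sum>k. ennreal ((1/2) ^ k))" by (intro suminf_le gint) auto
  also have "\<dots> = ennreal (\<Sum>k. (1/2) ^ k)" by (intro suminf_ennreal2) (auto simp: summable_geometric)
  also have "\<dots> < \<infinity>" by simp
  finally have "AE x in ?M. (\<Sum>k. ennreal (2 ^ k * (g k x)\<^sup>2)) \<noteq> \<infinity>"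
    by (intro nn_integral_PInf_AE) (auto simp: less_top)
  then have conv: "AE x in ?M. convergent (\<lambda>k. X (s k) x)"
  proof eventually_elim
    case (elim x)
    have "summable (\<lambda>k. 2 ^ k * (g k x)\<^sup>2)"
      by (rule summable_suminf_not_top) (use elim in \<open>auto simp: top_ennreal_def\<close>)
    then have "Bseq (\<lambda>k. 2 ^ k * (g k x)\<^sup>2)"
      by (intro convergent_imp_Bseq) (auto simp: convergent_def dest: summable_LIMSEQ_zero)
    then obtain K where K: "K > 0" "\<And>k. 2 ^ k * (g k x)\<^sup>2 \<le> K" by (auto simp: Bseq_def)
    \<comment> \<open>The terms of a convergent series are bounded, here by \<open>K\<close>, so
      \<open>g k x\<close> decays at least like the power \<open>k\<close> of
      \<open>sqrt (1/2)\<close>.\<close>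
    have gk: "norm (g k x) \<le> sqrt K * (sqrt (1/2)) ^ k" for k
    proof -
      have "(g k x)\<^sup>2 \<le> K * (1/2) ^ k" using K(2)[of k] by (simp add: field_simps power_one_over)
      then have "g k x \<le> sqrt (K * (1/2) ^ k)" by (rule real_le_rsqrt)
      then show ?thesis by (simp add: real_sqrt_mult real_sqrt_power g_def)
    qed
    have "summable (\<lambda>k. sqrt K * (sqrt (1/2)) ^ k)"
      by (intro summable_mult summable_geometric) (simp add: real_sqrt_lt_1_iff)
    then have "summable (\<lambda>k. g k x)" using gk by (rule summable_comparison_test')
    then have "summable (\<lambda>k. X (s (Suc k)) x - X (s k) x)" unfolding g_def by (rule summable_norm_cancel)
    then have "convergent (\<lambda>n. \<Sum>k<n. X (s (Suc k)) x - X (s k) x)" by (simp add: summable_iff_convergent)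
    then have "convergent (\<lambda>n. X (s n) x - X (s 0) x)" by (simp add: sum_lessThan_telescope[of "\<lambda>k. X (s k) x"])
    from convergent_add[OF this convergent_const[of "X (s 0) x"]] show ?case by simp
  qed
  \<comment> \<open>Where the subsequence diverges this is a default value, but that happens on a
    null set only.\<close>
  define x where "x y = lim (\<lambda>k. X (s k) y)" for y
  have [measurable]: "x \<in> borel_measurable ?M" unfolding x_def by measurable
  have lim: "AE y in ?M. (\<lambda>k. X (s k) y) \<longlonglongrightarrow> x y"
    using conv by eventually_elim (simp add: x_def convergent_LIMSEQ_iff)
  have fatou: "(\<integral>\<^sup>+y. ennreal ((norm (X n y - x y))\<^sup>2) \<partial>?M) \<le> ennreal (e\<^sup>2)"
    if e: "e > 0" and n: "\<And>m. m \<ge> n \<Longrightarrow> hnorm (L2 \<Omega>) (X n - X m) \<le> e" for n e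
  proof -
    have "(\<integral>\<^sup>+y. ennreal ((norm (X n y - x y))\<^sup>2) \<partial>?M)
        = (\<integral>\<^sup>+y. liminf (\<lambda>k. ennreal ((norm (X n y - X (s k) y))\<^sup>2)) \<partial>?M)"
    proof (rule nn_integral_cong_AE, use lim in eventually_elim)
      case (elim y)
      have "(\<lambda>k. ennreal ((norm (X n y - X (s k) y))\<^sup>2)) \<longlonglongrightarrow> ennreal ((norm (X n y - x y))\<^sup>2)"
        by (intro tendsto_ennrealI tendsto_intros elim)
      from lim_imp_Liminf[OF _ this, symmetric] show ?case by simp
    qed
    also have "\<dots> \<le> liminf (\<lambda>k. \<integral>\<^sup>+y. ennreal ((norm (X n y - X (s k) y))\<^sup>2) \<partial>?M)"
      by (rule nn_integral_liminf) measurable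
    also have "\<dots> \<le> ennreal (e\<^sup>2)"
    proof (rule order_trans[OF Liminf_le_Limsup Limsup_bounded])
      have "(\<integral>\<^sup>+y. ennreal ((norm (X n y - X (s k) y))\<^sup>2) \<partial>?M) \<le> ennreal (e\<^sup>2)" if "k \<ge> n" for k
      proof -
        have "s k \<ge> n" using that strict_mono_imp_increasing[OF s_mono, of k] by linarith
        then have "(hnorm (L2 \<Omega>) (X n - X (s k)))\<^sup>2 \<le> e\<^sup>2"
          using n X by (intro power_mono) auto
        then show ?thesis using nn_norm[OF H.diff_carr[OF X X], of n "s k"] by (simp add: ennreal_leI)
      qed
      then show "eventually (\<lambda>k. (\<integral>\<^sup>+y. ennreal ((norm (X n y - X (s k) y))\<^sup>2) \<partial>?M) \<le> ennreal (e\<^sup>2)) sequentially"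
        by (auto simp: eventually_sequentially)
    qed simp
    finally show ?thesis .
  qed
  have close: "X n - x \<in> carr (L2 \<Omega>) \<and> hnorm (L2 \<Omega>) (X n - x) \<le> e"
    if e: "e > 0" and n: "\<And>m. m \<ge> n \<Longrightarrow> hnorm (L2 \<Omega>) (X n - X m) \<le> e" for n e
  proof -
    have "(\<integral>\<^sup>+y. ennreal ((norm (X n y - x y))\<^sup>2) \<partial>?M) < \<infinity>"
      using fatou[OF that] by (simp add: order_le_less_trans[OF _ ennreal_less_top])
    then have c: "X n - x \<in> carr (L2 \<Omega>)"
      by (simp add: L2_carr_iff integrable_iff_bounded fun_diff_def)
    then have "ennreal ((hnorm (L2 \<Omega>) (X n - x))\<^sup>2) \<le> ennreal (e\<^sup>2)"
      using nn_norm[OF c] fatou[OF that] by simp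
    then have "(hnorm (L2 \<Omega>) (X n - x))\<^sup>2 \<le> e\<^sup>2" by simp
    then show ?thesis using c e by (auto intro: power2_le_imp_le)
  qed
  have ev: "\<exists>n0. \<forall>n\<ge>n0. X n - x \<in> carr (L2 \<Omega>) \<and> hnorm (L2 \<Omega>) (X n - x) \<le> e" if e: "e > 0" for e
  proof -
    obtain n0 where n0: "\<forall>m\<ge>n0. \<forall>n\<ge>n0. hnorm (L2 \<Omega>) (X m - X n) < e" using Cau[OF e] by blast
    have "X n - x \<in> carr (L2 \<Omega>) \<and> hnorm (L2 \<Omega>) (X n - x) \<le> e" if "n \<ge> n0" for n
      using n0 that \<open>e > 0\<close> by (intro close) (auto intro: less_imp_le)
    then show ?thesis by blast
  qed
  \<comment> \<open>One such \<open>n\<close> suffices to place \<open>x\<close> in the space,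
    because \<open>x = X n - (X n - x)\<close>.\<close>
  obtain n where "X n - x \<in> carr (L2 \<Omega>)" using ev[of 1] by auto
  from H.diff_carr[OF X[of n] this] have x: "x \<in> carr (L2 \<Omega>)" by simp
  have "(\<lambda>n. hnorm (L2 \<Omega>) (X n - x)) \<longlonglongrightarrow> 0"
  proof (rule LIMSEQ_I)
    fix e :: real assume "e > 0"
    then obtain n0 where "\<forall>n\<ge>n0. hnorm (L2 \<Omega>) (X n - x) \<le> e / 2" using ev[of "e / 2"] by auto
    then show "\<exists>n0. \<forall>n\<ge>n0. norm (hnorm (L2 \<Omega>) (X n - x) - 0) < e"
      using \<open>e > 0\<close> x X by (intro exI[of _ n0]) (auto intro: le_less_trans)
  qed
  then show ?thesis using x by blast
qed

lemma semi_hilbert_L2: "semi_hilbert (L2 \<Omega>)"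
  using semi_inner_L2 L2_complete by (auto simp: semi_hilbert_def semi_hilbert_axioms_def)

section \<open>Multiplication operators\<close>

definition mult_op :: "(real^3 \<Rightarrow> complex) \<Rightarrow> vfield \<Rightarrow> vfield" where
  "mult_op m u = (\<lambda>x. m x *s u x)"

lemma bdd_op_mult:
  assumes m: "m \<in> borel_measurable (lebesgue_on \<Omega>)" and C: "AE x in lebesgue_on \<Omega>. cmod (m x) \<le> C"
  shows "semi_inner.bdd_op (L2 \<Omega>) (mult_op m)"
proof -
  interpret H: semi_inner "L2 \<Omega>" by (rule semi_inner_L2)
  \<comment> \<open>\<open>bdd_op\<close> asks for a nonnegative constant, whereas \<open>C\<close>
    may be negative if \<open>\<Omega>\<close> has measure zero.\<close>
  have C': "AE x in lebesgue_on \<Omega>. cmod (m x) \<le> max C 0" using C by eventually_elim simp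
  have "hnorm (L2 \<Omega>) (mult_op m u) \<le> max C 0 * hnorm (L2 \<Omega>) u" if u: "u \<in> carr (L2 \<Omega>)" for u
  proof (rule power2_le_imp_le)
    show "(hnorm (L2 \<Omega>) (mult_op m u))\<^sup>2 \<le> (max C 0 * hnorm (L2 \<Omega>) u)\<^sup>2"
      unfolding power_mult_distrib mult_op_def by (rule L2_mult_carr(2)[OF u m C'])
  qed (use u in simp)
  then show ?thesis
    unfolding H.bdd_op_def using L2_mult_carr(1)[OF _ m C]
    by (auto simp: mult_op_def fun_eq_iff vector_add_ldistrib vector_smult_assoc mult.commute intro!: exI[of _ "max C 0"])
qed

lemma mult_op_adjoint: "ip (L2 \<Omega>) (mult_op m u) v = ip (L2 \<Omega>) u (mult_op (\<lambda>x. cnj (m x)) v)"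
  by (simp add: L2_ip mult_op_def mult_ac)

lemma mult_op_coercive:
  assumes u: "u \<in> carr (L2 \<Omega>)" and m: "m \<in> borel_measurable (lebesgue_on \<Omega>)"
    and C: "AE x in lebesgue_on \<Omega>. cmod (m x) \<le> C" and d: "AE x in lebesgue_on \<Omega>. d \<le> Re (k * m x)"
  shows "d * (hnorm (L2 \<Omega>) u)\<^sup>2 \<le> Re (k * ip (L2 \<Omega>) (mult_op m u) u)"
proof -
  have mu: "mult_op m u \<in> carr (L2 \<Omega>)" using L2_mult_carr(1)[OF u m C] by (simp add: mult_op_def)
  have eq: "k * (\<Sum>j\<in>UNIV. mult_op m u x $ j * cnj (u x $ j)) = k * m x * of_real ((norm (u x))\<^sup>2)" for x
    unfolding norm_vec_sq[symmetric] by (simp add: mult_op_def sum_distrib_left mult.assoc)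
  have i: "integrable (lebesgue_on \<Omega>) (\<lambda>x. k * m x * of_real ((norm (u x))\<^sup>2))"
    unfolding eq[symmetric] by (intro integrable_mult_right L2_integrable mu u)
  have "d * (hnorm (L2 \<Omega>) u)\<^sup>2 = (LINT x|lebesgue_on \<Omega>. d * (norm (u x))\<^sup>2)"
    by (simp add: L2_norm_sq)
  also have "\<dots> \<le> (LINT x|lebesgue_on \<Omega>. Re (k * m x * of_real ((norm (u x))\<^sup>2)))"
  proof (rule integral_mono_AE)
    show "AE x in lebesgue_on \<Omega>. d * (norm (u x))\<^sup>2 \<le> Re (k * m x * of_real ((norm (u x))\<^sup>2))"
      using d by eventually_elim (simp add: mult_right_mono del: of_real_power)
    show "integrable (lebesgue_on \<Omega>) (\<lambda>x. d * (norm (u x))\<^sup>2)" using u by (simp add: L2_carr_iff)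
    show "integrable (lebesgue_on \<Omega>) (\<lambda>x. Re (k * m x * of_real ((norm (u x))\<^sup>2)))" by (rule integrable_Re[OF i])
  qed
  also have "\<dots> = Re (LINT x|lebesgue_on \<Omega>. k * m x * of_real ((norm (u x))\<^sup>2))"
    by (rule integral_Re[OF i])
  also have "(LINT x|lebesgue_on \<Omega>. k * m x * of_real ((norm (u x))\<^sup>2)) = k * ip (L2 \<Omega>) (mult_op m u) u"
    unfolding L2_ip eq[symmetric] by simp
  finally show ?thesis .
qed

section \<open>Test fields separate square-integrable fields\<close>

text \<open>Level \<open>0\<close> demands nothing; continuity of a derivative follows from the next
  level, so the notion becomes the usual one once all levels are required. The derivative is an
  existential witness, which makes the closure properties plain inductions.\<close>

fun smooth_upto :: "nat \<Rightarrow> (real \<Rightarrow> real) \<Rightarrow> bool" where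
  "smooth_upto 0 g \<longleftrightarrow> True"
| "smooth_upto (Suc n) g \<longleftrightarrow> (\<exists>g'. (\<forall>x. (g has_real_derivative g' x) (at x)) \<and> smooth_upto n g')"

definition smooth :: "(real \<Rightarrow> real) \<Rightarrow> bool" where
  "smooth g \<longleftrightarrow> (\<forall>n. smooth_upto n g)"

lemma smooth_upto_SucI: "(\<And>x. (g has_real_derivative g' x) (at x)) \<Longrightarrow> smooth_upto n g' \<Longrightarrow> smooth_upto (Suc n) g"
  by (simp, blast)

lemma smooth_upto_Suc_D: "smooth_upto (Suc n) g \<Longrightarrow> smooth_upto n g"
  by (induction n arbitrary: g) (simp, metis smooth_upto.simps(2))

lemma smooth_upto_add: "smooth_upto n f \<Longrightarrow> smooth_upto n g \<Longrightarrow> smooth_upto n (\<lambda>x. f x + g x)"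
proof (induction n arbitrary: f g)
  case (Suc n)
  then obtain f' g' where "\<forall>x. (f has_real_derivative f' x) (at x)" "smooth_upto n f'"
    "\<forall>x. (g has_real_derivative g' x) (at x)" "smooth_upto n g'" by auto
  then show ?case using Suc.IH by (auto intro!: exI[of _ "\<lambda>x. f' x + g' x"] derivative_intros)
qed simp

lemma smooth_upto_mult: "smooth_upto n f \<Longrightarrow> smooth_upto n g \<Longrightarrow> smooth_upto n (\<lambda>x. f x * g x)"
proof (induction n arbitrary: f g)
  case (Suc n)
  then obtain f' g' where d: "\<forall>x. (f has_real_derivative f' x) (at x)" "smooth_upto n f'"
    "\<forall>x. (g has_real_derivative g' x) (at x)" "smooth_upto n g'" by auto
  have "smooth_upto n (\<lambda>x. f' x * g x + g' x * f x)"
    by (intro smooth_upto_add Suc.IH d smooth_upto_Suc_D[OF Suc.prems(1)] smooth_upto_Suc_D[OF Suc.prems(2)])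
  moreover have "((\<lambda>x. f x * g x) has_real_derivative f' x * g x + g' x * f x) (at x)" for x
    using d by (intro DERIV_mult) auto
  ultimately show ?case by (rule smooth_upto_SucI[rotated])
qed simp

lemma smooth_upto_const: "smooth_upto n (\<lambda>x. c)"
proof (induction n arbitrary: c)
  case (Suc n)
  then show ?case by (auto intro!: exI[of _ "\<lambda>x. 0"])
qed simp

lemma smooth_upto_affine: "smooth_upto n g \<Longrightarrow> smooth_upto n (\<lambda>x. g (c * x + d))"
proof (induction n arbitrary: g)
  case (Suc n)
  then obtain g' where g': "\<forall>x. (g has_real_derivative g' x) (at x)" "smooth_upto n g'" by auto
  have "((\<lambda>x. g (c * x + d)) has_real_derivative g' (c * x + d) * c) (at x)" for x
    by (rule DERIV_chain2[OF g'(1)[rule_format]]) (auto intro!: derivative_eq_intros)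
  moreover have "smooth_upto n (\<lambda>x. g' (c * x + d) * c)"
    by (intro smooth_upto_mult smooth_upto_const Suc.IH g')
  ultimately show ?case by (rule smooth_upto_SucI)
qed simp

lemma smooth_mult: "smooth f \<Longrightarrow> smooth g \<Longrightarrow> smooth (\<lambda>x. f x * g x)"
  by (simp add: smooth_def smooth_upto_mult)

lemma smooth_affine: "smooth g \<Longrightarrow> smooth (\<lambda>x. g (c * x + d))"
  by (simp add: smooth_def smooth_upto_affine)

text \<open>The witnesses obtained at different levels coincide because derivatives are unique, so a
  single \<open>g'\<close> serves all levels.\<close>

lemma smooth_derivative:
  assumes "smooth g"
  obtains g' where "\<And>x. (g has_real_derivative g' x) (at x)" "smooth g'"
proof -
  obtain g' where g': "\<And>x. (g has_real_derivative g' x) (at x)"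
    using assms[unfolded smooth_def, rule_format, of 1] by auto
  have "smooth_upto n g'" for n
  proof -
    obtain h where "\<forall>x. (g has_real_derivative h x) (at x)" "smooth_upto n h"
      using assms[unfolded smooth_def, rule_format, of "Suc n"] by auto
    then have "h = g'" using DERIV_unique g' by blast
    then show ?thesis using \<open>smooth_upto n h\<close> by simp
  qed
  then have "smooth g'" by (simp add: smooth_def)
  with g' show thesis by (rule that)
qed

text \<open>\<open>flat 0\<close> is the classical function \<open>exp (- 1 / t)\<close> extended by
  zero. The powers of \<open>1 / t\<close> make the span of the family closed under differentiation,
  so that smoothness is an induction over the order.\<close>

definition flat :: "nat \<Rightarrow> real \<Rightarrow> real" where
  "flat k t = (if t > 0 then (1 / t) ^ k * exp (- (1 / t)) else 0)"

lemma flat_tendsto_0: "(flat k \<longlongrightarrow> 0) (at 0)"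
proof -
  have "((\<lambda>t. (inverse t) ^ k / exp (inverse t)) \<longlongrightarrow> 0) (at_right (0::real))"
    by (rule filterlim_compose[OF tendsto_power_div_exp_0 filterlim_inverse_at_top_right])
  moreover have "eventually (\<lambda>t. (inverse t) ^ k / exp (inverse t) = flat k t) (at_right (0::real))"
    by (auto simp: eventually_at_filter flat_def exp_minus inverse_eq_divide)
  ultimately have right: "(flat k \<longlongrightarrow> 0) (at_right 0)" by (rule Lim_transform_eventually)
  have "(flat k \<longlongrightarrow> 0) (at_left 0)"
    by (rule tendsto_eventually) (auto simp: eventually_at_filter flat_def)
  then show ?thesis using right by (rule filterlim_split_at)
qed

lemma flat_derivative:
  "(flat k has_real_derivative flat (k + 2) t - real k * flat (k + 1) t) (at t)"
proof (cases "t = 0")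
  case True
  \<comment> \<open>The difference quotient of \<open>flat k\<close> at \<open>0\<close> is
    \<open>flat (Suc k)\<close>, whose limit there is zero.\<close>
  have "((\<lambda>h. (flat k (0 + h) - flat k 0) / h) \<longlongrightarrow> 0) (at 0)"
  proof (rule Lim_transform_eventually[OF flat_tendsto_0[of "Suc k"]])
    show "eventually (\<lambda>h. flat (Suc k) h = (flat k (0 + h) - flat k 0) / h) (at 0)"
      by (auto simp: eventually_at_filter flat_def)
  qed
  then show ?thesis using True by (simp add: DERIV_def flat_def)
next
  case False
  show ?thesis
  proof (cases "t > 0")
    case True
    have "((\<lambda>t. (1 / t) ^ k * exp (- (1 / t))) has_real_derivative
        flat (k + 2) t - real k * flat (k + 1) t) (at t)"
    proof -
      have r: "((\<lambda>t. 1 / t) has_real_derivative - (1 / t * (1 / t))) (at t)"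
        using True by (auto intro!: derivative_eq_intros)
      have e: "((\<lambda>t. exp (- (1 / t))) has_real_derivative exp (- (1 / t)) * - (- (1 / t * (1 / t)))) (at t)"
        by (intro DERIV_fun_exp DERIV_minus r)
      show ?thesis
        by (rule DERIV_cong[OF DERIV_mult[OF DERIV_power[OF r] e]], cases k)
          (use True in \<open>simp_all add: flat_def algebra_simps\<close>)
    qed
    then show ?thesis
      by (rule has_field_derivative_transform_within_open[of _ _ _ "{0<..}"]) (use True in \<open>auto simp: flat_def\<close>)
  next
    case False
    then have "t < 0" using \<open>t \<noteq> 0\<close> by simp
    have "((\<lambda>t. 0) has_real_derivative 0) (at t)" by simp
    then have "(flat k has_real_derivative 0) (at t)"
      by (rule has_field_derivative_transform_within_open[of _ _ _ "{..<0}"]) (use \<open>t < 0\<close> in \<open>auto simp: flat_def\<close>)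
    then show ?thesis using \<open>t < 0\<close> by (simp add: flat_def)
  qed
qed

lemma smooth_flat: "smooth (flat k)"
proof -
  have "smooth_upto n (flat k)" for n
  proof (induction n arbitrary: k)
    case (Suc n)
    have "smooth_upto n (\<lambda>t. flat (k + 2) t + (- real k) * flat (k + 1) t)"
      by (intro smooth_upto_add smooth_upto_mult smooth_upto_const Suc)
    then show ?case using flat_derivative
      by (auto intro!: exI[of _ "\<lambda>t. flat (k + 2) t + (- real k) * flat (k + 1) t"])
  qed simp
  then show ?thesis by (simp add: smooth_def)
qed

text \<open>Smooth, with values in the unit interval and nonzero exactly on the open interval from
  \<open>a\<close> to \<open>b\<close>; as \<open>n\<close> grows it tends pointwise to the
  indicator of that interval. \<open>Suc n\<close> keeps the scaling positive at
  \<open>n = 0\<close>.\<close>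

definition cutoff :: "nat \<Rightarrow> real \<Rightarrow> real \<Rightarrow> real \<Rightarrow> real" where
  "cutoff n a b t = flat 0 (real (Suc n) * (t - a)) * flat 0 (real (Suc n) * (b - t))"

lemma smooth_cutoff: "smooth (cutoff n a b)"
proof -
  have "smooth (\<lambda>t. flat 0 (real (Suc n) * t + - real (Suc n) * a) * flat 0 (- real (Suc n) * t + real (Suc n) * b))"
    by (intro smooth_mult smooth_affine smooth_flat)
  then show ?thesis unfolding cutoff_def[abs_def] by (simp add: algebra_simps)
qed

lemma flat_0_bounds: "0 \<le> flat 0 t" "flat 0 t \<le> 1" by (auto simp: flat_def)

lemma cutoff_bounds: "0 \<le> cutoff n a b t" "cutoff n a b t \<le> 1"
  by (simp_all add: cutoff_def flat_0_bounds mult_le_one)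

lemma cutoff_nonzero: "cutoff n a b t \<noteq> 0 \<longleftrightarrow> a < t \<and> t < b"
  by (auto simp: cutoff_def flat_def zero_less_mult_iff)

lemma cutoff_tendsto:
  assumes "a < t" "t < b" shows "(\<lambda>n. cutoff n a b t) \<longlonglongrightarrow> 1"
proof -
  have *: "(\<lambda>n. flat 0 (real (Suc n) * s)) \<longlonglongrightarrow> 1" if "s > 0" for s
  proof -
    have "(\<lambda>n. exp (- (1 / s * inverse (real (Suc n))))) \<longlonglongrightarrow> exp (- (1 / s * 0))"
      by (intro tendsto_intros LIMSEQ_inverse_real_of_nat)
    moreover have "flat 0 (real (Suc n) * s) = exp (- (1 / s * inverse (real (Suc n))))" for n
      using that by (simp add: flat_def divide_simps)
    ultimately show ?thesis by simp
  qed
  show ?thesis unfolding cutoff_def using tendsto_mult[OF *[of "t - a"] *[of "b - t"]] assms by simp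
qed

section \<open>Test fields of product form\<close>

text \<open>A partial derivative replaces one factor by its derivative and so stays in the class;
  differentiability of all orders thus reduces to functions of one variable.\<close>

definition tensor_field :: "3 \<Rightarrow> (3 \<Rightarrow> real \<Rightarrow> real) \<Rightarrow> vfield" where
  "tensor_field k g x = (\<Prod>i\<in>UNIV. g i (x $ i)) *\<^sub>R axis k 1"

lemma tensor_field_derivative:
  assumes g: "\<And>i x. (g i has_real_derivative g' i x) (at x)"
  shows "(tensor_field k g has_derivative
     (\<lambda>y. (\<Sum>i\<in>UNIV. g' i (x $ i) * (y $ i) * (\<Prod>j\<in>UNIV - {i}. g j (x $ j))) *\<^sub>R axis k 1)) (at x)"
proof -
  have "((\<lambda>x::real^3. g i (x $ i)) has_derivative (\<lambda>y. g' i (x $ i) * (y $ i))) (at x)" for i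
  proof -
    have "((\<lambda>x::real^3. x $ i) has_derivative (\<lambda>y. y $ i)) (at x)"
      by (rule bounded_linear_imp_has_derivative[OF bounded_linear_vec_nth])
    from has_derivative_compose[OF this g[of i, unfolded has_field_derivative_def]]
    show ?thesis by simp
  qed
  then have "((\<lambda>x. \<Prod>i\<in>UNIV. g i (x $ i)) has_derivative
     (\<lambda>y. \<Sum>i\<in>UNIV. g' i (x $ i) * (y $ i) * (\<Prod>j\<in>UNIV - {i}. g j (x $ j)))) (at x)"
    by (rule has_derivative_prod)
  from has_derivative_scaleR_left[OF this]
  show ?thesis unfolding tensor_field_def[abs_def] .
qed

lemma partial_tensor_field:
  assumes g: "\<And>i x. (g i has_real_derivative g' i x) (at x)"
  shows "partial j (tensor_field k g) = tensor_field k (g(j := g' j))"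
proof
  fix x :: "real^3"
  have "partial j (tensor_field k g) x
      = (\<Sum>i\<in>UNIV. g' i (x $ i) * (axis j 1 $ i) * (\<Prod>l\<in>UNIV - {i}. g l (x $ l))) *\<^sub>R axis k 1"
    unfolding partial_def frechet_derivative_at[OF tensor_field_derivative[OF g], symmetric] by simp
  also have "(\<Sum>i\<in>UNIV. g' i (x $ i) * (axis j 1 $ i) * (\<Prod>l\<in>UNIV - {i}. g l (x $ l)))
      = (\<Sum>i\<in>UNIV. if i = j then g' j (x $ j) * (\<Prod>l\<in>UNIV - {j}. g l (x $ l)) else 0)"
    by (rule sum.cong) (auto simp: axis_def)
  also have "\<dots> = g' j (x $ j) * (\<Prod>l\<in>UNIV - {j}. g l (x $ l))" by simp
  also have "\<dots> = (\<Prod>i\<in>UNIV. (g(j := g' j)) i (x $ i))"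
  proof -
    have "(\<Prod>l\<in>UNIV - {j}. (g(j := g' j)) l (x $ l)) = (\<Prod>l\<in>UNIV - {j}. g l (x $ l))"
      by (rule prod.cong) auto
    moreover have "(\<Prod>i\<in>UNIV. (g(j := g' j)) i (x $ i))
        = (g(j := g' j)) j (x $ j) * (\<Prod>l\<in>UNIV - {j}. (g(j := g' j)) l (x $ l))"
      by (rule prod.remove) auto
    ultimately show ?thesis by (simp only: fun_upd_same)
  qed
  finally show "partial j (tensor_field k g) x = tensor_field k (g(j := g' j)) x"
    by (simp only: tensor_field_def[of _ "g(j := g' j)"])
qed

lemma Ck_tensor_field:
  assumes "\<And>i. smooth (g i)" shows "Ck n (tensor_field k g)"
  using assms
proof (induction n arbitrary: g)
  case (0 g)
  have "\<forall>i. \<exists>g'. \<forall>x. (g i has_real_derivative g' x) (at x)"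
    using smooth_derivative[OF 0] by metis
  then obtain g' where g': "\<And>i x. (g i has_real_derivative g' i x) (at x)" by metis
  show ?case using tensor_field_derivative[of g g', OF g']
    by (auto intro!: continuous_at_imp_continuous_on dest: has_derivative_continuous)
next
  case (Suc n)
  have "\<forall>i. \<exists>g'. (\<forall>x. (g i has_real_derivative g' x) (at x)) \<and> smooth g'"
    using smooth_derivative[OF Suc.prems] by metis
  then obtain g' where g': "\<And>i x. (g i has_real_derivative g' i x) (at x)" "\<And>i. smooth (g' i)"
    by metis
  have "tensor_field k g differentiable_on UNIV"
    using tensor_field_derivative[of g g', OF g'(1)] by (auto simp: differentiable_on_def differentiable_def)
  moreover have "Ck n (partial j (tensor_field k g))" for j
    unfolding partial_tensor_field[of g g', OF g'(1)] using Suc.prems g'(2) by (intro Suc.IH) auto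
  ultimately show ?case by simp
qed

lemma tensor_cutoff_nonzero:
  "(\<Prod>i\<in>UNIV. cutoff n (a $ i) (b $ i) (x $ i)) \<noteq> 0 \<longleftrightarrow> x \<in> box a (b :: real^3)"
  by (simp add: cutoff_nonzero mem_box_cart)

lemma tensor_cutoff_test:
  assumes "cbox a b \<subseteq> \<Omega>"
  shows "tensor_field k (\<lambda>i. cutoff n (a $ i) (b $ i)) \<in> test_fields \<Omega>"
proof -
  let ?f = "tensor_field k (\<lambda>i. cutoff n (a $ i) (b $ i))"
  have "axis k (1::complex) \<noteq> 0" by (simp add: axis_eq_0_iff)
  then have "{x. ?f x \<noteq> 0} \<subseteq> cbox a b"
    using box_subset_cbox[of a b] by (auto simp: tensor_field_def tensor_cutoff_nonzero simp del: prod_zero_iff)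
  then have cl: "closure {x. ?f x \<noteq> 0} \<subseteq> cbox a b" by (rule closure_minimal[OF _ closed_cbox])
  then have "compact (closure {x. ?f x \<noteq> 0})"
    by (meson bounded_cbox bounded_subset closed_closure compact_eq_bounded_closed)
  then show ?thesis using cl assms by (auto simp: test_fields_def Ck_tensor_field smooth_cutoff)
qed

section \<open>From integrals over boxes to vanishing almost everywhere\<close>

lemma sigma_finite_lebesgue: "sigma_finite_measure (lebesgue :: 'a::euclidean_space measure)"
proof
  obtain A :: "'a set set" where A: "countable A" "A \<subseteq> sets lborel" "\<Union>A = space lborel"
    "\<forall>a\<in>A. emeasure lborel a \<noteq> \<infinity>"
    using lborel.sigma_finite_countable by metis
  then show "\<exists>A::'a set set. countable A \<and> A \<subseteq> sets lebesgue \<and> \<Union>A = space lebesgue \<and> (\<forall>a\<in>A. emeasure lebesgue a \<noteq> \<infinity>)"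
    by (intro exI[of _ A]) auto
qed

text \<open>Open boxes are an intersection-stable generator of the Borel sets, so the vanishing of
  the integral spreads to all Borel sets; \<open>tot\<close> takes care of complements. A Lebesgue
  set differs from a Borel set by a null set, and a density with all set integrals zero vanishes
  almost everywhere.\<close>

lemma AE_zero_if_box_integrals_zero:
  fixes h :: "'a::euclidean_space \<Rightarrow> 'b::{second_countable_topology, banach}"
  assumes h: "integrable lebesgue h" and tot: "(LINT x|lebesgue. h x) = 0"
    and box: "\<And>a b. (LINT x:box a b|lebesgue. h x) = 0"
  shows "AE x in lebesgue. h x = 0"
proof (rule sigma_finite_measure.density_zero[OF sigma_finite_lebesgue h])
  have si: "set_integrable lebesgue A h" if "A \<in> sets lebesgue" for A
    using integrable_mult_indicator[OF that h] by (simp add: set_integrable_def)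
  have bor: "(LINT x:A|lebesgue. h x) = 0" if A: "A \<in> sets borel" for A
  proof -
    let ?G = "range (\<lambda>(a, b). box a b :: 'a set)"
    have G: "sigma_sets UNIV ?G = sets borel" by (subst borel_eq_box) simp
    have "Int_stable ?G"
      by (auto simp: Int_stable_def box_Int_box)
    moreover have "?G \<subseteq> Pow UNIV" by simp
    moreover have "A \<in> sigma_sets UNIV ?G" using A by (simp add: G)
    ultimately show ?thesis
    proof (induction rule: sigma_sets_induct_disjoint)
      case (basic A)
      then show ?case using box by auto
    next
      case empty
      then show ?case by (simp add: set_lebesgue_integral_def)
    next
      case (compl A)
      then have A: "A \<in> sets lebesgue" by (simp add: G sets_completionI_sets)
      have "(LINT x:UNIV - A|lebesgue. h x) = (LINT x|lebesgue. h x) - (LINT x:A|lebesgue. h x)"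
      proof -
        have "indicat_real (UNIV - A) x *\<^sub>R h x = h x - indicat_real A x *\<^sub>R h x" for x
          by (simp add: indicator_def)
        then show ?thesis
          unfolding set_lebesgue_integral_def
          using Bochner_Integration.integral_diff[OF h integrable_mult_indicator[OF A h]] by simp
      qed
      then show ?case using compl tot by simp
    next
      case (union A)
      then have A: "A i \<in> sets lebesgue" for i
        by (auto simp: G intro: sets_completionI_sets)
      have "(LINT x:(\<Union>i. A i)|lebesgue. h x) = (\<Sum>i. LINT x:A i|lebesgue. h x)"
      proof (rule lebesgue_integral_countable_add[OF A])
        show "A i \<inter> A j = {}" if "i \<noteq> j" for i j using union(1) that by (auto simp: disjoint_family_on_def)
        show "set_integrable lebesgue (\<Union>i. A i) h" by (rule si) (use A in auto)
      qed
      then show ?case using union by simp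
    qed
  qed
  fix A :: "'a set" assume "A \<in> sets lebesgue"
  then obtain B N where B: "B \<in> sets borel" and N: "N \<in> null_sets lebesgue" and A: "A = B \<union> N"
    by (metis sets_lebesgue_almost_borel negligible_iff_null_sets)
  have "(LINT x:A|lebesgue. h x) = (LINT x:B|lebesgue. h x)"
    unfolding set_lebesgue_integral_def
  proof (rule integral_cong_AE)
    show "AE x in lebesgue. indicator A x *\<^sub>R h x = indicator B x *\<^sub>R h x"
      using AE_not_in[OF N] by eventually_elim (auto simp: A indicator_def)
  qed (use B \<open>A \<in> _\<close> in \<open>auto intro!: borel_measurable_integrable integrable_mult_indicator h sets_completionI_sets\<close>)
  then show "(LINT x:A|lebesgue. h x) = 0" using bor[OF B] by simp
qed

text \<open>Fundamental lemma of the calculus of variations. Test fields of product form in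
  direction \<open>k\<close> converge boundedly to the indicator of a box, so the component
  \<open>w x $ k\<close> has integral zero over every box whose closure lies in
  \<open>\<Omega>\<close>; countably many such boxes exhaust \<open>\<Omega>\<close> up to a null
  set.\<close>

lemma L2_orthogonal_test_fields:
  assumes \<Omega>: "open \<Omega>" and w: "w \<in> carr (L2 \<Omega>)"
    and orth: "\<And>f. f \<in> test_fields \<Omega> \<Longrightarrow> ip (L2 \<Omega>) w f = 0"
  shows "hnorm (L2 \<Omega>) w = 0"
proof -
  let ?M = "lebesgue_on \<Omega>"
  have \<Omega>s: "\<Omega> \<in> sets lebesgue" using \<Omega> by simp
  note [measurable] = L2_measurable[OF w]
  have box0: "integrable ?M (\<lambda>x. indicat_real (box a b) x *\<^sub>R (w x $ k))"
    "(LINT x|?M. indicat_real (box a b) x *\<^sub>R (w x $ k)) = 0"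
    if ab: "cbox a b \<subseteq> \<Omega>" for a b k
  proof -
    let ?\<phi> = "\<lambda>n x. \<Prod>i\<in>UNIV. cutoff n (a $ i) (b $ i) (x $ i)"
    \<comment> \<open>The norm of \<open>w x\<close> is at most its square plus \<open>1\<close>;
      the constant has to be integrated over the bounded box only.\<close>
    have dom: "integrable ?M (\<lambda>x. (norm (w x))\<^sup>2 + indicat_real (cbox a b) x)"
    proof (rule Bochner_Integration.integrable_add)
      show "integrable ?M (indicat_real (cbox a b))"
        using ab \<Omega>s emeasure_lborel_cbox_finite[of a b]
        by (intro integrable_real_indicator) (auto simp: sets_restrict_space_iff emeasure_restrict_space less_top)
    qed (use w in \<open>simp add: L2_carr_iff\<close>)
    have \<phi>_le: "\<bar>?\<phi> n x\<bar> \<le> indicat_real (box a b) x" for n x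
    proof (cases "x \<in> box a b")
      case True
      have "0 \<le> ?\<phi> n x" "?\<phi> n x \<le> 1" by (intro prod_nonneg prod_le_1 cutoff_bounds conjI ballI)+
      then show ?thesis using True by simp
    next
      case False
      then have "?\<phi> n x = 0" using tensor_cutoff_nonzero by blast
      then show ?thesis by (simp only: abs_zero indicator_pos_le)
    qed
    have [measurable]: "(\<lambda>x. ?\<phi> n x) \<in> borel_measurable ?M" for n
    proof -
      have "continuous_on UNIV (cutoff n a b)" for a b
        using smooth_derivative[OF smooth_cutoff] DERIV_continuous_on[of UNIV] by (metis has_field_derivative_at_within)
      then have "continuous_on UNIV (\<lambda>x::real^3. cutoff n (a $ i) (b $ i) (x $ i))" for i
        by (rule continuous_on_compose2) (auto intro!: continuous_intros)
      then have "continuous_on UNIV (?\<phi> n)" by (intro continuous_on_prod) auto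
      then have "?\<phi> n \<in> borel_measurable lborel" by (simp add: borel_measurable_continuous_onI)
      then show ?thesis by (intro measurable_restrict_space1 measurable_completion)
    qed
    have box_le: "cmod (r *\<^sub>R (w x $ k)) \<le> (norm (w x))\<^sup>2 + indicat_real (cbox a b) x"
      if "\<bar>r\<bar> \<le> indicat_real (box a b) x" for x r
    proof (cases "x \<in> box a b")
      case True
      then have "x \<in> cbox a b" using box_subset_cbox by blast
      have "cmod (r *\<^sub>R (w x $ k)) \<le> 1 * norm (w x)"
        unfolding norm_scaleR using that True by (intro mult_mono Finite_Cartesian_Product.norm_nth_le) auto
      also have "\<dots> \<le> (norm (w x))\<^sup>2 + 1"
        using sum_squares_bound[of "norm (w x)" 1] norm_ge_zero[of "w x"] unfolding power_one by linarith
      finally show ?thesis using \<open>x \<in> cbox a b\<close> by simp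
    next
      case False
      then show ?thesis using that by simp
    qed
    have lim: "(\<lambda>n. ?\<phi> n x *\<^sub>R (w x $ k)) \<longlonglongrightarrow> indicat_real (box a b) x *\<^sub>R (w x $ k)" for x
    proof (cases "x \<in> box a b")
      case True
      then have "(\<lambda>n. ?\<phi> n x) \<longlonglongrightarrow> (\<Prod>i\<in>(UNIV::3 set). 1)"
        by (intro tendsto_prod cutoff_tendsto) (auto simp: mem_box_cart)
      then show ?thesis using True by (intro tendsto_intros) simp
    next
      case False
      then have "?\<phi> n x = 0" for n using tensor_cutoff_nonzero by blast
      then show ?thesis using False by (simp only: scaleR_zero_left indicator_simps tendsto_const not_False_eq_True)
    qed
    have box_meas: "(\<lambda>x. indicat_real (box a b) x *\<^sub>R (w x $ k)) \<in> borel_measurable ?M"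
      using ab box_subset_cbox[of a b] \<Omega>s
      by (intro borel_measurable_scaleR borel_measurable_indicator measurable_vec_nth L2_measurable[OF w])
        (auto simp: sets_restrict_space_iff)
    have "(\<lambda>n. LINT x|?M. ?\<phi> n x *\<^sub>R (w x $ k)) \<longlonglongrightarrow> (LINT x|?M. indicat_real (box a b) x *\<^sub>R (w x $ k))"
    proof (rule integral_dominated_convergence[OF _ _ dom])
      show "AE x in ?M. (\<lambda>n. ?\<phi> n x *\<^sub>R (w x $ k)) \<longlonglongrightarrow> indicat_real (box a b) x *\<^sub>R (w x $ k)"
        using lim by simp
      show "AE x in ?M. norm (?\<phi> n x *\<^sub>R (w x $ k)) \<le> (norm (w x))\<^sup>2 + indicat_real (cbox a b) x" for n
        using box_le[OF \<phi>_le] by simp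
    qed (use box_meas in auto)
    moreover have "(LINT x|?M. ?\<phi> n x *\<^sub>R (w x $ k)) = 0" for n
    proof -
      let ?f = "tensor_field k (\<lambda>i. cutoff n (a $ i) (b $ i))"
      have "(\<Sum>j\<in>UNIV. w x $ j * cnj (?f x $ j)) = ?\<phi> n x *\<^sub>R (w x $ k)" for x
      proof -
        have "(\<Sum>j\<in>UNIV. w x $ j * cnj (?f x $ j)) = (\<Sum>j\<in>UNIV. if j = k then w x $ k * of_real (?\<phi> n x) else 0)"
        proof (rule sum.cong)
          obtain p where p: "?\<phi> n x = p" by simp
          show "w x $ j * cnj (?f x $ j) = (if j = k then w x $ k * of_real (?\<phi> n x) else 0)" for j
            unfolding tensor_field_def p by (cases "j = k") (auto simp: axis_def of_real_def)
        qed simp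
        then show ?thesis by (simp add: scaleR_conv_of_real mult.commute)
      qed
      then show ?thesis using orth[OF tensor_cutoff_test[OF ab, of k n]] by (simp add: L2_ip)
    qed
    ultimately show "(LINT x|?M. indicat_real (box a b) x *\<^sub>R (w x $ k)) = 0"
      by (simp add: LIMSEQ_const_iff)
    show "integrable ?M (\<lambda>x. indicat_real (box a b) x *\<^sub>R (w x $ k))"
    proof (rule Bochner_Integration.integrable_bound[OF dom])
      show "AE x in ?M. norm (indicat_real (box a b) x *\<^sub>R (w x $ k)) \<le> norm ((norm (w x))\<^sup>2 + indicat_real (cbox a b) x)"
        using box_le[of "indicat_real (box a b) _"] by (auto intro!: AE_I2 order_trans[OF box_le])
    qed (rule box_meas)
  qed
  have box_AE: "AE x in lebesgue. x \<in> box a b \<longrightarrow> w x $ k = 0" if ab: "cbox a b \<subseteq> \<Omega>" for a b k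
  proof -
    define h where "h x = indicat_real (box a b) x *\<^sub>R (w x $ k)" for x
    have B: "box a b \<subseteq> \<Omega>" using ab box_subset_cbox[of a b] by blast
    then have h\<Omega>: "indicat_real \<Omega> x *\<^sub>R h x = h x" for x by (auto simp: h_def indicator_def)
    have restr: "integral\<^sup>L ?M f = integral\<^sup>L lebesgue (\<lambda>x. indicat_real \<Omega> x *\<^sub>R f x)" for f :: "real^3 \<Rightarrow> complex"
      using \<Omega>s by (intro integral_restrict_space) simp
    have "AE x in lebesgue. h x = 0"
    proof (rule AE_zero_if_box_integrals_zero)
      show "integrable lebesgue h"
        using box0(1)[OF ab, of k] \<Omega>s h\<Omega> by (simp add: integrable_restrict_space flip: h_def)
      show "(LINT x|lebesgue. h x) = 0"
        using box0(2)[OF ab, of k] by (simp add: restr h\<Omega> flip: h_def)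
      fix c d :: "real^3"
      obtain a' b' where ab': "box c d \<inter> box a b = box a' b'" by (auto simp: box_Int_box)
      have eq: "indicat_real (box c d) x *\<^sub>R h x = indicat_real (box a' b') x *\<^sub>R (w x $ k)" for x
        unfolding h_def ab'[symmetric] by (simp add: indicator_inter_arith)
      show "(LINT x:box c d|lebesgue. h x) = 0"
      \<comment> \<open>An empty open box may have a nonempty closed box that leaves
        \<open>\<Omega>\<close>. Only for a nonempty intersection is \<open>cbox a' b'\<close> its
        closure and hence contained in \<open>cbox a b\<close>.\<close>
      proof (cases "box a' b' = {}")
        case True
        then show ?thesis by (simp add: set_lebesgue_integral_def eq)
      next
        case False
        then have ne: "box a b \<noteq> {}" using ab' by auto
        have "cbox a' b' = closure (box a' b')" using False by simp
        also have "\<dots> \<subseteq> closure (box a b)" using ab' by (intro closure_mono) auto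
        also have "\<dots> = cbox a b" using ne by simp
        finally have c: "cbox a' b' \<subseteq> \<Omega>" using ab by blast
        have e3: "indicat_real \<Omega> x *\<^sub>R (indicat_real (box a' b') x *\<^sub>R (w x $ k)) = indicat_real (box a' b') x *\<^sub>R (w x $ k)" for x
          using c box_subset_cbox[of a' b'] by (auto simp: indicator_def)
        show ?thesis using box0(2)[OF c, of k] unfolding set_lebesgue_integral_def eq restr e3 .
      qed
    qed
    then show ?thesis by eventually_elim (auto simp: h_def)
  qed
  obtain \<D> where \<D>: "countable \<D>" "\<D> \<subseteq> Pow \<Omega>" "\<And>X. X \<in> \<D> \<Longrightarrow> \<exists>a b. X = cbox a b" "\<Union>\<D> = \<Omega>"
    using open_countable_Union_open_cbox[OF \<Omega>] by metis
  have "AE x in lebesgue. x \<in> X \<longrightarrow> w x = 0" if X: "X \<in> \<D>" for X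
  proof -
    obtain a b where ab: "X = cbox a b" using \<D>(3)[OF X] by blast
    then have "AE x in lebesgue. \<forall>k\<in>UNIV. x \<in> box a b \<longrightarrow> w x $ k = 0"
      using X \<D>(2) by (intro AE_finite_allI box_AE) auto
    moreover have "AE x in lebesgue. x \<notin> cbox a b - box a b"
      using negligible_frontier_interval[of a b] by (intro AE_not_in) (simp add: negligible_iff_null_sets)
    ultimately show ?thesis by eventually_elim (auto simp: ab vec_eq_iff)
  qed
  then have "AE x in lebesgue. \<forall>X\<in>\<D>. x \<in> X \<longrightarrow> w x = 0"
    unfolding AE_ball_countable[OF \<D>(1)] by blast
  then have "AE x in lebesgue. x \<in> \<Omega> \<longrightarrow> w x = 0"
    by eventually_elim (use \<D>(4) in blast)
  then have "AE x in ?M. w x = 0" using \<Omega>s by (simp add: AE_restrict_space_iff)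
  then have "(hnorm (L2 \<Omega>) w)\<^sup>2 = 0"
    unfolding L2_norm_sq by (intro integral_eq_zero_AE) (auto elim: eventually_mono)
  then show ?thesis by simp
qed

section \<open>The weak curl\<close>

text \<open>Translation invariance of the measure makes the integral of every difference quotient in
  direction \<open>e\<close> vanish, and dominated convergence passes to the derivative. No iterated
  integrals occur.\<close>

lemma integral_directional_derivative_zero:
  fixes f :: "'a::euclidean_space \<Rightarrow> real"
  assumes f: "\<And>x. (f has_derivative f' x) (at x)"
    and cont: "continuous_on UNIV (\<lambda>x. f' x e)"
    and K: "compact K" and f0: "\<And>x. x \<notin> K \<Longrightarrow> f x = 0" and D0: "\<And>x. x \<notin> K \<Longrightarrow> f' x e = 0"
  shows "(LINT x|lborel. f' x e) = 0"
proof -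
  have fc: "continuous_on UNIV f"
    using f by (auto intro!: continuous_at_imp_continuous_on has_derivative_continuous)
  have [measurable]: "f \<in> borel_measurable borel" "(\<lambda>x. f' x e) \<in> borel_measurable borel"
    using fc cont by (auto intro: borel_measurable_continuous_onI)
  have f_int: "integrable lborel f"
  proof -
    have "integrable lborel (\<lambda>x. indicator K x *\<^sub>R f x)"
      by (intro borel_integrable_compact K continuous_on_subset[OF fc]) auto
    moreover have "indicat_real K x *\<^sub>R f x = f x" for x using f0[of x] by (auto simp: indicator_def)
    ultimately show ?thesis by (simp only:)
  qed
  have line: "((\<lambda>t. f (x + t *\<^sub>R e)) has_real_derivative f' (x + t *\<^sub>R e) e) (at t)" for x t
  proof -
    have "((\<lambda>t. x + t *\<^sub>R e) has_derivative (\<lambda>s. s *\<^sub>R e)) (at t)"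
      by (auto intro!: derivative_eq_intros)
    from has_derivative_compose[OF this f]
    have "((\<lambda>t. f (x + t *\<^sub>R e)) has_derivative (\<lambda>s. f' (x + t *\<^sub>R e) (s *\<^sub>R e))) (at t)" .
    then show ?thesis
      by (simp add: has_field_derivative_def linear_scale[OF has_derivative_linear[OF f]] mult_commute_abs)
  qed
  have "bounded ((\<lambda>x. f' x e) ` K)"
    by (intro compact_imp_bounded compact_continuous_image K continuous_on_subset[OF cont]) auto
  then obtain C where C: "C > 0" "\<And>x. x \<in> K \<Longrightarrow> \<bar>f' x e\<bar> \<le> C"
    unfolding bounded_pos by auto
  then have C: "C > 0" "\<And>x. \<bar>f' x e\<bar> \<le> C" using D0 by (auto, metis abs_zero less_imp_le)
  obtain R where R: "R > 0" "\<And>x. x \<in> K \<Longrightarrow> norm x \<le> R"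
    using compact_imp_bounded[OF K] unfolding bounded_pos by auto
  \<comment> \<open>Step sizes at most \<open>1\<close> keep the supports of all difference
    quotients in one ball.\<close>
  define h where "h n = inverse (real (Suc n))" for n
  have h: "0 < h n" "h n \<le> 1" for n by (auto simp: h_def field_simps)
  define q where "q n x = (f (x + h n *\<^sub>R e) - f x) / h n" for n x
  have [measurable]: "q n \<in> borel_measurable borel" for n unfolding q_def by measurable
  \<comment> \<open>By the mean value theorem on the segment, a difference quotient is a value of
    the directional derivative, so \<open>C\<close> dominates all of them.\<close>
  have q_bound: "\<bar>q n x\<bar> \<le> C" for n x
  proof -
    obtain z where "f (x + h n *\<^sub>R e) - f (x + 0 *\<^sub>R e) = (h n - 0) * f' (x + z *\<^sub>R e) e"
      using MVT2[of 0 "h n" "\<lambda>t. f (x + t *\<^sub>R e)" "\<lambda>t. f' (x + t *\<^sub>R e) e"] line h by blast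
    then have "q n x = f' (x + z *\<^sub>R e) e" using h[of n] by (simp add: q_def)
    then show ?thesis using C by simp
  qed
  have q_supp: "q n x = 0" if "x \<notin> cball 0 (R + norm e)" for n x
  proof -
    have nx: "norm x > R + norm e" using that by simp
    have "norm (h n *\<^sub>R e) \<le> norm e" using h[of n] by (simp add: mult_left_le_one_le)
    then have "norm (x + h n *\<^sub>R e) > R" using nx norm_diff_ineq[of x "h n *\<^sub>R e"] by linarith
    moreover have "norm x > R" using nx norm_ge_zero[of e] by linarith
    ultimately have "f (x + h n *\<^sub>R e) = 0" "f x = 0" using R(2) f0 by force+
    then show ?thesis by (simp add: q_def)
  qed
  have "(\<lambda>n. LINT x|lborel. q n x) \<longlonglongrightarrow> (LINT x|lborel. f' x e)"
  proof (rule integral_dominated_convergence[where w = "\<lambda>x. C * indicator (cball 0 (R + norm e)) x"])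
    show "integrable lborel (\<lambda>x. C * indicator (cball (0::'a) (R + norm e)) x)"
      by (intro integrable_mult_right integrable_real_indicator) (use emeasure_bounded_finite[OF bounded_cball] in auto)
    show "AE x in lborel. norm (q n x) \<le> C * indicator (cball 0 (R + norm e)) x" for n
      using q_bound q_supp by (auto simp: indicator_def intro!: AE_I2)
    show "AE x in lborel. (\<lambda>n. q n x) \<longlonglongrightarrow> f' x e"
    proof (rule AE_I2)
      fix x
      have "((\<lambda>t. (f (x + (0 + t) *\<^sub>R e) - f (x + 0 *\<^sub>R e)) / t) \<longlongrightarrow> f' (x + 0 *\<^sub>R e) e) (at 0)"
        using line[of x 0] unfolding DERIV_def .
      moreover have "filterlim h (at 0) sequentially"
        unfolding filterlim_at using h(1) LIMSEQ_inverse_real_of_nat by (auto simp: h_def[abs_def])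
      ultimately show "(\<lambda>n. q n x) \<longlonglongrightarrow> f' x e"
        unfolding q_def by (auto dest: filterlim_compose)
    qed
  qed auto
  moreover have "(LINT x|lborel. q n x) = 0" for n
  proof -
    have "(LINT x|lborel. f x) = (LINT x|distr lborel borel ((+) (h n *\<^sub>R e)). f x)"
      by (simp add: lborel_distr_plus)
    also have "\<dots> = (LINT x|lborel. f (h n *\<^sub>R e + x))" by (rule integral_distr) auto
    finally have eq: "(LINT x|lborel. f (x + h n *\<^sub>R e)) = (LINT x|lborel. f x)" by (simp add: add.commute)
    have "integrable (distr lborel borel ((+) (h n *\<^sub>R e))) f" using f_int by (simp add: lborel_distr_plus)
    then have "integrable lborel (\<lambda>x. f (x + h n *\<^sub>R e))"
      by (subst (asm) integrable_distr_eq) (auto simp: add.commute)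
    then show ?thesis using f_int eq by (simp add: q_def)
  qed
  ultimately show ?thesis by (simp add: LIMSEQ_const_iff)
qed

lemma integral_directional_derivative_zero_complex:
  fixes f :: "'a::euclidean_space \<Rightarrow> complex"
  assumes f: "\<And>x. (f has_derivative f' x) (at x)"
    and cont: "continuous_on UNIV (\<lambda>x. f' x e)"
    and K: "compact K" and f0: "\<And>x. x \<notin> K \<Longrightarrow> f x = 0" and D0: "\<And>x. x \<notin> K \<Longrightarrow> f' x e = 0"
  shows "integrable lborel (\<lambda>x. f' x e)" "(LINT x|lborel. f' x e) = 0"
proof -
  have "integrable lborel (\<lambda>x. indicator K x *\<^sub>R f' x e)"
    by (intro borel_integrable_compact K continuous_on_subset[OF cont]) auto
  moreover have "indicat_real K x *\<^sub>R f' x e = f' x e" for x using D0[of x] by (auto simp: indicator_def)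
  ultimately show int: "integrable lborel (\<lambda>x. f' x e)" by (simp only:)
  have "(LINT x|lborel. Re (f' x e)) = 0"
    by (rule integral_directional_derivative_zero[of "\<lambda>x. Re (f x)", OF _ _ K])
      (auto intro!: bounded_linear.has_derivative[OF bounded_linear_Re] f continuous_intros cont simp: f0 D0)
  moreover have "(LINT x|lborel. Im (f' x e)) = 0"
    by (rule integral_directional_derivative_zero[of "\<lambda>x. Im (f x)", OF _ _ K])
      (auto intro!: bounded_linear.has_derivative[OF bounded_linear_Im] f continuous_intros cont simp: f0 D0)
  ultimately show "(LINT x|lborel. f' x e) = 0"
    using int by (simp add: complex_eq_iff)
qed

lemma test_fieldD:
  assumes "f \<in> test_fields \<Omega>"
  shows "f differentiable at x" "continuous_on UNIV f" "continuous_on UNIV (partial j f)"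
    "compact (closure {x. f x \<noteq> 0})" "closure {x. f x \<noteq> 0} \<subseteq> \<Omega>"
proof -
  have Ck: "Ck k f" for k using assms by (simp add: test_fields_def)
  show "f differentiable at x" using Ck[of 1] by (simp add: differentiable_on_def)
  show "continuous_on UNIV f" using Ck[of 0] by simp
  show "continuous_on UNIV (partial j f)" using Ck[of 1] by simp
qed (use assms in \<open>auto simp: test_fields_def\<close>)

lemma test_field_derivative: "f \<in> test_fields \<Omega> \<Longrightarrow> (f has_derivative frechet_derivative f (at x)) (at x)"
  using test_fieldD(1) by (simp only: frechet_derivative_works[symmetric])

lemma outside_support: "x \<notin> closure {x. f x \<noteq> 0} \<Longrightarrow> f x = 0"
  using closure_subset[of "{x. f x \<noteq> 0}"] by blast

lemma partial_outside_support:
  fixes f :: vfield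
  assumes "x \<notin> closure {x. f x \<noteq> 0}" shows "partial j f x = 0"
proof -
  have "((\<lambda>x. 0) has_derivative (\<lambda>y. 0)) (at x)" by simp
  then have "(f has_derivative (\<lambda>y. 0)) (at x)"
  proof (rule has_derivative_transform_within_open[OF _ open_Compl[OF closed_closure]])
    show "x \<in> - closure {x. f x \<noteq> 0}" using assms by simp
    show "0 = f y" if "y \<in> - closure {x. f x \<noteq> 0}" for y using outside_support[of y f] that by simp
  qed
  from frechet_derivative_at[OF this, symmetric] show ?thesis by (simp only: partial_def)
qed

lemma classical_curl_nth:
  "classical_curl f x $ 1 = partial 2 f x $ 3 - partial 3 f x $ 2"
  "classical_curl f x $ 2 = partial 3 f x $ 1 - partial 1 f x $ 3"
  "classical_curl f x $ 3 = partial 1 f x $ 2 - partial 2 f x $ 1"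
  by (simp_all add: classical_curl_def)

lemma test_field_curl:
  assumes f: "f \<in> test_fields \<Omega>"
  shows "continuous_on UNIV (classical_curl f)" "x \<notin> closure {x. f x \<noteq> 0} \<Longrightarrow> classical_curl f x = 0"
proof -
  have "continuous_on UNIV (\<lambda>x. partial j f x $ k)" for j k
    by (intro continuous_intros test_fieldD(3)[OF f])
  then have "continuous_on UNIV (\<lambda>x. classical_curl f x $ i)" for i
    using exhaust_3[of i] by (auto simp: classical_curl_nth intro!: continuous_on_diff)
  then have "continuous_on UNIV (\<lambda>x. \<chi> i. classical_curl f x $ i)" by (rule continuous_on_vec_lambda)
  then show "continuous_on UNIV (classical_curl f)" by simp
  show "classical_curl f x = 0" if "x \<notin> closure {x. f x \<noteq> 0}"
    using partial_outside_support[OF that] by (simp add: vec_eq_iff forall_3 classical_curl_nth)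
qed

lemma continuous_compact_support_L2:
  fixes f :: vfield
  assumes f: "continuous_on UNIV f" and K: "compact K" and f0: "\<And>x. x \<notin> K \<Longrightarrow> f x = 0" and \<Omega>: "\<Omega> \<in> sets lebesgue"
  shows "f \<in> carr (L2 \<Omega>)"
proof -
  have "integrable lborel (\<lambda>x. indicator K x *\<^sub>R (norm (f x))\<^sup>2)"
    by (intro borel_integrable_compact K continuous_intros continuous_on_subset[OF f]) auto
  moreover have "indicat_real K x *\<^sub>R (norm (f x))\<^sup>2 = (norm (f x))\<^sup>2" for x
    using f0[of x] by (auto simp: indicator_def)
  ultimately have "integrable lborel (\<lambda>x. (norm (f x))\<^sup>2)" by (simp only:)
  then have "integrable lebesgue (\<lambda>x. (norm (f x))\<^sup>2)"
    by (subst integrable_completion) auto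
  from integrable_mult_indicator[OF \<Omega> this]
  have "integrable (lebesgue_on \<Omega>) (\<lambda>x. (norm (f x))\<^sup>2)"
    using \<Omega> by (subst integrable_restrict_space) simp_all
  moreover have "f \<in> borel_measurable (lebesgue_on \<Omega>)"
    using borel_measurable_continuous_onI[OF f]
    by (intro measurable_restrict_space1 measurable_completion) simp
  ultimately show ?thesis by (simp add: L2_carr_iff)
qed

lemma test_field_L2:
  assumes "f \<in> test_fields \<Omega>" "open \<Omega>"
  shows "f \<in> carr (L2 \<Omega>)" "classical_curl f \<in> carr (L2 \<Omega>)"
proof -
  have \<Omega>: "\<Omega> \<in> sets lebesgue" using assms(2) by simp
  show "f \<in> carr (L2 \<Omega>)"
    by (rule continuous_compact_support_L2[OF test_fieldD(2,4)[OF assms(1)] outside_support[of _ f] \<Omega>])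
  show "classical_curl f \<in> carr (L2 \<Omega>)"
    by (rule continuous_compact_support_L2[OF test_field_curl(1)[OF assms(1)] test_fieldD(4)[OF assms(1)]
          test_field_curl(2)[OF assms(1)] \<Omega>])
qed

text \<open>The difference of the two integrands is a signed sum of six terms
  \<open>D j a b\<close>, each the partial derivative in direction \<open>j\<close> of a product of
  a component of \<open>f\<close> with a conjugated component of \<open>g\<close>. Such a product
  has compact support in \<open>\<Omega>\<close>, so each term integrates to zero.\<close>

lemma curl_by_parts:
  assumes \<Omega>: "open \<Omega>" and f: "f \<in> test_fields \<Omega>" and g: "g \<in> test_fields \<Omega>"
  shows "ip (L2 \<Omega>) (classical_curl f) g = ip (L2 \<Omega>) f (classical_curl g)"
proof -
  let ?K = "closure {x. f x \<noteq> 0}"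
  define D where "D j a b x = partial j f x $ a * cnj (g x $ b) + f x $ a * cnj (partial j g x $ b)" for j a b x
  have D: "integrable lborel (D j a b) \<and> (LINT x|lborel. D j a b x) = 0" for j a b
  proof -
    let ?F = "\<lambda>x. f x $ a * cnj (g x $ b)"
    let ?F' = "\<lambda>x y. f x $ a * cnj (frechet_derivative g (at x) y $ b) + frechet_derivative f (at x) y $ a * cnj (g x $ b)"
    have "(?F has_derivative ?F' x) (at x)" for x
      by (intro has_derivative_mult bounded_linear.has_derivative[OF bounded_linear_cnj]
          bounded_linear.has_derivative[OF bounded_linear_vec_nth] test_field_derivative[OF f] test_field_derivative[OF g])
    moreover have "D j a b = (\<lambda>x. ?F' x (axis j 1))" by (auto simp: D_def partial_def)
    moreover have "continuous_on UNIV (D j a b)"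
      unfolding D_def using test_fieldD(2,3)[OF f] test_fieldD(2,3)[OF g] by (intro continuous_intros) auto
    moreover have "?F x = 0 \<and> D j a b x = 0" if "x \<notin> ?K" for x
      using outside_support[OF that] partial_outside_support[OF that] by (simp add: D_def)
    ultimately show ?thesis
      using integral_directional_derivative_zero_complex[of ?F ?F' "axis j 1" ?K] test_fieldD(4)[OF f] by auto
  qed
  have D_out: "D j a b x = 0" if "x \<notin> \<Omega>" for j a b x
  proof -
    have "x \<notin> ?K" using test_fieldD(5)[OF f] that by blast
    from outside_support[OF this] partial_outside_support[OF this] show ?thesis by (simp add: D_def)
  qed
  have \<Omega>s: "\<Omega> \<in> sets lebesgue" using \<Omega> by simp
  have D\<Omega>: "integrable (lebesgue_on \<Omega>) (D j a b)" "(LINT x|lebesgue_on \<Omega>. D j a b x) = 0" for j a b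
  proof -
    have eq: "indicat_real \<Omega> x *\<^sub>R D j a b x = D j a b x" for x using D_out[of x j a b] by (auto simp: indicator_def)
    have b: "D j a b \<in> borel_measurable lborel" using D[of j a b] by auto
    show "integrable (lebesgue_on \<Omega>) (D j a b)"
      using D[of j a b] \<Omega>s b by (simp add: integrable_restrict_space eq integrable_completion)
    show "(LINT x|lebesgue_on \<Omega>. D j a b x) = 0"
      using D[of j a b] \<Omega>s b by (simp add: integral_restrict_space eq integral_completion)
  qed
  have "(\<Sum>k\<in>UNIV. classical_curl f x $ k * cnj (g x $ k)) - (\<Sum>k\<in>UNIV. f x $ k * cnj (classical_curl g x $ k))
      = D 2 3 1 x - D 3 2 1 x + (D 3 1 2 x - D 1 3 2 x) + (D 1 2 3 x - D 2 1 3 x)" for x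
    by (simp add: sum_3 classical_curl_nth D_def algebra_simps)
  then have "ip (L2 \<Omega>) (classical_curl f) g - ip (L2 \<Omega>) f (classical_curl g)
      = (LINT x|lebesgue_on \<Omega>. D 2 3 1 x - D 3 2 1 x + (D 3 1 2 x - D 1 3 2 x) + (D 1 2 3 x - D 2 1 3 x))"
    unfolding L2_ip using test_field_L2[OF f \<Omega>] test_field_L2[OF g \<Omega>]
    by (subst Bochner_Integration.integral_diff[symmetric]) (auto intro: L2_integrable)
  also have "\<dots> = 0" using D\<Omega> by simp
  finally show ?thesis by simp
qed

section \<open>Linear combinations of test fields\<close>

lemma bounded_linear_vec_scale: "bounded_linear (\<lambda>v::complex^3. c *s v)"
  by (rule bounded_linear_intro[of _ "cmod c"])
    (auto simp: vector_add_ldistrib norm_vec_scale vec_eq_iff mult.commute scaleR_conv_of_real)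

lemma Ck_add: "Ck k f \<Longrightarrow> Ck k g \<Longrightarrow> Ck k (f + g)"
proof (induction k arbitrary: f g)
  case 0 then show ?case by (simp add: plus_fun_def continuous_on_add)
next
  case (Suc k)
  have d: "f differentiable at x" "g differentiable at x" for x
    using Suc.prems by (auto simp: differentiable_on_def)
  have "((\<lambda>x. f x + g x) has_derivative (\<lambda>y. frechet_derivative f (at x) y + frechet_derivative g (at x) y)) (at x)" for x
    by (intro has_derivative_add d[unfolded frechet_derivative_works])
  from frechet_derivative_at[OF this, symmetric]
  have eq: "partial j (f + g) = partial j f + partial j g" for j
    unfolding partial_def plus_fun_def by simp
  have "Ck k (partial j (f + g))" for j
    unfolding eq by (rule Suc.IH) (use Suc.prems in simp_all)
  moreover have "(f + g) differentiable_on UNIV"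
    using Suc.prems by (auto simp: plus_fun_def)
  ultimately show ?case unfolding Ck.simps by blast
qed

lemma Ck_scale: "Ck k f \<Longrightarrow> Ck k (\<lambda>x. c *s f x)"
proof (induction k arbitrary: f)
  case 0 then show ?case
    using continuous_on_compose2[OF linear_continuous_on[OF bounded_linear_vec_scale[of c], of UNIV]] by auto
next
  case (Suc k)
  have d: "f differentiable at x" for x
    using Suc.prems by (auto simp: differentiable_on_def)
  have hd: "((\<lambda>x. c *s f x) has_derivative (\<lambda>y. c *s frechet_derivative f (at x) y)) (at x)" for x
    by (intro bounded_linear.has_derivative[OF bounded_linear_vec_scale] d[unfolded frechet_derivative_works])
  from frechet_derivative_at[OF this, symmetric]
  have eq: "partial j (\<lambda>x. c *s f x) = (\<lambda>x. c *s partial j f x)" for j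
    unfolding partial_def by simp
  have "Ck k (partial j (\<lambda>x. c *s f x))" for j
    unfolding eq by (rule Suc.IH) (use Suc.prems in simp)
  moreover have "(\<lambda>x. c *s f x) differentiable_on UNIV"
    using hd by (auto simp: differentiable_on_def differentiable_def)
  ultimately show ?case unfolding Ck.simps by blast
qed

lemma compact_support_subset:
  fixes f g :: vfield
  assumes "compact K" "K \<subseteq> \<Omega>" "\<And>x. x \<notin> K \<Longrightarrow> f x = 0"
  shows "compact (closure {x. f x \<noteq> 0})" "closure {x. f x \<noteq> 0} \<subseteq> \<Omega>"
proof -
  have cl: "closure {x. f x \<noteq> 0} \<subseteq> K"
    using assms(3) by (intro closure_minimal compact_imp_closed assms(1)) auto
  then show "closure {x. f x \<noteq> 0} \<subseteq> \<Omega>" using assms(2) by blast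
  show "compact (closure {x. f x \<noteq> 0})"
    using compact_Int_closed[OF assms(1) closed_closure, of "{x. f x \<noteq> 0}"] cl by (simp add: Int_absorb1)
qed

lemma test_field_add:
  assumes f: "f \<in> test_fields \<Omega>" and g: "g \<in> test_fields \<Omega>" shows "f + g \<in> test_fields \<Omega>"
proof -
  have "compact (closure {x. f x \<noteq> 0} \<union> closure {x. g x \<noteq> 0})"
    "closure {x. f x \<noteq> 0} \<union> closure {x. g x \<noteq> 0} \<subseteq> \<Omega>"
    using test_fieldD(4,5)[OF f] test_fieldD(4,5)[OF g] by auto
  note c = this
  have "(f + g) x = 0" if "x \<notin> closure {x. f x \<noteq> 0} \<union> closure {x. g x \<noteq> 0}" for x
    using outside_support[of x f] outside_support[of x g] that by simp
  from compact_support_subset[OF c this] show ?thesis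
    using f g by (simp add: test_fields_def Ck_add)
qed

lemma test_field_scale:
  assumes f: "f \<in> test_fields \<Omega>" shows "(\<lambda>x. c *s f x) \<in> test_fields \<Omega>"
proof -
  have "c *s f x = 0" if "x \<notin> closure {x. f x \<noteq> 0}" for x
    using outside_support[OF that] by simp
  from compact_support_subset[OF test_fieldD(4,5)[OF f] this] show ?thesis
    using f by (simp add: test_fields_def Ck_scale)
qed

lemma test_field_zero: "0 \<in> test_fields \<Omega>"
proof -
  have "Ck k (\<lambda>x. 0)" for k
  proof (induction k)
    case (Suc k)
    have "partial j (\<lambda>x. 0) = (\<lambda>x. 0)" for j
      by (simp add: partial_def fun_eq_iff)
    then show ?case using Suc by simp
  qed simp
  then show ?thesis by (simp add: test_fields_def zero_fun_def)
qed

section \<open>The weak curl as an adjoint pair\<close>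

locale open_domain =
  fixes \<Omega> :: "(real^3) set"
  assumes open_domain: "open \<Omega>"
begin

sublocale semi_hilbert "L2 \<Omega>" by (rule semi_hilbert_L2)

abbreviation H :: "vfield hspace" where "H \<equiv> L2 \<Omega>"

abbreviation R :: "vfield \<Rightarrow> vfield" where "R \<equiv> omap (curl \<Omega>)"

lemma test_carr [simp]:
  "f \<in> test_fields \<Omega> \<Longrightarrow> f \<in> carr H" "f \<in> test_fields \<Omega> \<Longrightarrow> classical_curl f \<in> carr H"
  using test_field_L2 open_domain by auto

lemma Hcurl_carr [simp]: "u \<in> Hcurl \<Omega> \<Longrightarrow> u \<in> carr H"
  by (simp add: Hcurl_def curl_def)

lemma curl_weak:
  assumes "u \<in> Hcurl \<Omega>"
  shows "R u \<in> carr H" "is_weak_curl \<Omega> u (R u)"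
proof -
  have "\<exists>w. w \<in> carr H \<and> is_weak_curl \<Omega> u w"
    using assms unfolding Hcurl_def curl_def by auto
  from someI_ex[OF this] show "R u \<in> carr H" "is_weak_curl \<Omega> u (R u)"
    unfolding curl_def by simp_all
qed

declare curl_weak(1) [simp]

text \<open>Two weak curls of \<open>u\<close> differ by a field orthogonal to all test fields,
  hence by a null field. So the representative chosen in \<open>curl\<close> agrees with any
  \<open>w\<close> that satisfies the weak identity.\<close>

lemma weak_curlI:
  assumes u: "u \<in> carr H" and w: "w \<in> carr H"
    and weak: "\<And>f. f \<in> test_fields \<Omega> \<Longrightarrow> ip H w f = ip H u (classical_curl f)"
  shows "u \<in> Hcurl \<Omega>" "eqv (R u) w"
proof -
  have "is_weak_curl \<Omega> u w" using weak by (simp add: is_weak_curl_def)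
  then show uD: "u \<in> Hcurl \<Omega>" unfolding Hcurl_def curl_def oper.simps using u w by blast
  have "hnorm H (R u - w) = 0"
    using curl_weak(2)[OF uD] weak uD w
    by (intro L2_orthogonal_test_fields open_domain) (auto simp: is_weak_curl_def ip_diff)
  then show "eqv (R u) w" using uD w by (simp add: eqv_def)
qed

lemma curl_ip: "u \<in> Hcurl \<Omega> \<Longrightarrow> f \<in> test_fields \<Omega> \<Longrightarrow> ip H (R u) f = ip H u (classical_curl f)"
  using curl_weak(2) by (simp add: is_weak_curl_def)

lemma curl_test: "f \<in> test_fields \<Omega> \<Longrightarrow> f \<in> Hcurl \<Omega>" "f \<in> test_fields \<Omega> \<Longrightarrow> eqv (R f) (classical_curl f)"
  using weak_curlI[of f "classical_curl f"] curl_by_parts[OF open_domain] by auto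

lemma curl_add: "u \<in> Hcurl \<Omega> \<Longrightarrow> v \<in> Hcurl \<Omega> \<Longrightarrow> u + v \<in> Hcurl \<Omega> \<and> eqv (R (u + v)) (R u + R v)"
  using weak_curlI[of "u + v" "R u + R v"] by (auto simp: ip_add curl_ip)

lemma curl_diff: "u \<in> Hcurl \<Omega> \<Longrightarrow> v \<in> Hcurl \<Omega> \<Longrightarrow> u - v \<in> Hcurl \<Omega> \<and> eqv (R (u - v)) (R u - R v)"
  using weak_curlI[of "u - v" "R u - R v"] by (auto simp: ip_diff curl_ip)

lemma curl_scl: "u \<in> Hcurl \<Omega> \<Longrightarrow> scl H c u \<in> Hcurl \<Omega> \<and> eqv (R (scl H c u)) (scl H c (R u))"
  using weak_curlI[of "scl H c u" "scl H c (R u)"]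
  by (auto simp: ip_scl curl_ip simp del: L2_scl)

text \<open>The curl norm of \<open>u - f\<close> involves \<open>R (u - f)\<close>, which equals
  \<open>R u - R f\<close> only up to a null field. The right-hand side has the shape of the
  closedness condition of an adjoint pair.\<close>

lemma Hcurl0_iff:
  "u \<in> Hcurl0 \<Omega> \<longleftrightarrow> u \<in> Hcurl \<Omega> \<and> (\<forall>e>0. \<exists>f\<in>test_fields \<Omega>.
     hnorm H (u - f) < e \<and> hnorm H (R u - R f) < e)"
proof -
  have cn: "curl_norm \<Omega> (u - f) = sqrt ((hnorm H (u - f))\<^sup>2 + (hnorm H (R u - R f))\<^sup>2)"
    if "u \<in> Hcurl \<Omega>" "f \<in> test_fields \<Omega>" for f
    using eqv_hnorm[OF conjunct2[OF curl_diff[OF that(1) curl_test(1)[OF that(2)]]]]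
    by (simp add: curl_norm_def)
  show ?thesis
  proof (cases "u \<in> Hcurl \<Omega>")
    case True
    have "(\<forall>e>0. \<exists>f\<in>test_fields \<Omega>. curl_norm \<Omega> (u - f) < e) \<longleftrightarrow> (\<forall>e>0. \<exists>f\<in>test_fields \<Omega>.
       hnorm H (u - f) < e \<and> hnorm H (R u - R f) < e)" (is "?L \<longleftrightarrow> ?R")
    proof
      assume L: ?L
      show ?R
      proof (intro allI impI)
        fix e :: real assume "e > 0"
        then obtain f where f: "f \<in> test_fields \<Omega>" "curl_norm \<Omega> (u - f) < e" using L by blast
        have "hnorm H (u - f) \<le> curl_norm \<Omega> (u - f)" "hnorm H (R u - R f) \<le> curl_norm \<Omega> (u - f)"
          unfolding cn[OF True f(1)] by (auto intro: real_le_rsqrt)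
        then show "\<exists>f\<in>test_fields \<Omega>. hnorm H (u - f) < e \<and> hnorm H (R u - R f) < e"
          using f by (intro bexI[of _ f]) auto
      qed
    next
      assume R: ?R
      show ?L
      proof (intro allI impI)
        fix e :: real assume "e > 0"
        then obtain f where f: "f \<in> test_fields \<Omega>" "hnorm H (u - f) < e / 2" "hnorm H (R u - R f) < e / 2"
          using R half_gt_zero by blast
        have "curl_norm \<Omega> (u - f) \<le> hnorm H (u - f) + hnorm H (R u - R f)"
          unfolding cn[OF True f(1)] using True f(1) curl_test by (intro sqrt_sum_squares_le_sum) auto
        then show "\<exists>f\<in>test_fields \<Omega>. curl_norm \<Omega> (u - f) < e" using f by (intro bexI[of _ f]) auto
      qed
    qed
    then show ?thesis using True by (simp add: Hcurl0_def)
  qed (simp add: Hcurl0_def)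
qed

lemma test_Hcurl0: "f \<in> test_fields \<Omega> \<Longrightarrow> f \<in> Hcurl0 \<Omega>"
  unfolding Hcurl0_iff using curl_test(1) by (auto intro!: bexI[of _ f])

lemma Hcurl0_D: "u \<in> Hcurl0 \<Omega> \<Longrightarrow> u \<in> Hcurl \<Omega>"
  by (simp add: Hcurl0_def)

lemma Hcurl0_approx:
  assumes "u \<in> Hcurl0 \<Omega>" "e > 0"
  obtains f where "f \<in> test_fields \<Omega>" "f \<in> Hcurl \<Omega>" "hnorm H (u - f) < e" "hnorm H (R u - R f) < e"
  using assms Hcurl0_iff curl_test(1) by blast

text \<open>Green's formula for a test field is the definition of the weak curl, and density extends
  it to \<open>Hcurl0\<close>. Conversely test fields belong to \<open>Hcurl0\<close>, so the
  adjoint identity contains the weak identity, and \<open>weak_curlI\<close> applies.\<close>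

lemma adjoint_pair_curl: "adjoint_pair H (Hcurl0 \<Omega>) (Hcurl \<Omega>) R"
proof (rule adjoint_pair.intro[OF semi_hilbert_L2 adjoint_pair_axioms.intro])
  show "u + v \<in> Hcurl0 \<Omega>" if u: "u \<in> Hcurl0 \<Omega>" and v: "v \<in> Hcurl0 \<Omega>" for u v
    unfolding Hcurl0_iff
  proof (intro conjI allI impI)
    note D = Hcurl0_D[OF u] Hcurl0_D[OF v]
    show "u + v \<in> Hcurl \<Omega>" using curl_add[OF D] by simp
    fix e :: real assume "e > 0"
    then have "e / 2 > 0" by simp
    obtain f where f: "f \<in> test_fields \<Omega>" "f \<in> Hcurl \<Omega>" "hnorm H (u - f) < e / 2" "hnorm H (R u - R f) < e / 2"
      using Hcurl0_approx[OF u \<open>e / 2 > 0\<close>] by blast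
    obtain g where g: "g \<in> test_fields \<Omega>" "g \<in> Hcurl \<Omega>" "hnorm H (v - g) < e / 2" "hnorm H (R v - R g) < e / 2"
      using Hcurl0_approx[OF v \<open>e / 2 > 0\<close>] by blast
    have "hnorm H ((u + v) - (f + g)) \<le> hnorm H (u - f) + hnorm H (v - g)"
      using hnorm_triangle[of "u - f" "v - g"] D f g by (simp add: algebra_simps)
    then have 1: "hnorm H ((u + v) - (f + g)) < e" using f(3) g(3) by linarith
    have "eqv (R (u + v) - R (f + g)) ((R u - R f) + (R v - R g))"
      using curl_add[OF D] curl_add[OF f(2) g(2)] D f g
      by (auto intro!: eqv_ipI simp: ip_simps eqv_ip)
    then have "hnorm H (R (u + v) - R (f + g)) \<le> hnorm H (R u - R f) + hnorm H (R v - R g)"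
      using hnorm_triangle[of "R u - R f" "R v - R g"] D f g by (simp add: eqv_hnorm)
    then have 2: "hnorm H (R (u + v) - R (f + g)) < e" using f(4) g(4) by linarith
    show "\<exists>f\<in>test_fields \<Omega>. hnorm H (u + v - f) < e \<and> hnorm H (R (u + v) - R f) < e"
      using 1 2 test_field_add[OF f(1) g(1)] by blast
  qed
  show "scl H c u \<in> Hcurl0 \<Omega>" if u: "u \<in> Hcurl0 \<Omega>" for u c
    unfolding Hcurl0_iff
  proof (intro conjI allI impI)
    note D = Hcurl0_D[OF u]
    show "scl H c u \<in> Hcurl \<Omega>" using curl_scl[OF D] by blast
    fix e :: real assume "e > 0"
    \<comment> \<open>The summand \<open>1\<close> covers \<open>c = 0\<close>.\<close>
    then have "e / (cmod c + 1) > 0" by (simp add: add_nonneg_pos)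
    then obtain f where f: "f \<in> test_fields \<Omega>" "f \<in> Hcurl \<Omega>" "hnorm H (u - f) < e / (cmod c + 1)"
      "hnorm H (R u - R f) < e / (cmod c + 1)"
      using Hcurl0_approx[OF u] by blast
    have lt: "cmod c * t < e" if "t < e / (cmod c + 1)" "t \<ge> 0" for t
    proof -
      have "cmod c * t \<le> (cmod c + 1) * t" using that by (intro mult_right_mono) auto
      also have "\<dots> < (cmod c + 1) * (e / (cmod c + 1))" using that by (intro mult_strict_left_mono) (auto simp: add_nonneg_pos)
      also have "\<dots> = e"
      proof -
        have "cmod c + 1 \<noteq> 0" using norm_ge_zero[of c] by linarith
        then show ?thesis by simp
      qed
      finally show ?thesis .
    qed
    have "hnorm H (scl H c u - scl H c f) = cmod c * hnorm H (u - f)"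
      unfolding vs.scale_right_diff_distrib[symmetric] using D f by (intro hnorm_scl) auto
    then have 1: "hnorm H (scl H c u - scl H c f) < e" using lt[OF f(3)] D f by simp
    have "eqv (R (scl H c u) - R (scl H c f)) (scl H c (R u - R f))"
      using curl_scl[OF D, of c] curl_scl[OF f(2), of c] D f
      by (auto intro!: eqv_ipI simp: ip_simps eqv_ip right_diff_distrib simp del: L2_scl)
    then have "hnorm H (R (scl H c u) - R (scl H c f)) = cmod c * hnorm H (R u - R f)"
      using D f hnorm_scl[of "R u - R f" c] eqv_hnorm by simp
    then have 2: "hnorm H (R (scl H c u) - R (scl H c f)) < e" using lt[OF f(4)] D f by simp
    have "scl H c f \<in> test_fields \<Omega>" using test_field_scale[OF f(1)] by simp
    then show "\<exists>f\<in>test_fields \<Omega>. hnorm H (scl H c u - f) < e \<and> hnorm H (R (scl H c u) - R f) < e"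
      using 1 2 by blast
  qed
  show "ip H (R v) u = ip H v (R u)" if u: "u \<in> Hcurl0 \<Omega>" and v: "v \<in> Hcurl \<Omega>" for u v
  proof -
    note D = Hcurl0_D[OF u]
    define C where "C = hnorm H (R v) + hnorm H v"
    have C: "C \<ge> 0" using v by (simp add: C_def)
    have "cmod (ip H (R v) u - ip H v (R u)) \<le> 0 + e" if e: "e > 0" for e
    proof -
      \<comment> \<open>The approximation error in Green's formula is at most \<open>C * e'\<close>;
        dividing by \<open>C + 1\<close> makes it at most \<open>e\<close> and avoids division by
        zero.\<close>
      define e' where "e' = e / (C + 1)"
      have e': "e' > 0" using e C by (simp add: e'_def)
      obtain f where f: "f \<in> test_fields \<Omega>" "f \<in> Hcurl \<Omega>" "hnorm H (u - f) < e'" "hnorm H (R u - R f) < e'"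
        using Hcurl0_approx[OF u e'] by blast
      have "ip H v (R f) = cnj (ip H (classical_curl f) v)"
        using eqv_ip[OF curl_test(2)[OF f(1)], of v] v f ip_cnj[of "R f" v] by simp
      also have "\<dots> = ip H (R v) f"
        using curl_ip[OF v f(1)] v f ip_cnj[of "classical_curl f" v] by simp
      finally have "ip H (R v) u - ip H v (R u) = ip H (R v) (u - f) - ip H v (R u - R f)"
        using v D f by (simp add: ip_diff_right)
      also have "cmod \<dots> \<le> cmod (ip H (R v) (u - f)) + cmod (ip H v (R u - R f))"
        by (rule norm_triangle_ineq4)
      also have "\<dots> \<le> hnorm H (R v) * hnorm H (u - f) + hnorm H v * hnorm H (R u - R f)"
        using v D f by (intro add_mono Cauchy_Schwarz) auto
      also have "\<dots> \<le> hnorm H (R v) * e' + hnorm H v * e'"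
        using v f by (intro add_mono mult_left_mono) auto
      also have "\<dots> \<le> (C + 1) * e'" using e' by (simp add: C_def algebra_simps)
      also have "\<dots> = e" using C by (simp add: e'_def)
      finally show ?thesis by simp
    qed
    then have "cmod (ip H (R v) u - ip H v (R u)) \<le> 0" by (rule field_le_epsilon)
    then show ?thesis by simp
  qed
  show "q \<in> Hcurl \<Omega> \<and> hnorm H (R q - p) = 0"
    if q: "q \<in> carr H" and p: "p \<in> carr H"
      and orth: "\<And>u. u \<in> Hcurl0 \<Omega> \<Longrightarrow> ip H p u = ip H q (R u)" for q p
  proof -
    have "ip H p f = ip H q (classical_curl f)" if f: "f \<in> test_fields \<Omega>" for f
    proof -
      have "ip H q (R f) = ip H q (classical_curl f)"
        using eqv_ip[OF curl_test(2)[OF f] q] q f curl_test(1)[OF f]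
          ip_cnj[of "R f" q] ip_cnj[of "classical_curl f" q] by simp
      then show ?thesis using orth[OF test_Hcurl0[OF f]] by simp
    qed
    from weak_curlI[OF q p this] show ?thesis by (simp add: eqv_def)
  qed
  show "u \<in> Hcurl0 \<Omega>" if u: "u \<in> Hcurl \<Omega>"
    and close: "\<And>e. e > 0 \<Longrightarrow> \<exists>v\<in>Hcurl0 \<Omega>. hnorm H (u - v) < e \<and> hnorm H (R u - R v) < e" for u
    unfolding Hcurl0_iff
  proof (intro conjI allI impI u)
    fix e :: real assume "e > 0"
    then have e: "e / 2 > 0" by simp
    obtain v where v: "v \<in> Hcurl0 \<Omega>" "hnorm H (u - v) < e / 2" "hnorm H (R u - R v) < e / 2"
      using close[OF e] by blast
    obtain f where f: "f \<in> test_fields \<Omega>" "f \<in> Hcurl \<Omega>" "hnorm H (v - f) < e / 2" "hnorm H (R v - R f) < e / 2"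
      using Hcurl0_approx[OF v(1) e] by blast
    note D = Hcurl0_D[OF v(1)]
    have "hnorm H (u - f) < e"
      using hnorm_triangle_via[of u v f] u D f v by simp
    moreover have "hnorm H (R u - R f) < e"
      using hnorm_triangle_via[of "R u" "R v" "R f"] u D f v by simp
    ultimately show "\<exists>f\<in>test_fields \<Omega>. hnorm H (u - f) < e \<and> hnorm H (R u - R f) < e"
      using f(1) by blast
  qed
qed (auto simp: Hcurl0_D test_Hcurl0 test_field_zero)

end

section \<open>The Drude--Lorentz pencils\<close>

lemma Theta_measurable:
  assumes "\<theta> \<in> Linfty \<Omega>"
  shows "Theta \<gamma> \<theta> \<omega> \<in> borel_measurable (lebesgue_on \<Omega>)"
proof -
  have [measurable]: "\<theta> \<in> borel_measurable (lebesgue_on \<Omega>)" using assms by (simp add: Linfty_def)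
  show ?thesis unfolding Theta_def[abs_def] by measurable
qed

lemma Theta_bounded:
  assumes "\<theta> \<in> Linfty \<Omega>"
  obtains B where "B > 0" "AE x in lebesgue_on \<Omega>. cmod (Theta \<gamma> \<theta> \<omega> x) \<le> B"
proof -
  obtain C where C: "AE x in lebesgue_on \<Omega>. \<bar>\<theta> x\<bar> \<le> C" using assms by (auto simp: Linfty_def)
  let ?z = "\<omega>\<^sup>2 + \<i> * of_real \<gamma> * \<omega>"
  \<comment> \<open>The summand \<open>1\<close> makes the bound positive, as its square becomes the
    denominator of the coercivity constant.\<close>
  have "AE x in lebesgue_on \<Omega>. cmod (Theta \<gamma> \<theta> \<omega> x) \<le> cmod ?z + C\<^sup>2 + 1"
    using C
  proof eventually_elim
    case (elim x)
    have "cmod (Theta \<gamma> \<theta> \<omega> x) \<le> cmod ?z + cmod (of_real ((\<theta> x)\<^sup>2))"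
      unfolding Theta_def by (rule norm_triangle_ineq4)
    also have "cmod (of_real ((\<theta> x)\<^sup>2)) = (\<theta> x)\<^sup>2" by (simp only: norm_of_real abs_power2)
    also have "(\<theta> x)\<^sup>2 \<le> C\<^sup>2" using elim by (simp add: abs_le_square_iff[symmetric])
    finally show ?case by simp
  qed
  moreover have "cmod ?z + C\<^sup>2 + 1 > 0"
    by (intro add_nonneg_pos add_nonneg_nonneg) auto
  ultimately show thesis using that by blast
qed

text \<open>The potential is real and drops out. For \<open>\<gamma> = \<gamma>m\<close> the value
  is twice the product whose nonvanishing defines \<open>Sigma_set\<close>.\<close>

lemma Im_Theta: "Im (Theta \<gamma> \<theta> \<omega> x) = Re \<omega> * (2 * Im \<omega> + \<gamma>)"
  by (simp add: Theta_def power2_eq_square algebra_simps)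

lemma Sigma_setD:
  assumes "\<omega> \<in> Sigma_set \<gamma>m"
  shows "\<omega> + \<i> * of_real \<gamma> \<noteq> 0" "\<omega> \<noteq> - \<i> * of_real \<gamma>" "Re \<omega> * (2 * Im \<omega> + \<gamma>m) \<noteq> 0"
  using assms by (auto simp: Sigma_set_def complex_eq_iff)

text \<open>On \<open>Sigma_set \<gamma>m\<close> the imaginary part of \<open>Theta \<gamma>m \<theta>m \<omega>\<close> is a nonzero constant,
  so a rotation by \<open>\<i>\<close> or \<open>- \<i>\<close> makes \<open>1 / Theta \<gamma>m \<theta>m \<omega>\<close> coercive.\<close>

lemma schur_pencil_maxwell:
  assumes \<Omega>: "open \<Omega>" and \<theta>e: "\<theta>e \<in> Linfty \<Omega>" and \<theta>m: "\<theta>m \<in> Linfty \<Omega>"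
    and \<omega>: "\<omega> \<in> Sigma_set \<gamma>m"
  obtains \<kappa> \<delta> where "schur_pencil (L2 \<Omega>) (Hcurl0 \<Omega>) (Hcurl \<Omega>) (omap (curl \<Omega>))
    (mult_op (Theta \<gamma>e \<theta>e \<omega>)) (mult_op (\<lambda>x. inverse (Theta \<gamma>m \<theta>m \<omega> x))) (mult_op (Theta \<gamma>m \<theta>m \<omega>))
    (mult_op (\<lambda>x. cnj (Theta \<gamma>e \<theta>e \<omega> x))) (mult_op (\<lambda>x. cnj (inverse (Theta \<gamma>m \<theta>m \<omega> x))))
    (- 1 / (\<omega> + \<i> * of_real \<gamma>m)) \<kappa> \<delta>"
proof -
  interpret open_domain \<Omega> by unfold_locales (rule \<Omega>)
  interpret adjoint_pair "L2 \<Omega>" "Hcurl0 \<Omega>" "Hcurl \<Omega>" "omap (curl \<Omega>)" by (rule adjoint_pair_curl)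
  let ?E = "Theta \<gamma>e \<theta>e \<omega>" and ?Q = "Theta \<gamma>m \<theta>m \<omega>"
  let ?M = "lebesgue_on \<Omega>"
  define c where "c = Re \<omega> * (2 * Im \<omega> + \<gamma>m)"
  have c: "c \<noteq> 0" using Sigma_setD(3)[OF \<omega>] by (simp add: c_def)
  have ImQ: "Im (?Q x) = c" for x by (simp add: Im_Theta c_def)
  have Q0: "?Q x \<noteq> 0" for x using ImQ[of x] c by auto
  have lower: "\<bar>c\<bar> \<le> cmod (?Q x)" for x using abs_Im_le_cmod[of "?Q x"] ImQ by simp
  obtain Be where Be: "AE x in ?M. cmod (?E x) \<le> Be" using Theta_bounded[OF \<theta>e] by blast
  obtain B where B: "B > 0" "AE x in ?M. cmod (?Q x) \<le> B" using Theta_bounded[OF \<theta>m] by blast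
  note [measurable] = Theta_measurable[OF \<theta>e] Theta_measurable[OF \<theta>m]
  have inv_le: "AE x in ?M. cmod (inverse (?Q x)) \<le> 1 / \<bar>c\<bar>"
    using lower c by (intro AE_I2) (simp add: norm_inverse divide_inverse le_imp_inverse_le)
  \<comment> \<open>Multiplying by \<open>\<i>\<close> moves the imaginary part of
    \<open>?Q x\<close> into the real part of the inverse: the real part of
    \<open>\<kappa> / ?Q x\<close> is \<open>sgn c * c\<close> over the squared modulus of
    \<open>?Q x\<close>. The bound \<open>B\<close> from above on the modulus then gives
    \<open>\<delta>\<close>.\<close>
  define \<kappa> where "\<kappa> = \<i> * of_real (sgn c)"
  define \<delta> where "\<delta> = \<bar>c\<bar> / B\<^sup>2"
  have Pm: "(\<lambda>x. inverse (?Q x)) \<in> borel_measurable ?M" by measurable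
  have Re_eq: "Re (\<kappa> * inverse (?Q x)) = \<bar>c\<bar> / (cmod (?Q x))\<^sup>2" for x
  proof -
    have "\<bar>c\<bar> = sgn c * c" by (simp add: abs_sgn mult.commute)
    then show ?thesis by (simp add: \<kappa>_def ImQ cmod_power2)
  qed
  have re: "AE x in ?M. \<delta> \<le> Re (\<kappa> * inverse (?Q x))"
    using B(2)
  proof eventually_elim
    case (elim x)
    have "(cmod (?Q x))\<^sup>2 \<le> B\<^sup>2" using elim by (intro power_mono) auto
    then have "\<bar>c\<bar> / B\<^sup>2 \<le> \<bar>c\<bar> / (cmod (?Q x))\<^sup>2"
      using Q0[of x] B(1) by (intro divide_left_mono) auto
    then show ?case unfolding Re_eq \<delta>_def .
  qed
  have "schur_pencil (L2 \<Omega>) (Hcurl0 \<Omega>) (Hcurl \<Omega>) (omap (curl \<Omega>))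
    (mult_op ?E) (mult_op (\<lambda>x. inverse (?Q x))) (mult_op ?Q)
    (mult_op (\<lambda>x. cnj (?E x))) (mult_op (\<lambda>x. cnj (inverse (?Q x))))
    (- 1 / (\<omega> + \<i> * of_real \<gamma>m)) \<kappa> \<delta>"
  proof (intro schur_pencil.intro adjoint_pair_curl schur_pencil_axioms.intro)
    show "bdd_op (mult_op ?E)" by (rule bdd_op_mult[OF _ Be]) measurable
    show "bdd_op (mult_op (\<lambda>x. inverse (?Q x)))" by (rule bdd_op_mult[OF Pm inv_le])
    show "bdd_op (mult_op ?Q)" by (rule bdd_op_mult[OF _ B(2)]) measurable
    show "bdd_op (mult_op (\<lambda>x. cnj (inverse (?Q x))))"
    proof (rule bdd_op_mult)
      show "AE x in ?M. cmod (cnj (inverse (?Q x))) \<le> 1 / \<bar>c\<bar>" using inv_le by (simp only: complex_mod_cnj)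
    qed measurable
    have bE': "bdd_op (mult_op (\<lambda>x. cnj (?E x)))"
    proof (rule bdd_op_mult)
      show "AE x in ?M. cmod (cnj (?E x)) \<le> Be" using Be by (simp only: complex_mod_cnj)
    qed measurable
    show "mult_op (\<lambda>x. cnj (?E x)) u \<in> carr (L2 \<Omega>)" if "u \<in> carr (L2 \<Omega>)" for u
      by (rule bdd_op_carr[OF bE' that])
    show "mult_op (\<lambda>x. inverse (?Q x)) (mult_op ?Q u) = u" "mult_op ?Q (mult_op (\<lambda>x. inverse (?Q x)) u) = u" for u
      using Q0 by (simp_all add: mult_op_def fun_eq_iff vector_smult_assoc)
    show "\<delta> * (hnorm (L2 \<Omega>) w)\<^sup>2 \<le> Re (\<kappa> * ip (L2 \<Omega>) (mult_op (\<lambda>x. inverse (?Q x)) w) w)"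
      if "w \<in> carr (L2 \<Omega>)" for w
      by (rule mult_op_coercive[OF that Pm inv_le re])
    show "- 1 / (\<omega> + \<i> * of_real \<gamma>m) \<noteq> 0" using Sigma_setD(1)[OF \<omega>] by simp
    show "\<kappa> \<noteq> 0" using c by (simp add: \<kappa>_def sgn_zero_iff)
    show "\<delta> > 0" using c B by (simp add: \<delta>_def)
  qed (rule mult_op_adjoint)+
  then show thesis by (rule that)
qed

lemma maxwell_spectra_agree:
  fixes \<gamma>e \<gamma>m :: real
  assumes \<Omega>: "open \<Omega>" and \<theta>e: "\<theta>e \<in> Linfty \<Omega>" and \<theta>m: "\<theta>m \<in> Linfty \<Omega>"
    and \<omega>: "\<omega> \<in> Sigma_set \<gamma>m"
  defines "T \<equiv> L_op \<Omega> \<gamma>e \<gamma>m \<theta>e \<theta>m \<omega>" and "S \<equiv> S1_op \<Omega> \<gamma>e \<gamma>m \<theta>e \<theta>m \<omega>"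
    and "K \<equiv> hsum (L2 \<Omega>) (L2 \<Omega>)"
  shows "0 \<in> spectrum K T \<longleftrightarrow> 0 \<in> spectrum (L2 \<Omega>) S"
    "0 \<in> point_spectrum K T \<longleftrightarrow> 0 \<in> point_spectrum (L2 \<Omega>) S"
    "0 \<in> continuous_spectrum K T \<longleftrightarrow> 0 \<in> continuous_spectrum (L2 \<Omega>) S"
    "0 \<in> residual_spectrum K T \<longleftrightarrow> 0 \<in> residual_spectrum (L2 \<Omega>) S"
    "0 \<in> essential_spectrum K T \<longleftrightarrow> 0 \<in> essential_spectrum (L2 \<Omega>) S"
proof -
  obtain \<kappa> \<delta> where "schur_pencil (L2 \<Omega>) (Hcurl0 \<Omega>) (Hcurl \<Omega>) (omap (curl \<Omega>))
    (mult_op (Theta \<gamma>e \<theta>e \<omega>)) (mult_op (\<lambda>x. inverse (Theta \<gamma>m \<theta>m \<omega> x))) (mult_op (Theta \<gamma>m \<theta>m \<omega>))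
    (mult_op (\<lambda>x. cnj (Theta \<gamma>e \<theta>e \<omega> x))) (mult_op (\<lambda>x. cnj (inverse (Theta \<gamma>m \<theta>m \<omega> x))))
    (- 1 / (\<omega> + \<i> * of_real \<gamma>m)) \<kappa> \<delta>"
    by (rule schur_pencil_maxwell[OF \<Omega> \<theta>e \<theta>m \<omega>])
  \<comment> \<open>The locale predicate carries no argument for \<open>a\<close>, on which the
    locale imposes no condition; its value
    \<open>- 1 / (\<omega> + \<i> * of_real \<gamma>e)\<close> is supplied here.\<close>
  then interpret schur_pencil "L2 \<Omega>" "Hcurl0 \<Omega>" "Hcurl \<Omega>" "omap (curl \<Omega>)"
    "mult_op (Theta \<gamma>e \<theta>e \<omega>)" "mult_op (\<lambda>x. inverse (Theta \<gamma>m \<theta>m \<omega> x))" "mult_op (Theta \<gamma>m \<theta>m \<omega>)"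
    "mult_op (\<lambda>x. cnj (Theta \<gamma>e \<theta>e \<omega> x))" "mult_op (\<lambda>x. cnj (inverse (Theta \<gamma>m \<theta>m \<omega> x)))"
    "- 1 / (\<omega> + \<i> * of_real \<gamma>e)" "- 1 / (\<omega> + \<i> * of_real \<gamma>m)" \<kappa> \<delta> .
  \<comment> \<open>This identifies \<open>a E\<close> and \<open>b Q\<close> with the diagonal
    entries of the pencil. The denominators are nonzero since points of \<open>Sigma_set\<close>
    have nonzero real part.\<close>
  have coeff: "- 1 / (\<omega> + \<i> * of_real \<gamma>) * Theta \<gamma> \<theta> \<omega> x = - \<omega> + of_real ((\<theta> x)\<^sup>2) / (\<omega> + \<i> * of_real \<gamma>)"
    for \<gamma> \<theta> x
  proof -
    have "Theta \<gamma> \<theta> \<omega> x = (\<omega> + \<i> * of_real \<gamma>) * \<omega> - of_real ((\<theta> x)\<^sup>2)"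
      by (simp add: Theta_def power2_eq_square algebra_simps)
    moreover have "- 1 / z * (z * w - t) = - w + t / z" if "z \<noteq> 0" for z w t :: complex
      using that by (simp add: field_simps)
    ultimately show ?thesis using Sigma_setD(1)[OF \<omega>, of \<gamma>] by simp
  qed
  have c0: "omap (curl0 \<Omega>) = omap (curl \<Omega>)" by (simp add: curl0_def)
  have "block_op = T"
    unfolding block_op_def T_def L_op_def c0 row1_def row2_def L2_scl mult_op_def plus_fun_def
      vector_smult_assoc coeff by simp
  moreover have "schur_op = S"
    unfolding schur_op_def S_def S1_op_def c0 schur_def[abs_def] domS_def L2_scl mult_op_def fun_diff_def
      vector_smult_assoc by (simp add: mult.commute)
  ultimately show "0 \<in> spectrum K T \<longleftrightarrow> 0 \<in> spectrum (L2 \<Omega>) S"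
    "0 \<in> point_spectrum K T \<longleftrightarrow> 0 \<in> point_spectrum (L2 \<Omega>) S"
    "0 \<in> continuous_spectrum K T \<longleftrightarrow> 0 \<in> continuous_spectrum (L2 \<Omega>) S"
    "0 \<in> residual_spectrum K T \<longleftrightarrow> 0 \<in> residual_spectrum (L2 \<Omega>) S"
    "0 \<in> essential_spectrum K T \<longleftrightarrow> 0 \<in> essential_spectrum (L2 \<Omega>) S"
    using spectra_agree unfolding K_def by simp_all
qed

theorem proposition2p12:
  fixes \<Omega> :: "(real^3) set" and \<gamma>e \<gamma>m :: real and \<theta>e \<theta>m :: "real^3 \<Rightarrow> real"
  assumes "lipschitz_domain \<Omega>"
    and "\<gamma>e > 0" and "\<gamma>m > 0"
    and "\<theta>e \<in> Linfty \<Omega>" and "AE x in lebesgue_on \<Omega>. \<theta>e x \<ge> 0"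
    and "\<theta>m \<in> Linfty \<Omega>" and "AE x in lebesgue_on \<Omega>. \<theta>m x \<ge> 0"
  shows "let \<L> = L_op \<Omega> \<gamma>e \<gamma>m \<theta>e \<theta>m;
             \<S> = S1_op \<Omega> \<gamma>e \<gamma>m \<theta>e \<theta>m;
             D = UNIV - {- \<i> * of_real \<gamma>e, - \<i> * of_real \<gamma>m};
             \<Sigma> = Sigma_set \<gamma>m;
             H = L2 \<Omega>;
             K = hsum (L2 \<Omega>) (L2 \<Omega>)
         in pencil_set (spectrum K) D \<L> \<inter> \<Sigma> = pencil_set (spectrum H) \<Sigma> \<S> \<inter> \<Sigma>
          \<and> pencil_set (point_spectrum K) D \<L> \<inter> \<Sigma> = pencil_set (point_spectrum H) \<Sigma> \<S> \<inter> \<Sigma>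
          \<and> pencil_set (continuous_spectrum K) D \<L> \<inter> \<Sigma> = pencil_set (continuous_spectrum H) \<Sigma> \<S> \<inter> \<Sigma>
          \<and> pencil_set (residual_spectrum K) D \<L> \<inter> \<Sigma> = pencil_set (residual_spectrum H) \<Sigma> \<S> \<inter> \<Sigma>
          \<and> pencil_set (essential_spectrum K) D \<L> \<inter> \<Sigma> = pencil_set (essential_spectrum H) \<Sigma> \<S> \<inter> \<Sigma>"
proof -
  have \<Omega>: "open \<Omega>" using assms(1) by (simp add: lipschitz_domain_def)
  \<comment> \<open>The excluded points are purely imaginary, so the domain of the pencil contains
    all of \<open>Sigma_set\<close> and the intersections compare the spectra point by
    point.\<close>
  have "\<omega> \<in> UNIV - {- \<i> * of_real \<gamma>e, - \<i> * of_real \<gamma>m}" if "\<omega> \<in> Sigma_set \<gamma>m" for \<omega>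
    using Sigma_setD(2)[OF that] by blast
  with maxwell_spectra_agree[OF \<Omega> assms(4,6)] show ?thesis
    unfolding Let_def pencil_set_def by blast
qed

end
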